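(* Let $x_1,\dots,x_n\in\mathbb R^d$ and let $p\ge0$ be the smallest integer such that $\mathrm{rank}\,V_{\le p}=n$ (so $\mathrm{rank}\,V_{\le p-1}<n$), where $V_{\le p}=(V_0\ V_1\ \cdots\ V_p)$ is the multivariate Vandermonde matrix of the nodes. Let $k$ be a positive definite kernel function on $\mathbb R^d$ such that either (a) $k$ is radial, $k(x,y)=\psi(\|x-y\|)$ with $\psi$ analytic at $0$, with regularity index $r\ge p+1$ ($r=\infty$ allowed); or (b) $k\in\mathcal C^{p+1,p+1}$ and the kernel matrix $K(\varepsilon)$ is analytic in $\varepsilon$ near $0$. Let $K(\varepsilon)=[k(\varepsilon x_i,\varepsilon x_j)]_{i,j=1}^n$, let $Q_0,\dots,Q_p$ and $R_{0,0},\dots,R_{p,p}$ come from the block QR factorisation of $V_{\le p}$, and let $S_0,\dots,S_p$ be the Schur complements of the block matrix $$H=\mathrm{diag}(R_{0,0},\dots,R_{p,p})\,W_{\le p,\le p}\,\mathrm{diag}(R_{0,0}^T,\dots,R_{p,p}^T),$$ where $W_{\le p,\le p}$ is the Wronskian matrix of $k$. Then the asymptotic spectral equivalent of $K$ is $$\underline K(\varepsilon)=\sum_{i=0}^p\varepsilon^{2i}\,Q_iS_iQ_i^T .$$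
   Context: Vandermonde matrices: for a multi-index $\alpha\in\mathbb N^d$, $x^\alpha=\prod x_i^{\alpha_i}$, $|\alpha|=\sum\alpha_i$, $\alpha!=\prod\alpha_i!$. $V_s=[x_i^{\alpha}]_{1\le i\le n,\,|\alpha|=s}$, $V_{\le s}=(V_0\ \cdots\ V_s)$, with a fixed ordering of the monomials of each degree; $\mathrm{rank}\,V_{\le-1}=0$. There are $\mathcal H_{s,d}=\binom{s+d-1}{d-1}$ monomials of degree $s$. Kernels: a positive definite kernel is a symmetric function $k:\mathbb R^d\times\mathbb R^d\to\mathbb R$ whose kernel matrices $[k(y_i,y_j)]$ at finitely many distinct points are positive definite. For a radial kernel with $\psi(s)=\psi_0+\psi_1s+\psi_2s^2+\cdots$, the regularity index $r$ is the integer with $\psi_{2r-1}\ne0$ and $\psi_{2c-1}=0$ for all $1\le c<r$ ($r=\infty$ if all odd coefficients vanish); $K(\varepsilon)=[\psi(\varepsilon\|x_i-x_j\|)]$ is regarded as an analytic matrix in $\varepsilon$ via the power series of $\psi$. $k\in\mathcal C^{q,q}$ means that all partial derivatives $\partial_x^{\alpha}\partial_y^{\beta}k$ with $|\alpha|,|\beta|\le q$ exist and are continuous near $(0,0)$. Wronskian: $W_{i,j}=\left[\frac{1}{\alpha!\beta!}\partial_x^\alpha\partial_y^\beta k(x,y)|_{x=y=0}\right]_{|\alpha|=i,|\beta|=j}$ (same ordering of multi-indices as in $V_i,V_j$), $W_{\le q,\le q}=(W_{i,j})_{i,j=0}^q$. Block QR: with $b_i=\mathrm{rank}\,V_{\le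 i}-\mathrm{rank}\,V_{\le i-1}$, $V_{\le p}=QR$ with $Q=(Q_0\cdots Q_p)$ orthogonal, $Q_i\in\mathbb R^{n\times b_i}$, $R$ block upper triangular with blocks $R_{i,j}\in\mathbb R^{b_i\times\mathcal H_{j,d}}$. Schur complements of $H=(H_{i,j})$, $H_{i,j}\in\mathbb R^{b_i\times b_j}$: $S_0=H_{0,0}$, $S_i=H_{i,i}-H_{i,<i}(H_{<i,<i})^{-1}H_{<i,i}$, where $H_{<i,<i}=(H_{k,l})_{k,l<i}$, $H_{i,<i}=(H_{i,0}\cdots H_{i,i-1})$, $H_{<i,i}=H_{i,<i}^T$. Asymptotic spectral equivalent (ASE): for a real symmetric $K(\varepsilon)$ analytic near $0$, take analytic eigenvalues $\lambda_k(\varepsilon)$ and analytic orthonormal eigenvectors $u_k(\varepsilon)$ (Rellich). If $\lambda_k\not\equiv0$, write $\lambda_k=\varepsilon^{\alpha}(\tilde\lambda_k+O(\varepsilon))$, $\tilde\lambda_k\ne0$, and $\mathrm{lt}(\lambda_k)=\tilde\lambda_k\varepsilon^\alpha$; otherwise $\mathrm{lt}(\lambda_k)=0$. The ASE is $\underline K(\varepsilon)=\sum_k\mathrm{lt}(\lambda_k)(\varepsilon)\,u_k(0)u_k(0)^T$ (independent of choices).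
   Formalization: The matrix H is additionally assumed nonsingular; without this the claim fails, e.g. for k(x,y)=exp(xy)-xy on the line with nodes 0 and 1, where S_1=0 but the second eigenvalue is of order ε^4. *)

theory Defs
  imports
    "HOL-Analysis.Analysis"
    "HOL-Library.Extended_Nat"
    "Jordan_Normal_Form.DL_Rank"
    "Jordan_Normal_Form.Gauss_Jordan_Elimination"
begin

text \<open>
  Points live in \<^typ>\<open>real ^ 'd\<close>, so that \<^term>\<open>CARD('d)\<close> is the dimension. Matrices have
  sizes that depend on ranks and are therefore matrices of the AFP entry Jordan\_Normal\_Form,
  with indices starting at 0; the nodes are \<open>x 0, \<dots>, x (n - 1)\<close>.
\<close>

hide_const (open) Finite_Cartesian_Product.vec Finite_Cartesian_Product.mat
  Finite_Cartesian_Product.row Finite_Cartesian_Product.rows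
  Cartesian_Space.rank
hide_type (open) Finite_Cartesian_Product.vec
unbundle no vec_syntax
no_notation inner (infix "\<bullet>" 70)


subsection \<open>Block matrices\<close>

definition hcat :: "nat \<Rightarrow> 'a mat list \<Rightarrow> 'a mat" where
  "hcat nr As = mat_of_cols nr (concat (map cols As))"

definition vcat :: "nat \<Rightarrow> 'a mat list \<Rightarrow> 'a mat" where
  "vcat nc As = mat_of_rows nc (concat (map rows As))"

text \<open>The block matrix \<open>(B i j)\<close>, \<open>i, j < m\<close>, where \<open>B i j\<close> is an \<open>nr i \<times> nc j\<close> matrix.\<close>

definition block_matrix ::
    "nat \<Rightarrow> (nat \<Rightarrow> nat) \<Rightarrow> (nat \<Rightarrow> nat) \<Rightarrow> (nat \<Rightarrow> nat \<Rightarrow> 'a mat) \<Rightarrow> 'a mat" where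
  "block_matrix m nr nc B =
     vcat (\<Sum>j<m. nc j) (map (\<lambda>i. hcat (nr i) (map (B i) [0..<m])) [0..<m])"

definition submatrix_at :: "'a mat \<Rightarrow> nat \<Rightarrow> nat \<Rightarrow> nat \<Rightarrow> nat \<Rightarrow> 'a mat" where
  "submatrix_at A r nr c nc = mat nr nc (\<lambda>(i, j). A $$ (r + i, c + j))"

definition matrix_sum :: "nat \<Rightarrow> nat \<Rightarrow> ('b \<Rightarrow> 'a::comm_monoid_add mat) \<Rightarrow> 'b set \<Rightarrow> 'a mat" where
  "matrix_sum nr nc A I = mat nr nc (\<lambda>(a, b). \<Sum>i\<in>I. A i $$ (a, b))"

text \<open>
  The Schur complement \<open>S\<^sub>i\<close> of a matrix \<open>H\<close> whose diagonal blocks have sizes \<open>b 0, b 1, \<dots>\<close>.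
  The block \<open>H\<^sub>i\<^sub>i\<close> starts at row and column \<open>m = b 0 + \<dots> + b (i - 1)\<close>.
\<close>

definition schur_complement :: "(nat \<Rightarrow> nat) \<Rightarrow> real mat \<Rightarrow> nat \<Rightarrow> real mat" where
  "schur_complement b H i =
     (if i = 0 then submatrix_at H 0 (b 0) 0 (b 0)
      else let m = (\<Sum>k<i. b k);
               H_ii = submatrix_at H m (b i) m (b i);
               H_il = submatrix_at H m (b i) 0 m;
               H_ll = submatrix_at H 0 m 0 m
           in H_ii - H_il * the (mat_inverse H_ll) * transpose_mat H_il)"


subsection \<open>Multi-indices and Vandermonde matrices\<close>

definition mi_degree :: "('d::finite \<Rightarrow> nat) \<Rightarrow> nat" where
  "mi_degree \<alpha> = (\<Sum>i\<in>UNIV. \<alpha> i)"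

definition mi_fact :: "('d::finite \<Rightarrow> nat) \<Rightarrow> real" where
  "mi_fact \<alpha> = (\<Prod>i\<in>UNIV. fact (\<alpha> i))"

definition monomial :: "('d::finite \<Rightarrow> nat) \<Rightarrow> real ^ 'd \<Rightarrow> real" where
  "monomial \<alpha> x = (\<Prod>i\<in>UNIV. vec_nth x i ^ \<alpha> i)"

definition monomial_ordering :: "(nat \<Rightarrow> ('d::finite \<Rightarrow> nat) list) \<Rightarrow> bool" where
  "monomial_ordering mons \<longleftrightarrow> (\<forall>s. distinct (mons s) \<and> set (mons s) = {\<alpha>. mi_degree \<alpha> = s})"

definition vandermonde ::
    "(nat \<Rightarrow> ('d::finite \<Rightarrow> nat) list) \<Rightarrow> nat \<Rightarrow> (nat \<Rightarrow> real ^ 'd) \<Rightarrow> nat \<Rightarrow> real mat" where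
  "vandermonde mons n x s = mat n (length (mons s)) (\<lambda>(i, j). monomial (mons s ! j) (x i))"

text \<open>
  \<open>vandermonde_lt mons n x s\<close> is \<open>V\<^bsub>\<le>s-1\<^esub>\<close>. For \<open>s = 0\<close> it has no columns, hence rank 0.
\<close>

definition vandermonde_lt ::
    "(nat \<Rightarrow> ('d::finite \<Rightarrow> nat) list) \<Rightarrow> nat \<Rightarrow> (nat \<Rightarrow> real ^ 'd) \<Rightarrow> nat \<Rightarrow> real mat" where
  "vandermonde_lt mons n x s = hcat n (map (vandermonde mons n x) [0..<s])"

abbreviation vandermonde_le ::
    "(nat \<Rightarrow> ('d::finite \<Rightarrow> nat) list) \<Rightarrow> nat \<Rightarrow> (nat \<Rightarrow> real ^ 'd) \<Rightarrow> nat \<Rightarrow> real mat" where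
  "vandermonde_le mons n x s \<equiv> vandermonde_lt mons n x (Suc s)"

definition rank_jump ::
    "(nat \<Rightarrow> ('d::finite \<Rightarrow> nat) list) \<Rightarrow> nat \<Rightarrow> (nat \<Rightarrow> real ^ 'd) \<Rightarrow> nat \<Rightarrow> nat" where
  "rank_jump mons n x i =
     vec_space.rank n (vandermonde_le mons n x i) - vec_space.rank n (vandermonde_lt mons n x i)"

definition block_QR ::
    "(nat \<Rightarrow> ('d::finite \<Rightarrow> nat) list) \<Rightarrow> nat \<Rightarrow> (nat \<Rightarrow> real ^ 'd) \<Rightarrow> nat \<Rightarrow>
     (nat \<Rightarrow> real mat) \<Rightarrow> (nat \<Rightarrow> nat \<Rightarrow> real mat) \<Rightarrow> bool" where
  "block_QR mons n x p Q R \<longleftrightarrow>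
     (let b = rank_jump mons n x; h = (\<lambda>j. length (mons j)); Qfull = hcat n (map Q [0..<Suc p])
      in (\<forall>i\<le>p. Q i \<in> carrier_mat n (b i)) \<and>
         Qfull \<in> carrier_mat n n \<and> transpose_mat Qfull * Qfull = 1\<^sub>m n \<and>
         (\<forall>i\<le>p. \<forall>j\<le>p. R i j \<in> carrier_mat (b i) (h j)) \<and>
         (\<forall>i\<le>p. \<forall>j<i. R i j = 0\<^sub>m (b i) (h j)) \<and>
         vandermonde_le mons n x p = Qfull * block_matrix (Suc p) b h R)"


subsection \<open>Partial derivatives and the Wronskian\<close>

definition partial_deriv :: "'v::real_normed_vector \<Rightarrow> ('v \<Rightarrow> real) \<Rightarrow> 'v \<Rightarrow> real" where
  "partial_deriv b f z = deriv (\<lambda>t. f (z + t *\<^sub>R b)) 0"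

definition iter_partial :: "'v::real_normed_vector list \<Rightarrow> ('v \<Rightarrow> real) \<Rightarrow> 'v \<Rightarrow> real" where
  "iter_partial bs f = foldr partial_deriv bs f"

text \<open>
  Directions in \<open>\<real>\<^sup>d \<times> \<real>\<^sup>d\<close> of the derivatives with respect to the coordinates \<open>us\<close> of the first
  argument, taken after those with respect to the coordinates \<open>vs\<close> of the second argument.
\<close>

definition xy_directions :: "'d::finite list \<Rightarrow> 'd list \<Rightarrow> ((real ^ 'd) \<times> (real ^ 'd)) list" where
  "xy_directions us vs = map (\<lambda>i. (axis i 1, 0)) us @ map (\<lambda>j. (0, axis j 1)) vs"

text \<open>
  The class \<open>C\<^bsup>q,q\<^esup>\<close> near the origin. As a partial derivative \<open>\<partial>\<^sub>x\<^sup>\<alpha>\<close> may be computed by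
  differentiating in any order of the coordinates, \<open>us\<close> and \<open>vs\<close> are arbitrary lists of
  coordinates, of length \<open>|\<alpha>|\<close> and \<open>|\<beta>|\<close>. A derivative exists when every
  differentiation that leads to it is possible; as the tails of the list of directions are of the
  same form, it suffices to demand this of the last one.
\<close>

definition C_class :: "nat \<Rightarrow> (real ^ 'd::finite \<Rightarrow> real ^ 'd \<Rightarrow> real) \<Rightarrow> bool" where
  "C_class q k \<longleftrightarrow>
     (\<exists>U. open U \<and> (0, 0) \<in> U \<and>
        (\<forall>us vs. length us \<le> q \<and> length vs \<le> q \<longrightarrow>
           (\<forall>b bs. xy_directions us vs = b # bs \<longrightarrow>
              (\<forall>z\<in>U. (\<lambda>t. iter_partial bs (case_prod k) (z + t *\<^sub>R b)) differentiable (at 0))) \<and>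
           continuous_on U (iter_partial (xy_directions us vs) (case_prod k))))"

text \<open>
  A list of coordinates in which each \<open>i\<close> occurs \<open>\<alpha> i\<close> times. The order of the list does not
  matter for the values below by the symmetry of mixed partial derivatives.
\<close>

definition mi_list :: "('d::finite \<Rightarrow> nat) \<Rightarrow> 'd list" where
  "mi_list \<alpha> = (SOME us. \<forall>i. count_list us i = \<alpha> i)"

definition mixed_partial ::
    "('d::finite \<Rightarrow> nat) \<Rightarrow> ('d \<Rightarrow> nat) \<Rightarrow> (real ^ 'd \<Rightarrow> real ^ 'd \<Rightarrow> real) \<Rightarrow>
     real ^ 'd \<Rightarrow> real ^ 'd \<Rightarrow> real" where
  "mixed_partial \<alpha> \<beta> k x y = iter_partial (xy_directions (mi_list \<alpha>) (mi_list \<beta>)) (case_prod k) (x, y)"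

definition wronskian_block ::
    "(nat \<Rightarrow> ('d::finite \<Rightarrow> nat) list) \<Rightarrow> (real ^ 'd \<Rightarrow> real ^ 'd \<Rightarrow> real) \<Rightarrow> nat \<Rightarrow> nat \<Rightarrow> real mat" where
  "wronskian_block mons k i j =
     mat (length (mons i)) (length (mons j))
       (\<lambda>(a, b). mixed_partial (mons i ! a) (mons j ! b) k 0 0
                  / (mi_fact (mons i ! a) * mi_fact (mons j ! b)))"

definition wronskian_le ::
    "(nat \<Rightarrow> ('d::finite \<Rightarrow> nat) list) \<Rightarrow> (real ^ 'd \<Rightarrow> real ^ 'd \<Rightarrow> real) \<Rightarrow> nat \<Rightarrow> real mat" where
  "wronskian_le mons k q =
     block_matrix (Suc q) (\<lambda>i. length (mons i)) (\<lambda>j. length (mons j)) (wronskian_block mons k)"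

text \<open>
  The Schur complements of \<open>H\<close> exist and are invertible only if \<open>H\<close> is nonsingular, and this does
  not follow from positive definiteness of \<open>k\<close>: for \<open>k(x,y) = exp(xy) - xy\<close> on the real line with
  nodes 0 and 1, \<open>H\<close> has rank 1, while the second eigenvalue of the kernel matrix is of exact order
  \<open>\<epsilon>\<^sup>4\<close> rather than \<open>\<epsilon>\<^sup>2\<close>.
\<close>

definition H_matrix ::
    "(nat \<Rightarrow> ('d::finite \<Rightarrow> nat) list) \<Rightarrow> (real ^ 'd \<Rightarrow> real ^ 'd \<Rightarrow> real) \<Rightarrow> nat \<Rightarrow>
     (nat \<Rightarrow> nat \<Rightarrow> real mat) \<Rightarrow> real mat" where
  "H_matrix mons k p R =
     diag_block_mat (map (\<lambda>i. R i i) [0..<Suc p])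
       * wronskian_le mons k p
       * diag_block_mat (map (\<lambda>i. transpose_mat (R i i)) [0..<Suc p])"


subsection \<open>Kernels\<close>

definition positive_definite_mat :: "real mat \<Rightarrow> bool" where
  "positive_definite_mat A \<longleftrightarrow>
     square_mat A \<and> transpose_mat A = A \<and>
     (\<forall>v\<in>carrier_vec (dim_row A). v \<noteq> 0\<^sub>v (dim_row A) \<longrightarrow> scalar_prod v (A *\<^sub>v v) > 0)"

definition positive_definite_kernel :: "('v \<Rightarrow> 'v \<Rightarrow> real) \<Rightarrow> bool" where
  "positive_definite_kernel k \<longleftrightarrow>
     (\<forall>x y. k x y = k y x) \<and>
     (\<forall>ys. distinct ys \<longrightarrow>
        positive_definite_mat (mat (length ys) (length ys) (\<lambda>(i, j). k (ys ! i) (ys ! j))))"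

text \<open>The least \<open>r \<ge> 1\<close> with \<open>\<psi>\<^bsub>2r-1\<^esub> \<noteq> 0\<close>; the infimum of the empty set is \<open>\<infinity>\<close>.\<close>

definition regularity_index :: "real fps \<Rightarrow> enat" where
  "regularity_index \<Psi> = (INF r\<in>{r. 1 \<le> r \<and> fps_nth \<Psi> (2 * r - 1) \<noteq> 0}. enat r)"

definition kernel_matrix ::
    "nat \<Rightarrow> (nat \<Rightarrow> real ^ 'd::finite) \<Rightarrow> (real ^ 'd \<Rightarrow> real ^ 'd \<Rightarrow> real) \<Rightarrow> real \<Rightarrow> real mat" where
  "kernel_matrix n x k \<epsilon> = mat n n (\<lambda>(i, j). k (\<epsilon> *\<^sub>R x i) (\<epsilon> *\<^sub>R x j))"

text \<open>
  For a radial kernel \<open>k(x,y) = \<psi>(\<parallel>x - y\<parallel>)\<close> this coincides with \<^const>\<open>kernel_matrix\<close> for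
  \<open>\<epsilon> \<ge> 0\<close>. It is analytic at 0, whereas \<^const>\<open>kernel_matrix\<close> depends on \<open>\<bar>\<epsilon>\<bar>\<close> only
  and is not analytic in general.
\<close>

definition radial_kernel_matrix ::
    "nat \<Rightarrow> (nat \<Rightarrow> real ^ 'd::finite) \<Rightarrow> (real \<Rightarrow> real) \<Rightarrow> real \<Rightarrow> real mat" where
  "radial_kernel_matrix n x \<psi> \<epsilon> = mat n n (\<lambda>(i, j). \<psi> (\<epsilon> * norm (x i - x j)))"


subsection \<open>Asymptotic spectral equivalents\<close>

definition analytic_at_0 :: "(real \<Rightarrow> real) \<Rightarrow> bool" where
  "analytic_at_0 f \<longleftrightarrow> (\<exists>F. f has_fps_expansion F)"

definition analytic_matrix_at_0 :: "nat \<Rightarrow> (real \<Rightarrow> real mat) \<Rightarrow> bool" where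
  "analytic_matrix_at_0 n K \<longleftrightarrow> (\<forall>i<n. \<forall>j<n. analytic_at_0 (\<lambda>\<epsilon>. K \<epsilon> $$ (i, j)))"

definition taylor_fps :: "(real \<Rightarrow> real) \<Rightarrow> real fps" where
  "taylor_fps f = (THE F. f has_fps_expansion F)"

definition leading_term :: "(real \<Rightarrow> real) \<Rightarrow> real \<Rightarrow> real" where
  "leading_term f \<epsilon> =
     (let F = taylor_fps f
      in if F = 0 then 0 else fps_nth F (subdegree F) * \<epsilon> ^ subdegree F)"

text \<open>Analytic eigenvalues and orthonormal eigenvectors of \<open>K\<close>, as provided by Rellich's theorem.\<close>

definition analytic_eigensystem ::
    "nat \<Rightarrow> (real \<Rightarrow> real mat) \<Rightarrow> (nat \<Rightarrow> real \<Rightarrow> real) \<Rightarrow> (nat \<Rightarrow> real \<Rightarrow> real vec) \<Rightarrow> bool" where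
  "analytic_eigensystem n K ev u \<longleftrightarrow>
     (\<forall>k<n. analytic_at_0 (ev k)) \<and>
     (\<forall>k<n. \<forall>\<epsilon>. u k \<epsilon> \<in> carrier_vec n) \<and>
     (\<forall>k<n. \<forall>i<n. analytic_at_0 (\<lambda>\<epsilon>. u k \<epsilon> $ i)) \<and>
     eventually (\<lambda>\<epsilon>. (\<forall>k<n. K \<epsilon> *\<^sub>v u k \<epsilon> = ev k \<epsilon> \<cdot>\<^sub>v u k \<epsilon>) \<and>
                     (\<forall>k<n. \<forall>l<n. scalar_prod (u k \<epsilon>) (u l \<epsilon>) = (if k = l then 1 else 0)))
       (nhds 0)"

definition outer_prod :: "real vec \<Rightarrow> real vec \<Rightarrow> real mat" where
  "outer_prod v w = mat (dim_vec v) (dim_vec w) (\<lambda>(i, j). v $ i * w $ j)"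

text \<open>
  \<open>A\<close> is the asymptotic spectral equivalent of \<open>K\<close>: an analytic eigensystem exists, and whichever
  is chosen, the sum of the leading terms is \<open>A\<close>.
\<close>

definition is_ASE :: "nat \<Rightarrow> (real \<Rightarrow> real mat) \<Rightarrow> (real \<Rightarrow> real mat) \<Rightarrow> bool" where
  "is_ASE n K A \<longleftrightarrow>
     (\<exists>ev u. analytic_eigensystem n K ev u) \<and>
     (\<forall>ev u. analytic_eigensystem n K ev u \<longrightarrow>
        A = (\<lambda>\<epsilon>. matrix_sum n n
                  (\<lambda>k. leading_term (ev k) \<epsilon> \<cdot>\<^sub>m outer_prod (u k 0) (u k 0)) {..<n}))"

end

(* Orders of epsilon are compared through limits as epsilon tends to 0 from the right. Let D be
   the diagonal matrix with entries epsilon^i on block i. Because Q_i annihilates all monomials of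
   degree below i, a Taylor expansion of the kernel in both arguments shows that
   D^-1 Q^T K(epsilon) Q D^-1 tends to H. As a limit of positive semidefinite matrices, H is
   positive semidefinite, and being invertible it is coercive. Hence, in the basis Q, the limit of
   every eigenvector lives in a single block i, its eigenvalue has exact order epsilon^(2i), and
   eliminating the lower blocks with the rows of H turns the eigenvalue equation into
   S_i v = l v. So in each block the leading terms form a spectral decomposition of S_i.
   A radial kernel of regularity at least p+1 is of class C^{p,p}, since it is an even polynomial
   in |z| plus |z|^(2p+1) G(|z|) with G analytic.
   Analytic eigensystems exist (Rellich) by block diagonalisation over the ring of convergent
   power series: the off-diagonal coupling solves a fixed point equation, whose formal solution
   converges by comparison with a majorant. *)
theory Submission
  imports Defs "Jordan_Normal_Form.Spectral_Radius" "HOL-Combinatorics.Multiset_Permutations"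
begin

subsection \<open>Orthogonal matrices and symmetric congruence over rings\<close>

text \<open>Limits from the right are the common ground of the two kinds of kernels. A kernel of
  finite smoothness has no power series in its arguments, and a radial kernel matrix, continued
  analytically in \<epsilon>, in general agrees with kernel values only for \<epsilon> \<ge> 0.
  Analyticity of the matrix serves the eigensystem: it supplies a limit for every eigenvector and a
  leading exponent for every eigenvalue. Eigenvalues are never counted block by block. For fixed
  \<epsilon> each limit eigenvector is an eigenvector of the claimed sum, with the leading term as
  its eigenvalue, and a matrix is determined by an orthonormal basis of eigenvectors together with
  the eigenvalues. Multiple eigenvalues of the S_i therefore need no special treatment. In the
  diagonalisation arguments matrices are functions on an arbitrary finite index set. The induction
  behind Rellich's theorem splits this set into eigenvalue classes, which need not be intervals, and
  the same reduction steps serve real matrices and matrices of power series.\<close>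

definition orthogonal_on :: "'i set \<Rightarrow> ('i \<Rightarrow> 'i \<Rightarrow> 'a::comm_ring_1) \<Rightarrow> bool" where
  "orthogonal_on I U \<longleftrightarrow>
     (\<forall>i\<in>I. \<forall>j\<in>I. (\<Sum>k\<in>I. U k i * U k j) = (if i = j then 1 else 0)) \<and>
     (\<forall>i\<in>I. \<forall>j\<in>I. (\<Sum>k\<in>I. U i k * U j k) = (if i = j then 1 else 0))"

text \<open>Entry (i, j) of U^T A U, with rows and columns indexed by I.\<close>

definition congruence_on :: "'i set \<Rightarrow> ('i \<Rightarrow> 'i \<Rightarrow> 'a::comm_ring_1) \<Rightarrow> ('i \<Rightarrow> 'i \<Rightarrow> 'a) \<Rightarrow> 'i \<Rightarrow> 'i \<Rightarrow> 'a" where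
  "congruence_on I U A i j = (\<Sum>k\<in>I. \<Sum>l\<in>I. U k i * A k l * U l j)"

lemma sum_delta_mult:
  fixes f :: "'i \<Rightarrow> 'a::comm_ring_1"
  assumes "finite I" "i \<in> I"
  shows "(\<Sum>k\<in>I. (if i = k then 1 else 0) * f k) = f i" "(\<Sum>k\<in>I. (if k = i then 1 else 0) * f k) = f i"
    "(\<Sum>k\<in>I. f k * (if i = k then 1 else 0)) = f i" "(\<Sum>k\<in>I. f k * (if k = i then 1 else 0)) = f i"
proof -
  have *: "(if b then 1 else 0) * f k = (if b then f k else 0)"
    "f k * (if b then 1 else 0) = (if b then f k else 0)" for b k by auto
  show "(\<Sum>k\<in>I. (if i = k then 1 else 0) * f k) = f i" "(\<Sum>k\<in>I. (if k = i then 1 else 0) * f k) = f i"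
    "(\<Sum>k\<in>I. f k * (if i = k then 1 else 0)) = f i" "(\<Sum>k\<in>I. f k * (if k = i then 1 else 0)) = f i"
    unfolding * using assms by (auto simp: sum.delta sum.delta')
qed

text \<open>The relation B A = 1 turns A adj(A) = det(A) 1 into adj(A) = det(A) B. As det(A) det(B)
  = 1, the factor det(A) can be cancelled from det(A) A B = det(A) 1. The entries will be power
  series, so arguments over a field do not apply.\<close>

lemma left_inverse_imp_right_inverse:
  fixes A B :: "'a::comm_ring_1 mat"
  assumes A: "A \<in> carrier_mat n n" and B: "B \<in> carrier_mat n n" and BA: "B * A = 1\<^sub>m n"
  shows "A * B = 1\<^sub>m n"
proof -
  have det: "det A * det B = 1"
    using arg_cong[OF BA, of det] by (simp add: det_mult[OF B A] mult.commute)
  note adj = adj_mat[OF A]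
  have "adj_mat A = (B * A) * adj_mat A" using adj by (simp add: BA)
  also have "\<dots> = B * (A * adj_mat A)" using A B adj(1) by (simp add: assoc_mult_mat)
  also have "\<dots> = det A \<cdot>\<^sub>m B" using A B by (simp add: adj(2) mult_smult_distrib[OF B one_carrier_mat])
  finally have *: "adj_mat A = det A \<cdot>\<^sub>m B" .
  have "det A \<cdot>\<^sub>m (A * B) = det A \<cdot>\<^sub>m 1\<^sub>m n"
    using adj(2) A B by (simp add: * mult_smult_distrib)
  then have "det B \<cdot>\<^sub>m (det A \<cdot>\<^sub>m (A * B)) = det B \<cdot>\<^sub>m (det A \<cdot>\<^sub>m 1\<^sub>m n)" by simp
  then show ?thesis
    using det A B by (auto simp: mat_eq_iff mult.assoc[symmetric] mult.commute[of "det B"])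
qed

text \<open>Orthonormal columns suffice: after numbering I the matrix is square, and the transpose,
  being a left inverse, is a right inverse too.\<close>

lemma orthogonal_onI:
  fixes U :: "'i \<Rightarrow> 'i \<Rightarrow> 'a::idom"
  assumes fin: "finite I"
    and cols: "\<And>i j. i \<in> I \<Longrightarrow> j \<in> I \<Longrightarrow> (\<Sum>k\<in>I. U k i * U k j) = (if i = j then 1 else 0)"
  shows "orthogonal_on I U"
proof -
  obtain h where h: "bij_betw h {0..<card I} I"
    using ex_bij_betw_nat_finite[OF fin] by blast
  define n where "n = card I"
  define M where "M = mat n n (\<lambda>(a, b). U (h a) (h b))"
  have M: "M \<in> carrier_mat n n" by (simp add: M_def)
  have hI: "h a \<in> I" if "a < n" for a using h that by (auto simp: bij_betw_def n_def)
  have hinj: "h a = h b \<longleftrightarrow> a = b" if "a < n" "b < n" for a b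
    using h that by (auto simp: bij_betw_def n_def inj_on_def)
  have reidx: "(\<Sum>a = 0..<n. f (h a)) = (\<Sum>k\<in>I. f k)" for f :: "'i \<Rightarrow> 'a"
    using sum.reindex_bij_betw[OF h] by (simp add: n_def)
  have "transpose_mat M * M = 1\<^sub>m n"
  proof (rule eq_matI)
    fix a b assume ab: "a < dim_row (1\<^sub>m n :: 'a mat)" "b < dim_col (1\<^sub>m n :: 'a mat)"
    have "(transpose_mat M * M) $$ (a, b) = (\<Sum>c = 0..<n. U (h c) (h a) * U (h c) (h b))"
      using ab by (simp add: M_def scalar_prod_def)
    also have "\<dots> = (\<Sum>k\<in>I. U k (h a) * U k (h b))" by (rule reidx)
    also have "\<dots> = 1\<^sub>m n $$ (a, b)" using ab cols hI hinj by simp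
    finally show "(transpose_mat M * M) $$ (a, b) = 1\<^sub>m n $$ (a, b)" .
  qed (auto simp: M_def)
  then have MM: "M * transpose_mat M = 1\<^sub>m n"
    by (intro left_inverse_imp_right_inverse[OF M]) (use M in auto)
  have "(\<Sum>k\<in>I. U i k * U j k) = (if i = j then 1 else 0)" if "i \<in> I" "j \<in> I" for i j
  proof -
    have "i \<in> h ` {0..<n}" "j \<in> h ` {0..<n}"
      using that bij_betw_imp_surj_on[OF h] by (auto simp: n_def)
    then obtain a b where ab: "a < n" "b < n" "i = h a" "j = h b" by auto
    have "(M * transpose_mat M) $$ (a, b) = (\<Sum>c = 0..<n. U (h a) (h c) * U (h b) (h c))"
      using ab by (simp add: M_def scalar_prod_def)
    also have "\<dots> = (\<Sum>k\<in>I. U i k * U j k)" unfolding ab by (rule reidx)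
    finally show ?thesis using MM ab hinj by simp
  qed
  then show ?thesis using cols by (auto simp: orthogonal_on_def)
qed

text \<open>This is (u v)^T (u' w) = v^T (u^T u') w. It isolates the sum over k, which orthogonality
  then replaces by a Kronecker delta.\<close>

lemma sum_assoc4:
  fixes a :: "'i \<Rightarrow> 'a::comm_ring_1"
  shows "(\<Sum>k\<in>I. (\<Sum>p\<in>I. u k p * v p) * (\<Sum>q\<in>I. u' k q * w q)) =
    (\<Sum>p\<in>I. \<Sum>q\<in>I. v p * (\<Sum>k\<in>I. u k p * (u' k q :: 'a)) * w q)"
proof -
  have "(\<Sum>k\<in>I. (\<Sum>p\<in>I. u k p * v p) * (\<Sum>q\<in>I. u' k q * w q)) =
     (\<Sum>k\<in>I. \<Sum>p\<in>I. \<Sum>q\<in>I. v p * (u k p * u' k q) * w q)"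
    by (simp add: sum_product mult_ac)
  also have "\<dots> = (\<Sum>p\<in>I. \<Sum>k\<in>I. \<Sum>q\<in>I. v p * (u k p * u' k q) * w q)" by (rule sum.swap)
  also have "\<dots> = (\<Sum>p\<in>I. \<Sum>q\<in>I. \<Sum>k\<in>I. v p * (u k p * u' k q) * w q)"
    by (intro sum.cong refl sum.swap)
  finally show ?thesis by (simp add: sum_distrib_left sum_distrib_right)
qed

lemma orthogonal_on_mult:
  assumes fin: "finite I" and U: "orthogonal_on I U" and V: "orthogonal_on I V"
  shows "orthogonal_on I (\<lambda>i j. \<Sum>k\<in>I. U i k * V k j)"
  unfolding orthogonal_on_def
proof (intro conjI ballI)
  fix i j assume ij: "i \<in> I" "j \<in> I"
  have "(\<Sum>k\<in>I. (\<Sum>p\<in>I. U k p * V p i) * (\<Sum>q\<in>I. U k q * V q j)) =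
    (\<Sum>p\<in>I. \<Sum>q\<in>I. V p i * (\<Sum>k\<in>I. U k p * U k q) * V q j)"
    by (rule sum_assoc4)
  also have "\<dots> = (\<Sum>p\<in>I. \<Sum>q\<in>I. V p i * ((if p = q then 1 else 0) * V q j))"
    using U by (intro sum.cong refl) (auto simp: orthogonal_on_def)
  also have "\<dots> = (\<Sum>p\<in>I. V p i * V p j)"
    by (intro sum.cong refl) (simp add: sum_distrib_left[symmetric] sum_delta_mult fin)
  also have "\<dots> = (if i = j then 1 else 0)" using V ij by (auto simp: orthogonal_on_def)
  finally show "(\<Sum>k\<in>I. (\<Sum>p\<in>I. U k p * V p i) * (\<Sum>q\<in>I. U k q * V q j)) = (if i = j then 1 else 0)" .
  have "(\<Sum>k\<in>I. (\<Sum>p\<in>I. U i p * V p k) * (\<Sum>q\<in>I. U j q * V q k)) =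
    (\<Sum>k\<in>I. (\<Sum>p\<in>I. V p k * U i p) * (\<Sum>q\<in>I. V q k * U j q))"
    by (simp add: mult.commute)
  also have "\<dots> = (\<Sum>p\<in>I. \<Sum>q\<in>I. U i p * (\<Sum>k\<in>I. V p k * V q k) * U j q)"
    by (rule sum_assoc4)
  also have "\<dots> = (\<Sum>p\<in>I. \<Sum>q\<in>I. U i p * ((if p = q then 1 else 0) * U j q))"
    using V by (intro sum.cong refl) (auto simp: orthogonal_on_def)
  also have "\<dots> = (\<Sum>p\<in>I. U i p * U j p)"
    by (intro sum.cong refl) (simp add: sum_distrib_left[symmetric] sum_delta_mult fin)
  also have "\<dots> = (if i = j then 1 else 0)" using U ij by (auto simp: orthogonal_on_def)
  finally show "(\<Sum>k\<in>I. (\<Sum>p\<in>I. U i p * V p k) * (\<Sum>q\<in>I. U j q * V q k)) = (if i = j then 1 else 0)" .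
qed

lemma congruence_on_mult:
  fixes A U V :: "'i \<Rightarrow> 'i \<Rightarrow> 'a::comm_ring_1"
  shows
  "congruence_on I (\<lambda>i j. \<Sum>k\<in>I. U i k * V k j) A i j = congruence_on I V (congruence_on I U A) i j"
proof -
  have *: "sum f I * a * sum g I = (\<Sum>p\<in>I. \<Sum>q\<in>I. f p * a * g q)" for f g :: "'i \<Rightarrow> 'a" and a
  proof -
    have "sum f I * a * sum g I = (sum f I * sum g I) * a" by (simp only: mult_ac)
    also have "\<dots> = (\<Sum>p\<in>I. \<Sum>q\<in>I. f p * g q * a)"
      by (subst sum_product) (simp add: sum_distrib_right)
    finally show ?thesis by (simp only: mult_ac)
  qed
  have "congruence_on I (\<lambda>i j. \<Sum>k\<in>I. U i k * V k j) A i j =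
     (\<Sum>k\<in>I. \<Sum>l\<in>I. \<Sum>p\<in>I. \<Sum>q\<in>I. V p i * (U k p * A k l * U l q) * V q j)"
    unfolding congruence_on_def
    by (intro sum.cong refl) (simp only: *, simp only: mult_ac)
  also have "\<dots> = (\<Sum>k\<in>I. \<Sum>p\<in>I. \<Sum>l\<in>I. \<Sum>q\<in>I. V p i * (U k p * A k l * U l q) * V q j)"
    by (rule sum.cong[OF refl], rule sum.swap)
  also have "\<dots> = (\<Sum>p\<in>I. \<Sum>k\<in>I. \<Sum>q\<in>I. \<Sum>l\<in>I. V p i * (U k p * A k l * U l q) * V q j)"
    by (rule trans[OF sum.swap], rule sum.cong[OF refl], rule sum.cong[OF refl], rule sum.swap)
  also have "\<dots> = (\<Sum>p\<in>I. \<Sum>q\<in>I. \<Sum>k\<in>I. \<Sum>l\<in>I. V p i * (U k p * A k l * U l q) * V q j)"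
    by (rule sum.cong[OF refl], rule sum.swap)
  finally show ?thesis by (simp add: congruence_on_def sum_distrib_left sum_distrib_right)
qed

lemma congruence_on_sym:
  assumes "\<And>k l. k \<in> I \<Longrightarrow> l \<in> I \<Longrightarrow> A k l = A l k"
  shows "congruence_on I U A i j = congruence_on I U A j i"
  unfolding congruence_on_def by (subst sum.swap) (auto intro!: sum.cong simp: assms mult_ac)

text \<open>As U^T U = 1, a scalar shift and a common factor pass through the congruence. This is
  what allows \<open>rellich_on\<close> to subtract a diagonal entry and to divide by a power of the
  variable.\<close>

lemma congruence_on_affine:
  assumes fin: "finite I" and U: "orthogonal_on I U" and ij: "i \<in> I" "j \<in> I"
    and A: "\<And>k l. k \<in> I \<Longrightarrow> l \<in> I \<Longrightarrow> A k l = (if k = l then f else 0) + g * C k l"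
  shows "congruence_on I U A i j = (if i = j then f else 0) + g * congruence_on I U C i j"
proof -
  have "congruence_on I U A i j =
     (\<Sum>k\<in>I. \<Sum>l\<in>I. f * U k i * ((if k = l then 1 else 0) * U l j)) + (\<Sum>k\<in>I. \<Sum>l\<in>I. g * (U k i * C k l * U l j))"
    unfolding congruence_on_def sum.distrib[symmetric]
    by (intro sum.cong refl) (auto simp: A algebra_simps)
  also have "(\<Sum>k\<in>I. \<Sum>l\<in>I. f * U k i * ((if k = l then 1 else 0) * U l j)) = (\<Sum>k\<in>I. f * (U k i * U k j))"
    by (intro sum.cong refl) (simp add: sum_distrib_left[symmetric] sum_delta_mult fin mult_ac)
  also have "\<dots> = f * (if i = j then 1 else 0)"
    unfolding sum_distrib_left[symmetric] using U ij by (auto simp: orthogonal_on_def)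
  finally show ?thesis by (auto simp: congruence_on_def sum_distrib_left)
qed

text \<open>P singles out the admissible entries of a diagonalising matrix. It is instantiated with
  all real numbers and with the power series of positive radius of convergence, so that direct sums,
  congruences and shifts are treated once for both.\<close>

locale ring_predicate =
  fixes P :: "'a::comm_ring_1 \<Rightarrow> bool"
  assumes P0: "P 0" and P1: "P 1"
    and P_add: "P a \<Longrightarrow> P b \<Longrightarrow> P (a + b)"
    and P_mult: "P a \<Longrightarrow> P b \<Longrightarrow> P (a * b)"
begin

lemma P_sum: "(\<And>i. i \<in> I \<Longrightarrow> P (f i)) \<Longrightarrow> P (sum f I)"
  by (induction I rule: infinite_finite_induct) (auto simp: P0 P_add)

lemma P_congruence_on:
  assumes "\<And>i j. i \<in> I \<Longrightarrow> j \<in> I \<Longrightarrow> P (A i j)" "\<And>i j. i \<in> I \<Longrightarrow> j \<in> I \<Longrightarrow> P (U i j)" "i \<in> I" "j \<in> I"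
  shows "P (congruence_on I U A i j)"
  unfolding congruence_on_def using assms by (intro P_sum P_mult) auto

definition diagonalizable_on :: "'i set \<Rightarrow> ('i \<Rightarrow> 'i \<Rightarrow> 'a) \<Rightarrow> bool" where
  "diagonalizable_on I A \<longleftrightarrow>
     (\<exists>U. orthogonal_on I U \<and> (\<forall>i\<in>I. \<forall>j\<in>I. P (U i j)) \<and>
        (\<forall>i\<in>I. \<forall>j\<in>I. i \<noteq> j \<longrightarrow> congruence_on I U A i j = 0))"

lemma diagonalizable_on_empty: "diagonalizable_on {} A"
  by (auto simp: diagonalizable_on_def orthogonal_on_def)

lemma diagonalizable_on_diag:
  assumes "finite I" "\<And>i j. i \<in> I \<Longrightarrow> j \<in> I \<Longrightarrow> i \<noteq> j \<Longrightarrow> A i j = 0"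
  shows "diagonalizable_on I A"
  unfolding diagonalizable_on_def
proof (intro exI conjI ballI impI)
  let ?U = "\<lambda>i j. if i = j then 1 else 0 :: 'a"
  show "orthogonal_on I ?U"
    unfolding orthogonal_on_def using assms(1) by (auto simp: sum_delta_mult)
  show "P (?U i j)" for i j by (simp add: P0 P1)
  fix i j assume ij: "i \<in> I" "j \<in> I" "i \<noteq> j"
  have "congruence_on I ?U A i j = (\<Sum>k\<in>I. (if k = i then 1 else 0) * A k j)"
    unfolding congruence_on_def using assms(1) ij
    by (intro sum.cong refl) (simp only: sum_delta_mult)
  also have "\<dots> = 0" using assms ij by (simp add: sum_delta_mult)
  finally show "congruence_on I ?U A i j = 0" .
qed

lemma diagonalizable_on_congruence:
  assumes fin: "finite I" and U: "orthogonal_on I U" "\<And>i j. i \<in> I \<Longrightarrow> j \<in> I \<Longrightarrow> P (U i j)"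
    and diag: "diagonalizable_on I (congruence_on I U A)"
  shows "diagonalizable_on I A"
proof -
  obtain V where V: "orthogonal_on I V" "\<forall>i\<in>I. \<forall>j\<in>I. P (V i j)"
    "\<forall>i\<in>I. \<forall>j\<in>I. i \<noteq> j \<longrightarrow> congruence_on I V (congruence_on I U A) i j = 0"
    using diag by (auto simp: diagonalizable_on_def)
  show ?thesis
    unfolding diagonalizable_on_def
    using V U by (intro exI[of _ "\<lambda>i j. \<Sum>k\<in>I. U i k * V k j"])
      (auto simp: congruence_on_mult intro!: orthogonal_on_mult fin P_sum P_mult)
qed

lemma diagonalizable_on_affine:
  assumes fin: "finite I" and diag: "diagonalizable_on I C"
    and A: "\<And>k l. k \<in> I \<Longrightarrow> l \<in> I \<Longrightarrow> A k l = (if k = l then f else 0) + g * C k l"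
  shows "diagonalizable_on I A"
proof -
  obtain U where U: "orthogonal_on I U" "\<forall>i\<in>I. \<forall>j\<in>I. P (U i j)"
    "\<forall>i\<in>I. \<forall>j\<in>I. i \<noteq> j \<longrightarrow> congruence_on I U C i j = 0"
    using diag by (auto simp: diagonalizable_on_def)
  have "congruence_on I U A i j = 0" if "i \<in> I" "j \<in> I" "i \<noteq> j" for i j
    using congruence_on_affine[OF fin U(1) that(1,2) A] that U(3) by simp
  then show ?thesis using U by (auto simp: diagonalizable_on_def)
qed

lemma diagonalizable_on_Un:
  assumes fin: "finite I" and I: "I = J \<union> J'" "J \<inter> J' = {}"
    and diag: "diagonalizable_on J A" "diagonalizable_on J' A"
    and zero: "\<And>k l. k \<in> J \<Longrightarrow> l \<in> J' \<Longrightarrow> A k l = 0 \<and> A l k = 0"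
  shows "diagonalizable_on I A"
proof -
  obtain U where U: "orthogonal_on J U" "\<forall>i\<in>J. \<forall>j\<in>J. P (U i j)"
    "\<forall>i\<in>J. \<forall>j\<in>J. i \<noteq> j \<longrightarrow> congruence_on J U A i j = 0"
    using diag by (auto simp: diagonalizable_on_def)
  obtain V where V: "orthogonal_on J' V" "\<forall>i\<in>J'. \<forall>j\<in>J'. P (V i j)"
    "\<forall>i\<in>J'. \<forall>j\<in>J'. i \<noteq> j \<longrightarrow> congruence_on J' V A i j = 0"
    using diag by (auto simp: diagonalizable_on_def)
  define W where "W i j = (if i \<in> J \<and> j \<in> J then U i j else if i \<in> J' \<and> j \<in> J' then V i j else 0)" for i j
  have WJ: "W k i = (if k \<in> J then U k i else 0)" "W i k = (if k \<in> J then U i k else 0)"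
    if "i \<in> J" for i k using that I(2) by (auto simp: W_def)
  have WJ': "W k i = (if k \<in> J' then V k i else 0)" "W i k = (if k \<in> J' then V i k else 0)"
    if "i \<in> J'" for i k using that I(2) by (auto simp: W_def)
  have finJ: "finite J" "finite J'" using fin I by auto
  have sumI: "(\<Sum>k\<in>I. f k) = (\<Sum>k\<in>J. f k) + (\<Sum>k\<in>J'. f k)" for f :: "_ \<Rightarrow> 'a"
    unfolding I(1) by (rule sum.union_disjoint) (use finJ I in auto)
  have disj: "k \<notin> J'" if "k \<in> J" for k using that I(2) by auto
  have disj': "k \<notin> J" if "k \<in> J'" for k using that I(2) by auto
  have "orthogonal_on I W"
    unfolding orthogonal_on_def
  proof (intro conjI ballI)
    fix i j assume ij: "i \<in> I" "j \<in> I"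
    consider "i \<in> J" "j \<in> J" | "i \<in> J'" "j \<in> J'" | "i \<in> J" "j \<in> J'" | "i \<in> J'" "j \<in> J"
      using ij I by auto
    then show "(\<Sum>k\<in>I. W k i * W k j) = (if i = j then 1 else 0)"
      using U(1) V(1) I(2)
      by cases (auto simp: sumI WJ WJ' disj disj' orthogonal_on_def)
    from \<open>i \<in> I\<close> \<open>j \<in> I\<close> consider "i \<in> J" "j \<in> J" | "i \<in> J'" "j \<in> J'" | "i \<in> J" "j \<in> J'" | "i \<in> J'" "j \<in> J"
      using ij I by auto
    then show "(\<Sum>k\<in>I. W i k * W j k) = (if i = j then 1 else 0)"
      using U(1) V(1) I(2)
      by cases (auto simp: sumI WJ WJ' disj disj' orthogonal_on_def)
  qed
  moreover have "P (W i j)" for i j using U(2) V(2) by (auto simp: W_def P0)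
  moreover have "congruence_on I W A i j = 0" if ij: "i \<in> I" "j \<in> I" "i \<noteq> j" for i j
  proof -
    consider "i \<in> J" "j \<in> J" | "i \<in> J'" "j \<in> J'" | "i \<in> J" "j \<in> J'" | "i \<in> J'" "j \<in> J"
      using ij I by auto
    then show ?thesis
    proof cases
      case 1 then have "congruence_on I W A i j = congruence_on J U A i j"
        by (simp add: congruence_on_def sumI WJ disj')
      then show ?thesis using 1 U(3) ij by simp
    next
      case 2 then have "congruence_on I W A i j = congruence_on J' V A i j"
        by (simp add: congruence_on_def sumI WJ' disj)
      then show ?thesis using 2 V(3) ij by simp
    next
      case 3 then show ?thesis by (simp add: congruence_on_def sumI WJ WJ' disj disj' zero)
    next
      case 4 then show ?thesis by (simp add: congruence_on_def sumI WJ WJ' disj disj' zero)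
    qed
  qed
  ultimately show ?thesis unfolding diagonalizable_on_def by blast
qed

end

subsection \<open>The real spectral theorem\<close>

interpretation real_ring: ring_predicate "(\<lambda>_. True) :: real \<Rightarrow> bool"
  by standard auto

text \<open>The complexified matrix has an eigenvalue e with eigenvector v. The number conj(v)^T A v
  is its own conjugate by symmetry and equals e |v|^2, so e is real. It is then a root of the real
  characteristic polynomial, which yields a real eigenvector.\<close>

lemma real_symmetric_eigenvector:
  fixes A :: "real mat"
  assumes A: "A \<in> carrier_mat n n" and n: "n > 0" and sym: "transpose_mat A = A"
  shows "\<exists>v e. v \<in> carrier_vec n \<and> v \<noteq> 0\<^sub>v n \<and> A *\<^sub>v v = e \<cdot>\<^sub>v v"
proof -
  define C where "C = map_mat complex_of_real A"
  have C: "C \<in> carrier_mat n n" using A by (simp add: C_def)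
  have symA: "A $$ (i, j) = A $$ (j, i)" if "i < n" "j < n" for i j
    using arg_cong[OF sym, of "\<lambda>B. B $$ (j, i)"] A that by simp
  obtain e where "e \<in> spectrum C" using spectrum_non_empty[OF C n] by auto
  then have eC: "eigenvalue C e" by (simp add: spectrum_def)
  then obtain v where v: "v \<in> carrier_vec n" "v \<noteq> 0\<^sub>v n" "C *\<^sub>v v = e \<cdot>\<^sub>v v"
    using C by (auto simp: eigenvalue_def eigenvector_def)
  have row: "(\<Sum>j = 0..<n. complex_of_real (A $$ (i, j)) * v $ j) = e * v $ i" if "i < n" for i
    using arg_cong[OF v(3), of "\<lambda>w. w $ i"] that v(1) A
    by (simp add: C_def scalar_prod_def)
  define q where "q = (\<Sum>i = 0..<n. cnj (v $ i) * (\<Sum>j = 0..<n. complex_of_real (A $$ (i, j)) * v $ j))"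
  have "cnj q = (\<Sum>i = 0..<n. \<Sum>j = 0..<n. v $ i * (complex_of_real (A $$ (i, j)) * cnj (v $ j)))"
    by (simp add: q_def sum_distrib_left)
  also have "\<dots> = (\<Sum>j = 0..<n. \<Sum>i = 0..<n. v $ i * (complex_of_real (A $$ (i, j)) * cnj (v $ j)))"
    by (rule sum.swap)
  also have "\<dots> = q"
    unfolding q_def sum_distrib_left by (intro sum.cong refl) (simp add: symA mult_ac)
  finally have qreal: "q \<in> \<real>" by (simp add: Reals_cnj_iff)
  define N where "N = (\<Sum>i = 0..<n. (cmod (v $ i))\<^sup>2)"
  have "q = (\<Sum>i = 0..<n. cnj (v $ i) * (e * v $ i))" by (simp add: q_def row)
  also have "\<dots> = e * complex_of_real N"
    unfolding N_def of_real_sum sum_distrib_left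
  proof (intro sum.cong refl)
    fix i
    show "cnj (v $ i) * (e * v $ i) = e * complex_of_real ((cmod (v $ i))\<^sup>2)"
      using complex_norm_square[of "v $ i"] by (simp add: mult_ac)
  qed
  finally have qN: "q = e * complex_of_real N" .
  have "N \<noteq> 0"
  proof
    assume "N = 0"
    then have "\<forall>i\<in>{0..<n}. (cmod (v $ i))\<^sup>2 = 0"
      unfolding N_def by (subst (asm) sum_nonneg_eq_0_iff) auto
    then have "v = 0\<^sub>v n" using v(1) by (intro eq_vecI) auto
    then show False using v(2) by simp
  qed
  then have "e = q / complex_of_real N" by (simp add: qN)
  then have "e \<in> \<real>" using qreal by (metis Reals_divide Reals_of_real)
  then obtain r where r: "e = complex_of_real r" by (auto elim: Reals_cases)
  have "poly (char_poly C) e = 0" using eC eigenvalue_root_char_poly[OF C] by simp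
  then have "poly (map_poly complex_of_real (char_poly A)) (complex_of_real r) = 0"
    using A by (simp add: C_def r of_real_hom.char_poly_hom)
  then have "poly (char_poly A) r = 0" by simp
  then have "eigenvalue A r" using eigenvalue_root_char_poly[OF A] by simp
  then show ?thesis using A by (auto simp: eigenvalue_def eigenvector_def)
qed

lemma symmetric_eigenvector_on:
  fixes A :: "'i \<Rightarrow> 'i \<Rightarrow> real"
  assumes fin: "finite I" and "I \<noteq> {}" and sym: "\<And>i j. i \<in> I \<Longrightarrow> j \<in> I \<Longrightarrow> A i j = A j i"
  obtains v e where "(\<Sum>i\<in>I. (v i)\<^sup>2) = 1" "\<And>i. i \<in> I \<Longrightarrow> (\<Sum>j\<in>I. A i j * v j) = e * v i"
proof -
  obtain h where h: "bij_betw h {0..<card I} I"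
    using ex_bij_betw_nat_finite[OF fin] by blast
  define n where "n = card I"
  have n: "n > 0" using assms by (simp add: n_def card_gt_0_iff)
  have hI: "h a \<in> I" if "a < n" for a using h that by (auto simp: bij_betw_def n_def)
  have reidx: "(\<Sum>a = 0..<n. f (h a)) = (\<Sum>k\<in>I. f k)" for f :: "'i \<Rightarrow> real"
    using sum.reindex_bij_betw[OF h] by (simp add: n_def)
  define M where "M = mat n n (\<lambda>(a, b). A (h a) (h b))"
  have "transpose_mat M = M" by (rule eq_matI) (auto simp: M_def sym hI)
  then obtain w e where w: "w \<in> carrier_vec n" "w \<noteq> 0\<^sub>v n" "M *\<^sub>v w = e \<cdot>\<^sub>v w"
    using real_symmetric_eigenvector[of M n] n by (auto simp: M_def)
  define g where "g = the_inv_into {0..<n} h"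
  have g: "g (h a) = a" if "a < n" for a
    unfolding g_def using h that by (intro the_inv_into_f_f) (auto simp: bij_betw_def n_def)
  have hg: "g i < n" "h (g i) = i" if "i \<in> I" for i
  proof -
    have "i \<in> h ` {0..<n}" using that bij_betw_imp_surj_on[OF h] by (simp add: n_def)
    then obtain a where "a < n" "i = h a" by auto
    then show "g i < n" "h (g i) = i" using g by auto
  qed
  define N where "N = (\<Sum>i\<in>I. (w $ g i)\<^sup>2)"
  have "N = (\<Sum>a = 0..<n. (w $ a)\<^sup>2)"
    unfolding N_def reidx[symmetric] by (intro sum.cong refl) (simp add: g)
  moreover have "(\<Sum>a = 0..<n. (w $ a)\<^sup>2) \<noteq> 0"
  proof
    assume "(\<Sum>a = 0..<n. (w $ a)\<^sup>2) = 0"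
    then have "\<forall>i\<in>{0..<n}. (w $ i)\<^sup>2 = 0" by (subst (asm) sum_nonneg_eq_0_iff) auto
    then have "w = 0\<^sub>v n" using w(1) by (intro eq_vecI) auto
    then show False using w(2) by simp
  qed
  ultimately have "N \<noteq> 0" by simp
  moreover have "N \<ge> 0" unfolding N_def by (intro sum_nonneg) auto
  ultimately have N: "N > 0" by simp
  have "(\<Sum>j\<in>I. A i j * (w $ g j / sqrt N)) = e * (w $ g i / sqrt N)" if "i \<in> I" for i
  proof -
    have "(\<Sum>j\<in>I. A i j * w $ g j) = (\<Sum>b = 0..<n. A i (h b) * w $ b)"
      unfolding reidx[symmetric] by (intro sum.cong refl) (simp add: g)
    also have "\<dots> = (M *\<^sub>v w) $ g i"
      using hg[OF that] w(1) by (simp add: M_def scalar_prod_def)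
    also have "\<dots> = e * w $ g i" using hg[OF that] w by simp
    finally show ?thesis by (simp add: sum_divide_distrib[symmetric])
  qed
  moreover have "(\<Sum>i\<in>I. (w $ g i / sqrt N)\<^sup>2) = 1"
    using N by (simp add: power_divide sum_divide_distrib[symmetric] N_def[symmetric])
  ultimately show ?thesis using that[of "\<lambda>i. w $ g i / sqrt N" e] by simp
qed

text \<open>The reflection along w = v - e_{i0} maps the unit vector e_{i0} to v. If v i0 = 1, the
  unit vector v equals e_{i0}, w vanishes, and the identity is taken instead.\<close>

lemma householder_on:
  fixes v :: "'i \<Rightarrow> real"
  assumes fin: "finite I" and i0: "i0 \<in> I" and v: "(\<Sum>i\<in>I. (v i)\<^sup>2) = 1"
  obtains U where "orthogonal_on I U" "\<And>i. i \<in> I \<Longrightarrow> U i i0 = v i"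
proof (cases "v i0 = 1")
  case True
  have "(\<Sum>i\<in>I - {i0}. (v i)\<^sup>2) = 0"
    using v True fin i0 by (simp add: sum.remove)
  then have "\<forall>i\<in>I - {i0}. (v i)\<^sup>2 = 0" using fin by (subst (asm) sum_nonneg_eq_0_iff) auto
  then have "(if i = i0 then 1 else 0) = v i" if "i \<in> I" for i using that True by auto
  moreover have "orthogonal_on I (\<lambda>i j. if i = j then 1 else 0 :: real)"
    by (intro orthogonal_onI fin) (simp add: sum_delta_mult fin)
  ultimately show ?thesis using that by blast
next
  case False
  define w where "w i = (if i = i0 then v i - 1 else v i)" for i
  define s where "s = 1 - v i0"
  have s: "s \<noteq> 0" using False by (simp add: s_def)
  have "(\<Sum>i\<in>I. (w i)\<^sup>2) = (v i0 - 1)\<^sup>2 + (\<Sum>i\<in>I - {i0}. (w i)\<^sup>2)"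
    using fin i0 by (simp add: sum.remove w_def)
  also have "(\<Sum>i\<in>I - {i0}. (w i)\<^sup>2) = (\<Sum>i\<in>I - {i0}. (v i)\<^sup>2)"
    by (intro sum.cong refl) (simp add: w_def)
  also have "\<dots> = 1 - (v i0)\<^sup>2" using v fin i0 by (simp add: sum.remove)
  finally have ww: "(\<Sum>i\<in>I. (w i)\<^sup>2) = 2 * s" by (simp add: s_def power2_eq_square algebra_simps)
  \<comment> \<open>As |w|^2 = 2 s, this is the reflection 1 - 2 w w^T / |w|^2.\<close>
  define U where "U i j = (if i = j then 1 else 0) - w i * w j / s" for i j
  have "(\<Sum>k\<in>I. U k i * U k j) = (if i = j then 1 else 0)" if "i \<in> I" "j \<in> I" for i j
  proof -
    have "(\<Sum>k\<in>I. U k i * U k j) = (\<Sum>k\<in>I. (if k = i then 1 else 0) * (if k = j then 1 else 0))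
       - (\<Sum>k\<in>I. (if k = i then 1 else 0) * (w k * w j / s)) - (\<Sum>k\<in>I. (if k = j then 1 else 0) * (w k * w i / s))
       + (\<Sum>k\<in>I. (w i * w j / s\<^sup>2) * (w k)\<^sup>2)"
      unfolding sum_subtractf[symmetric] sum.distrib[symmetric]
      using s by (intro sum.cong refl) (auto simp: U_def field_simps power2_eq_square)
    also have "\<dots> = (if i = j then 1 else 0) - 2 * (w i * w j / s) + (w i * w j / s\<^sup>2) * (2 * s)"
      unfolding sum_distrib_left[symmetric] ww using fin that
      by (simp add: sum_delta_mult mult.commute[of "w j"] del: times_divide_eq_right)
    also have "\<dots> = (if i = j then 1 else 0)" using s by (simp add: field_simps power2_eq_square)
    finally show ?thesis .
  qed
  then have "orthogonal_on I U" by (intro orthogonal_onI fin)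
  moreover have "U i i0 = v i" if "i \<in> I" for i
    using s by (auto simp: U_def w_def s_def field_simps)
  ultimately show ?thesis using that by blast
qed

text \<open>A reflection with an eigenvector in column i0 clears that column outside the diagonal,
  symmetry clears the row, and the remaining indices form a smaller set.\<close>

theorem real_symmetric_diagonalizable_on:
  fixes A :: "'i \<Rightarrow> 'i \<Rightarrow> real"
  assumes "finite I" "\<And>i j. i \<in> I \<Longrightarrow> j \<in> I \<Longrightarrow> A i j = A j i"
  shows "real_ring.diagonalizable_on I A"
  using assms
proof (induction I arbitrary: A rule: finite_psubset_induct)
  case (psubset I)
  note fin = \<open>finite I\<close> and sym = psubset.prems
  show ?case
  proof (cases "I = {}")
    case True then show ?thesis by (simp add: real_ring.diagonalizable_on_empty)
  next
    case False
    then obtain i0 where i0: "i0 \<in> I" by auto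
    obtain v e where v: "(\<Sum>i\<in>I. (v i)\<^sup>2) = 1" "\<And>i. i \<in> I \<Longrightarrow> (\<Sum>j\<in>I. A i j * v j) = e * v i"
      using symmetric_eigenvector_on[of I A, OF fin False sym] by blast
    obtain U where U: "orthogonal_on I U" "\<And>i. i \<in> I \<Longrightarrow> U i i0 = v i"
      using householder_on[OF fin i0 v(1)] by blast
    define B where "B = congruence_on I U A"
    have symB: "B i j = B j i" for i j
      unfolding B_def by (rule congruence_on_sym) (rule sym)
    have "B i i0 = 0" if "i \<in> I" "i \<noteq> i0" for i
    proof -
      have "B i i0 = (\<Sum>k\<in>I. U k i * (\<Sum>l\<in>I. A k l * v l))"
        by (simp add: B_def congruence_on_def U sum_distrib_left mult.assoc)
      also have "\<dots> = (\<Sum>k\<in>I. e * (U k i * U k i0))"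
      proof (rule sum.cong[OF refl])
        fix k assume k: "k \<in> I"
        show "U k i * (\<Sum>l\<in>I. A k l * v l) = e * (U k i * U k i0)"
          unfolding v(2)[OF k] U(2)[OF k] by simp
      qed
      also have "\<dots> = e * (\<Sum>k\<in>I. U k i * U k i0)" by (rule sum_distrib_left[symmetric])
      also have "\<dots> = 0" using U(1) that i0 by (auto simp: orthogonal_on_def)
      finally show ?thesis .
    qed
    then have zero: "B k l = 0 \<and> B l k = 0" if "k \<in> {i0}" "l \<in> I - {i0}" for k l
      using that symB[of l k] by auto
    have "real_ring.diagonalizable_on (I - {i0}) B"
      by (rule psubset.IH) (use i0 symB in auto)
    moreover have "real_ring.diagonalizable_on {i0} B"
      by (rule real_ring.diagonalizable_on_diag) auto
    ultimately have "real_ring.diagonalizable_on I B"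
      using zero i0 by (intro real_ring.diagonalizable_on_Un[OF fin, of "{i0}" "I - {i0}"]) auto
    then show ?thesis
      unfolding B_def using fin U(1) by (intro real_ring.diagonalizable_on_congruence[of I U A]) auto
  qed
qed

subsection \<open>Convergent power series and fixed points\<close>

text \<open>The denominators (m + 1)^2 make the bound stable under products up to the factor 8. With
  a purely geometric bound c R^m, convolution would cost a factor m + 1, and no ball of such series
  would be mapped into itself by a quadratic map.\<close>

definition majorized :: "real \<Rightarrow> real \<Rightarrow> real fps \<Rightarrow> bool" where
  "majorized c R F \<longleftrightarrow> (\<forall>m. \<bar>fps_nth F m\<bar> \<le> c * R ^ m / (real m + 1)\<^sup>2)"

lemma majorized_nonneg: "majorized c R F \<Longrightarrow> 0 \<le> c"
  unfolding majorized_def by (drule spec[of _ 0]) simp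

lemma majorized_add: "majorized c R F \<Longrightarrow> majorized d R G \<Longrightarrow> majorized (c + d) R (F + G)"
  unfolding majorized_def
proof (intro allI)
  fix m assume *: "\<forall>m. \<bar>fps_nth F m\<bar> \<le> c * R ^ m / (real m + 1)\<^sup>2" "\<forall>m. \<bar>fps_nth G m\<bar> \<le> d * R ^ m / (real m + 1)\<^sup>2"
  have "\<bar>fps_nth (F + G) m\<bar> \<le> \<bar>fps_nth F m\<bar> + \<bar>fps_nth G m\<bar>" by simp
  also have "\<dots> \<le> c * R ^ m / (real m + 1)\<^sup>2 + d * R ^ m / (real m + 1)\<^sup>2"
    using * by (intro add_mono) auto
  finally show "\<bar>fps_nth (F + G) m\<bar> \<le> (c + d) * R ^ m / (real m + 1)\<^sup>2"
    by (simp add: add_divide_distrib algebra_simps)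
qed

lemma majorized_mono:
  assumes "majorized c R F" "c \<le> d" "R \<ge> 0" shows "majorized d R F"
  unfolding majorized_def
proof
  fix m
  have "c * R ^ m / (real m + 1)\<^sup>2 \<le> d * R ^ m / (real m + 1)\<^sup>2"
    using assms by (intro divide_right_mono mult_right_mono) auto
  then show "\<bar>fps_nth F m\<bar> \<le> d * R ^ m / (real m + 1)\<^sup>2"
    using assms(1) unfolding majorized_def by (meson order_trans)
qed

lemma majorized_0: "c \<ge> 0 \<Longrightarrow> R \<ge> 0 \<Longrightarrow> majorized c R 0"
  by (simp add: majorized_def)

lemma majorized_1: "R \<ge> 0 \<Longrightarrow> majorized 1 R 1"
  by (simp add: majorized_def)

lemma majorized_sum:
  assumes "\<And>i. i \<in> I \<Longrightarrow> majorized c R (f i)" "finite I" "R \<ge> 0"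
  shows "majorized (real (card I) * c) R (sum f I)"
  using assms(2,1)
proof (induction I rule: finite_induct)
  case empty then show ?case by (simp add: majorized_def)
next
  case (insert i I)
  then have "majorized (c + real (card I) * c) R (f i + sum f I)"
    by (intro majorized_add) auto
  then show ?case using insert by (simp add: algebra_simps)
qed

lemma majorized_cmult:
  assumes "majorized c R F" "\<bar>a\<bar> \<le> b" "R \<ge> 0"
  shows "majorized (b * c) R (fps_const a * F)"
  unfolding majorized_def
proof
  fix m
  have "\<bar>fps_nth (fps_const a * F) m\<bar> = \<bar>a\<bar> * \<bar>fps_nth F m\<bar>" by (simp add: abs_mult)
  also have "\<dots> \<le> b * (c * R ^ m / (real m + 1)\<^sup>2)"
    using assms by (intro mult_mono) (auto simp: majorized_def)
  finally show "\<bar>fps_nth (fps_const a * F) m\<bar> \<le> b * c * R ^ m / (real m + 1)\<^sup>2"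
    by (simp add: mult.assoc)
qed

lemma sum_inverse_squares_le: "(\<Sum>i=0..m. 1 / (real i + 1)\<^sup>2) \<le> 2 - 1 / (real m + 1)"
proof (induction m)
  case (Suc m)
  have "1 / (real m + 2)\<^sup>2 \<le> 1 / ((real m + 1) * (real m + 2))"
    by (intro divide_left_mono) (auto simp: power2_eq_square intro!: mult_right_mono)
  also have "\<dots> = 1 / (real m + 1) - 1 / (real m + 2)" by (simp add: field_simps)
  finally show ?case using Suc by (simp add: add.commute)
qed simp

text \<open>With a = i + 1 and b = m - i + 1 one has a + b = m + 2 and 1 / (a b) = (1 / a + 1 / b) /
  (a + b). Squaring, with (x + y)^2 \<le> 2 (x^2 + y^2), separates the two factors, and each of the
  two sums of inverse squares is at most 2.\<close>

lemma sum_inverse_squares_convolution_le: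
  "(\<Sum>i=0..m. 1 / ((real i + 1)\<^sup>2 * (real (m - i) + 1)\<^sup>2)) \<le> 8 / (real m + 1)\<^sup>2"
proof -
  define q where "q i = 1 / (real i + 1)\<^sup>2" for i
  have le: "1 / ((real i + 1)\<^sup>2 * (real (m - i) + 1)\<^sup>2) \<le> 2 / (real m + 2)\<^sup>2 * (q i + q (m - i))"
    if "i \<le> m" for i
  proof -
    define a b where "a = real i + 1" "b = real (m - i) + 1"
    have ab: "a > 0" "b > 0" "real m + 2 = a + b" using that by (auto simp: a_b_def of_nat_diff)
    have "1 / (a\<^sup>2 * b\<^sup>2) = 1 / (a + b)\<^sup>2 * (1 / a + 1 / b)\<^sup>2"
      using ab(1,2) by (simp add: divide_simps power2_eq_square) (simp add: algebra_simps)
    also have "\<dots> \<le> 1 / (a + b)\<^sup>2 * (2 * ((1 / a)\<^sup>2 + (1 / b)\<^sup>2))"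
    proof (rule mult_left_mono)
      have "(x + y)\<^sup>2 \<le> 2 * (x\<^sup>2 + y\<^sup>2)" for x y :: real
        using zero_le_power2[of "x - y"] by (simp add: power2_eq_square algebra_simps)
      then show "(1 / a + 1 / b)\<^sup>2 \<le> 2 * ((1 / a)\<^sup>2 + (1 / b)\<^sup>2)" .
    qed simp
    finally show ?thesis
      unfolding q_def ab(3) a_b_def[symmetric] by (simp add: power_one_over)
  qed
  have q: "(\<Sum>i=0..m. q i) \<le> 2"
  proof -
    have "(\<Sum>i=0..m. q i) \<le> 2 - 1 / (real m + 1)"
      unfolding q_def by (rule sum_inverse_squares_le)
    also have "\<dots> \<le> 2" by simp
    finally show ?thesis .
  qed
  have "(\<Sum>i=0..m. 1 / ((real i + 1)\<^sup>2 * (real (m - i) + 1)\<^sup>2)) \<le> (\<Sum>i=0..m. 2 / (real m + 2)\<^sup>2 * (q i + q (m - i)))"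
    by (intro sum_mono le) auto
  also have "\<dots> = 2 / (real m + 2)\<^sup>2 * ((\<Sum>i=0..m. q i) + (\<Sum>i=0..m. q (m - i)))"
    unfolding sum_distrib_left[symmetric] sum.distrib[symmetric] ..
  also have "(\<Sum>i=0..m. q (m - i)) = (\<Sum>i=0..m. q i)"
    using sum.atLeastAtMost_rev[of q 0 m] by simp
  also have "2 / (real m + 2)\<^sup>2 * ((\<Sum>i=0..m. q i) + (\<Sum>i=0..m. q i)) \<le> 2 / (real m + 2)\<^sup>2 * 4"
    using q by (intro mult_left_mono) auto
  also have "\<dots> \<le> 8 / (real m + 1)\<^sup>2"
    by (simp add: divide_left_mono power_mono)
  finally show ?thesis .
qed

lemma majorized_mult:
  assumes "majorized c R F" "majorized d R G" "R \<ge> 0"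
  shows "majorized (8 * c * d) R (F * G)"
  unfolding majorized_def
proof
  fix m
  have cd: "c \<ge> 0" "d \<ge> 0" by (rule majorized_nonneg[OF assms(1)], rule majorized_nonneg[OF assms(2)])
  have "\<bar>fps_nth (F * G) m\<bar> \<le> (\<Sum>i=0..m. \<bar>fps_nth F i\<bar> * \<bar>fps_nth G (m - i)\<bar>)"
    unfolding fps_mult_nth abs_mult[symmetric] by (rule sum_abs)
  also have "\<dots> \<le> (\<Sum>i=0..m. (c * R ^ i / (real i + 1)\<^sup>2) * (d * R ^ (m - i) / (real (m - i) + 1)\<^sup>2))"
    using assms by (intro sum_mono mult_mono) (auto simp: majorized_def cd simp del: of_nat_diff)
  also have "\<dots> = (\<Sum>i=0..m. c * d * R ^ m * (1 / ((real i + 1)\<^sup>2 * (real (m - i) + 1)\<^sup>2)))"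
  proof (intro sum.cong refl)
    fix i assume "i \<in> {0..m}"
    then have "R ^ m = R ^ i * R ^ (m - i)" by (simp add: power_add[symmetric])
    then show "(c * R ^ i / (real i + 1)\<^sup>2) * (d * R ^ (m - i) / (real (m - i) + 1)\<^sup>2) =
        c * d * R ^ m * (1 / ((real i + 1)\<^sup>2 * (real (m - i) + 1)\<^sup>2))" by simp
  qed
  also have "\<dots> = c * d * R ^ m * (\<Sum>i=0..m. 1 / ((real i + 1)\<^sup>2 * (real (m - i) + 1)\<^sup>2))"
    by (simp add: sum_distrib_left)
  also have "\<dots> \<le> c * d * R ^ m * (8 / (real m + 1)\<^sup>2)"
    using assms cd by (intro mult_left_mono sum_inverse_squares_convolution_le) auto
  finally show "\<bar>fps_nth (F * G) m\<bar> \<le> 8 * c * d * R ^ m / (real m + 1)\<^sup>2"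
    by (simp add: mult_ac)
qed

lemma majorized_imp_conv_radius_pos:
  assumes "majorized c R F" "R > 0"
  shows "fps_conv_radius F > 0"
proof -
  have c: "c \<ge> 0" by (rule majorized_nonneg[OF assms(1)])
  have "summable (\<lambda>m. fps_nth F m * (1 / (2 * R)) ^ m)"
  proof (rule summable_comparison_test)
    show "\<exists>N. \<forall>m\<ge>N. norm (fps_nth F m * (1 / (2 * R)) ^ m) \<le> c * (1 / 2) ^ m"
    proof (intro exI allI impI)
      fix m
      have "\<bar>fps_nth F m\<bar> \<le> c * R ^ m / (real m + 1)\<^sup>2" using assms by (simp add: majorized_def)
      also have "\<dots> \<le> c * R ^ m / 1" using assms c by (intro divide_left_mono) (auto simp: one_le_power)
      finally have "\<bar>fps_nth F m\<bar> * (1 / (2 * R)) ^ m \<le> c * R ^ m * (1 / (2 * R)) ^ m"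
        using assms by (intro mult_right_mono) auto
      also have "\<dots> = c * (1 / 2) ^ m"
        using assms by (simp add: power_mult_distrib power_one_over field_simps)
      finally show "norm (fps_nth F m * (1 / (2 * R)) ^ m) \<le> c * (1 / 2) ^ m"
        using assms by (simp add: abs_mult)
    qed
    show "summable (\<lambda>m. c * (1 / 2) ^ m :: real)" by (intro summable_mult summable_geometric) auto
  qed
  then have "conv_radius (fps_nth F) \<ge> norm (1 / (2 * R))"
    by (intro conv_radius_geI) auto
  moreover have "0 < ereal (norm (1 / (2 * R)))" using assms by simp
  ultimately show ?thesis unfolding fps_conv_radius_def by (rule less_le_trans[rotated])
qed

text \<open>The bound c can be prescribed arbitrarily small: directly it restricts only the
  coefficient of index 0, which is zero, and in all others a large R compensates.\<close>

lemma conv_radius_pos_imp_majorized: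
  assumes "fps_conv_radius F > 0" "fps_nth F 0 = 0" "c > 0"
  shows "\<exists>R0>0. \<forall>R\<ge>R0. majorized c R F"
proof -
  obtain r where r: "r > 0" "ereal r < fps_conv_radius F"
    using assms(1) ereal_dense2[of 0 "fps_conv_radius F"] by (auto simp: zero_ereal_def)
  have "summable (\<lambda>m. fps_nth F m * r ^ m)"
    using r by (intro summable_in_conv_radius) (auto simp: fps_conv_radius_def)
  then have "Bseq (\<lambda>m. fps_nth F m * r ^ m)"
    by (rule convergent_imp_Bseq[OF convergentI[OF summable_LIMSEQ_zero]])
  then obtain M where M: "M > 0" "\<And>m. \<bar>fps_nth F m * r ^ m\<bar> \<le> M" by (auto simp: Bseq_def)
  \<comment> \<open>For m \<ge> 1 the power of 4 / r absorbs (m + 1)^2 \<le> 4^m and r^m, and the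
    power of M / c + 1 \<ge> 1 absorbs M / c.\<close>
  define R0 where "R0 = 4 / r * (M / c + 1)"
  have R0: "R0 > 0" using r M assms by (simp add: R0_def add_pos_pos)
  have "majorized c R F" if "R \<ge> R0" for R
    unfolding majorized_def
  proof
    fix m
    have R: "R > 0" using R0 that by simp
    show "\<bar>fps_nth F m\<bar> \<le> c * R ^ m / (real m + 1)\<^sup>2"
    proof (cases "m = 0")
      case True then show ?thesis using assms by simp
    next
      case False
      have sq: "(real m + 1)\<^sup>2 \<le> 4 ^ m"
      proof -
        have "real (m + 1) \<le> real (2 ^ m)"
          unfolding of_nat_le_iff using less_exp[of m] by linarith
        then have "real m + 1 \<le> 2 ^ m" by simp
        then have "(real m + 1)\<^sup>2 \<le> (2 ^ m)\<^sup>2" by (intro power_mono) auto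
        then show ?thesis by (simp add: power2_eq_square flip: power_mult_distrib)
      qed
      have "M / c \<le> (M / c + 1) ^ m"
      proof -
        have "M / c \<le> M / c + 1" by simp
        also have "\<dots> \<le> (M / c + 1) ^ m"
          using False M assms by (intro self_le_power) auto
        finally show ?thesis .
      qed
      then have "M \<le> c * (M / c + 1) ^ m" using assms by (simp add: field_simps)
      also have "M / c + 1 = R0 * r / 4" using r by (simp add: R0_def field_simps)
      finally have M': "M \<le> c * (R0 * r / 4) ^ m" .
      have "\<bar>fps_nth F m\<bar> = \<bar>fps_nth F m * r ^ m\<bar> / r ^ m" using r by (simp add: abs_mult)
      also have "\<dots> \<le> c * (R0 * r / 4) ^ m / r ^ m"
        using r by (intro divide_right_mono order_trans[OF M(2) M']) auto
      also have "\<dots> = c * R0 ^ m / 4 ^ m" using r by (simp add: power_divide power_mult_distrib)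
      also have "\<dots> \<le> c * R ^ m / 4 ^ m"
        using assms that R0 by (intro divide_right_mono mult_left_mono power_mono) auto
      also have "\<dots> \<le> c * R ^ m / (real m + 1)\<^sup>2"
        using sq assms R by (intro divide_left_mono) auto
      finally show ?thesis .
    qed
  qed
  then show ?thesis using R0 by blast
qed

text \<open>Congruence modulo the m-th power of the variable.\<close>

definition agree_below :: "nat \<Rightarrow> 'a::comm_ring_1 fps \<Rightarrow> 'a fps \<Rightarrow> bool" where
  "agree_below m F G \<longleftrightarrow> (\<forall>l<m. fps_nth F l = fps_nth G l)"

lemma agree_below_refl: "agree_below m F F" by (simp add: agree_below_def)
lemma agree_below_add: "agree_below m F G \<Longrightarrow> agree_below m F' G' \<Longrightarrow> agree_below m (F + F') (G + G')"
  by (simp add: agree_below_def)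
lemma agree_below_sum: "(\<And>i. i \<in> I \<Longrightarrow> agree_below m (f i) (g i)) \<Longrightarrow> agree_below m (sum f I) (sum g I)"
  by (simp add: agree_below_def fps_sum_nth)
lemma agree_below_mult: "agree_below m F G \<Longrightarrow> agree_below m F' G' \<Longrightarrow> agree_below m (F * F') (G * G')"
  by (auto simp: agree_below_def fps_mult_nth intro!: sum.cong)

text \<open>One order is gained because the coefficient of index m of F, where F and G may differ,
  meets only the constant term of the other factor, which is zero.\<close>

lemma agree_below_mult_zero:
  assumes "agree_below m F G" "agree_below (Suc m) F' G'" "fps_nth F' 0 = 0" "fps_nth G' 0 = 0"
  shows "agree_below (Suc m) (F * F') (G * G')"
  unfolding agree_below_def fps_mult_nth
proof (intro allI impI sum.cong refl)
  fix l i assume "l < Suc m" "i \<in> {0..l}"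
  then show "fps_nth F i * fps_nth F' (l - i) = fps_nth G i * fps_nth G' (l - i)"
    using assms by (cases "i = l") (auto simp: agree_below_def)
qed

lemma agree_below_mult_zero_zero:
  assumes "agree_below m F G" "agree_below m F' G'"
    "fps_nth F 0 = 0" "fps_nth G 0 = 0" "fps_nth F' 0 = 0" "fps_nth G' 0 = 0"
  shows "agree_below (Suc m) (F * F') (G * G')"
  unfolding agree_below_def fps_mult_nth
proof (intro allI impI sum.cong refl)
  fix l i assume "l < Suc m" "i \<in> {0..l}"
  then show "fps_nth F i * fps_nth F' (l - i) = fps_nth G i * fps_nth G' (l - i)"
    using assms by (cases "i = l"; cases "i = 0") (auto simp: agree_below_def)
qed

text \<open>In the iterates starting from 0, coefficient l is stationary from the l-th iterate on,
  because each application of \<Phi> gains one order of agreement. The limit is thus taken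
  coefficient by coefficient, and it inherits the majorant because that is a condition on single
  coefficients.\<close>

lemma fps_fixpoint:
  fixes \<Phi> :: "('i \<Rightarrow> real fps) \<Rightarrow> 'i \<Rightarrow> real fps"
  assumes zero: "\<And>X i. (\<And>i. fps_nth (X i) 0 = 0) \<Longrightarrow> fps_nth (\<Phi> X i) 0 = 0"
    and contr: "\<And>X Y m i. (\<And>i. fps_nth (X i) 0 = 0) \<Longrightarrow> (\<And>i. fps_nth (Y i) 0 = 0) \<Longrightarrow>
        (\<And>i. agree_below m (X i) (Y i)) \<Longrightarrow> agree_below (Suc m) (\<Phi> X i) (\<Phi> Y i)"
    and ball: "\<And>X i. (\<And>i. majorized c R (X i)) \<Longrightarrow> majorized c R (\<Phi> X i)"
    and "c \<ge> 0" "R \<ge> 0"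
  obtains X where "\<And>i. \<Phi> X i = X i" "\<And>i. majorized c R (X i)" "\<And>i. fps_nth (X i) 0 = 0"
proof -
  define Y where "Y k = (\<Phi> ^^ k) (\<lambda>_. 0)" for k
  have Y0: "fps_nth (Y k i) 0 = 0" for k i
    by (induction k arbitrary: i) (simp_all add: Y_def zero)
  have Ymaj: "majorized c R (Y k i)" for k i
    using assms(4,5) by (induction k arbitrary: i) (simp_all add: Y_def ball majorized_0)
  have step: "agree_below (Suc k) (Y k i) (Y (Suc k) i)" for k i
  proof (induction k arbitrary: i)
    case 0 then show ?case using Y0 by (simp add: agree_below_def)
  next
    case (Suc k)
    have "agree_below (Suc (Suc k)) (\<Phi> (Y k) i) (\<Phi> (Y (Suc k)) i)"
      by (rule contr[OF Y0 Y0 Suc])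
    then show ?case by (simp add: Y_def)
  qed
  have stab: "fps_nth (Y k i) l = fps_nth (Y l i) l" if "l \<le> k" for k l i
    using that
  proof (induction k rule: dec_induct)
    case (step k) then show ?case using assms \<open>\<And>k i. agree_below (Suc k) (Y k i) (Y (Suc k) i)\<close>[of k i]
      by (auto simp: agree_below_def)
  qed simp
  define X where "X i = Abs_fps (\<lambda>l. fps_nth (Y l i) l)" for i
  have X0: "fps_nth (X i) 0 = 0" for i by (simp add: X_def Y0)
  have XY: "agree_below (Suc k) (Y k i) (X i)" for k i
    unfolding agree_below_def X_def fps_nth_Abs_fps by (intro allI impI stab) simp
  have "fps_nth (\<Phi> X i) l = fps_nth (X i) l" for i l
  proof -
    have "agree_below (Suc (Suc l)) (\<Phi> (Y l) i) (\<Phi> X i)" by (rule contr[OF Y0 X0 XY])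
    then have "fps_nth (\<Phi> X i) l = fps_nth (Y (Suc l) i) l" by (simp add: agree_below_def Y_def)
    also have "\<dots> = fps_nth (X i) l" using stab[of l "Suc l"] by (simp add: X_def)
    finally show ?thesis .
  qed
  then have "\<Phi> X i = X i" for i by (simp add: fps_eq_iff)
  moreover have "majorized c R (X i)" for i
    using Ymaj by (simp add: majorized_def X_def)
  ultimately show ?thesis using X0 that by blast
qed

subsection \<open>Rellich theorem\<close>

interpretation conv_fps: ring_predicate "\<lambda>F :: real fps. fps_conv_radius F > 0"
proof
  show "fps_conv_radius (a + b) > 0" if "fps_conv_radius a > 0" "fps_conv_radius b > 0" for a b :: "real fps"
    using that fps_conv_radius_add[of a b] by (auto simp: min_def split: if_splits)
  show "fps_conv_radius (a * b) > 0" if "fps_conv_radius a > 0" "fps_conv_radius b > 0" for a b :: "real fps"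
    using that fps_conv_radius_mult[of a b] by (auto simp: min_def split: if_splits)
qed auto

text \<open>
  Writing \<open>U = 1 + W\<close>, orthogonality of \<open>U\<close> determines the symmetric part of \<open>W\<close> as
  \<open>- W\<^sup>T W / 2\<close>, and the vanishing of the entries of \<open>U\<^sup>T A U\<close> that couple distinct eigenvalues of
  \<open>A(0)\<close> determines the skew part there. Both right-hand sides are of higher order in \<open>W\<close>.
\<close>

lemma separate_eigenvalues_on:
  fixes A :: "'i \<Rightarrow> 'i \<Rightarrow> real fps" and lam :: "'i \<Rightarrow> real"
  assumes fin: "finite I"
    and sym: "\<And>i j. i \<in> I \<Longrightarrow> j \<in> I \<Longrightarrow> A i j = A j i"
    and conv: "\<And>i j. i \<in> I \<Longrightarrow> j \<in> I \<Longrightarrow> fps_conv_radius (A i j) > 0"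
    and A0: "\<And>i j. i \<in> I \<Longrightarrow> j \<in> I \<Longrightarrow> fps_nth (A i j) 0 = (if i = j then lam i else 0)"
  obtains U where "orthogonal_on I U" "\<And>i j. i \<in> I \<Longrightarrow> j \<in> I \<Longrightarrow> fps_conv_radius (U i j) > 0"
    "\<And>i j. i \<in> I \<Longrightarrow> j \<in> I \<Longrightarrow> lam i \<noteq> lam j \<Longrightarrow> congruence_on I U A i j = 0"
proof -
  define E where "E i j = A i j - (if i = j then fps_const (lam i) else 0)" for i j
  define n where "n = real (card I)"
  define L where "L = (\<Sum>k\<in>I. \<bar>lam k\<bar>)"
  \<comment> \<open>A common bound for the divisors that occur below. Pairs of equal eigenvalues
    contribute 0, since division by zero yields 0.\<close>
  define g where "g = (\<Sum>a\<in>I. \<Sum>b\<in>I. \<bar>1 / (lam b - lam a)\<bar>)"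
  have n0: "n \<ge> 0" by (simp add: n_def)
  have L0: "L \<ge> 0" by (simp add: L_def sum_nonneg)
  have g0: "g \<ge> 0" by (simp add: g_def sum_nonneg)
  have Lk: "\<bar>lam k\<bar> \<le> L" if "k \<in> I" for k
    unfolding L_def using fin that by (intro member_le_sum) auto
  have gk: "\<bar>1 / (lam b - lam a)\<bar> \<le> g" if "a \<in> I" "b \<in> I" for a b
  proof -
    have "\<bar>1 / (lam b - lam a)\<bar> \<le> (\<Sum>b\<in>I. \<bar>1 / (lam b - lam a)\<bar>)"
      using fin that by (intro member_le_sum[of b]) auto
    also have "\<dots> \<le> g"
      unfolding g_def using fin that by (intro member_le_sum[of a]) (auto intro!: sum_nonneg)
    finally show ?thesis .
  qed
  \<comment> \<open>On the ball of radius \<kappa> the map \<Phi> below is bounded by B \<kappa>^2 +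
    D c: B collects the terms quadratic in W, and D those that contain E. The choices of \<kappa>
    and c make each of the two parts at most \<kappa> / 2.\<close>
  define B where "B = 4 * n + 16 * g * L * n"
  define D where "D = 256 * g * n\<^sup>2"
  have BD: "B \<ge> 0" "D \<ge> 0" using n0 L0 g0 by (simp_all add: B_def D_def)
  define \<kappa> where "\<kappa> = 1 / (2 * B + 1)"
  define c where "c = \<kappa> / (2 * D + 1)"
  have \<kappa>: "\<kappa> > 0" "\<kappa> \<le> 1" using BD by (simp_all add: \<kappa>_def)
  have c: "c > 0" using BD \<kappa> by (simp add: c_def)
  have E0: "fps_nth (E i j) 0 = 0" if "i \<in> I" "j \<in> I" for i j
    using A0[OF that] by (simp add: E_def)
  have Econv: "fps_conv_radius (E i j) > 0" if "i \<in> I" "j \<in> I" for i j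
    using conv[OF that] fps_conv_radius_diff[of "A i j" "if i = j then fps_const (lam i) else 0"]
    by (auto simp: E_def min_def split: if_splits)
  have "\<forall>p\<in>I \<times> I. \<exists>R0>0. \<forall>R\<ge>R0. majorized c R (E (fst p) (snd p))"
    using E0 Econv c by (auto intro!: conv_radius_pos_imp_majorized)
  then obtain R0 where R0: "\<And>p R. p \<in> I \<times> I \<Longrightarrow> R \<ge> R0 p \<Longrightarrow> majorized c R (E (fst p) (snd p))"
    by metis
  \<comment> \<open>One R for all entries. Inserting 1 makes the maximum meaningful for empty I and
    R positive.\<close>
  define R where "R = Max (insert 1 (R0 ` (I \<times> I)))"
  have R1: "R \<ge> 1" unfolding R_def using fin by (intro Max_ge) auto
  then have R: "R \<ge> 0" "R > 0" by auto
  have Emaj: "majorized c R (E i j)" if "i \<in> I" "j \<in> I" for i j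
    using R0[of "(i, j)" R] that fin by (auto simp: R_def)
  \<comment> \<open>N is the prescribed symmetric part - W^T W / 2 and V is the candidate 1 + W. For
    lam a \<noteq> lam b, M is the entry (b, a) of V^T A V without its terms lam b W (b, a) + lam a
    W (a, b).\<close>
  define N where "N W b a = fps_const (-1/2) * (\<Sum>k\<in>I. W (k, b) * W (k, a))" for W :: "'i \<times> 'i \<Rightarrow> real fps" and b a
  define V where "V W i j = (if i = j then 1 else 0) + W (i, j)" for W :: "'i \<times> 'i \<Rightarrow> real fps" and i j
  define M where "M W b a = (\<Sum>k\<in>I. fps_const (lam k) * (W (k, b) * W (k, a)))
      + (\<Sum>k\<in>I. \<Sum>l\<in>I. V W k b * (E k l * V W l a))" for W :: "'i \<times> 'i \<Rightarrow> real fps" and b a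
  \<comment> \<open>For W = N + K with N symmetric and K skew, the entry (b, a) is (lam a + lam b) N
    + (lam b - lam a) K + M, all taken at (b, a). Equating it to 0 and solving for K gives
    S.\<close>
  define S where "S W b a = fps_const (-1 / (lam b - lam a)) * (fps_const (lam a + lam b) * N W b a + M W b a)"
    for W b a
  \<comment> \<open>Within an eigenvalue class the skew part is free and is chosen to be 0. The
    value 0 outside I lets the fixed point lemma range over all index pairs.\<close>
  define \<Phi> where "\<Phi> W = (\<lambda>(b, a). if b \<in> I \<and> a \<in> I then N W b a + (if lam a = lam b then 0 else S W b a) else 0)"
    for W
  have N0: "fps_nth (N W b a) 0 = 0" if "\<And>i. fps_nth (W i) 0 = 0" for W b a
    using that by (simp add: N_def fps_sum_nth)
  have M0: "fps_nth (M W b a) 0 = 0" if "\<And>i. fps_nth (W i) 0 = 0" for W b a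
    using that E0 by (simp add: M_def fps_sum_nth)
  have \<Phi>0: "fps_nth (\<Phi> W i) 0 = 0" if "\<And>i. fps_nth (W i) 0 = 0" for W i
    using N0[OF that] M0[OF that] by (cases i) (auto simp: \<Phi>_def S_def)
  have contr: "agree_below (Suc m) (\<Phi> X i) (\<Phi> Y i)"
    if X: "\<And>i. fps_nth (X i) 0 = 0" and Y: "\<And>i. fps_nth (Y i) 0 = 0" and XY: "\<And>i. agree_below m (X i) (Y i)"
    for X Y m i
  proof -
    have V: "agree_below m (V X a b) (V Y a b)" for a b
      unfolding V_def by (intro agree_below_add agree_below_refl XY)
    have N: "agree_below (Suc m) (N X b a) (N Y b a)" for a b
      unfolding N_def by (intro agree_below_mult agree_below_refl agree_below_sum agree_below_mult_zero_zero XY X Y)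
    have M: "agree_below (Suc m) (M X b a) (M Y b a)" for a b
    proof -
      have EV: "agree_below (Suc m) (E k l * V X l a) (E k l * V Y l a)" if "k \<in> I" "l \<in> I" for k l
        using agree_below_mult_zero[OF V[of l a] agree_below_refl[of "Suc m" "E k l"]] E0[OF that]
        by (simp add: mult.commute)
      have "agree_below (Suc m) (V X k b * (E k l * V X l a)) (V Y k b * (E k l * V Y l a))"
        if "k \<in> I" "l \<in> I" for k l
        using E0[OF that] by (intro agree_below_mult_zero[OF V EV[OF that]]) auto
      moreover have "agree_below (Suc m) (fps_const (lam k) * (X (k, b) * X (k, a))) (fps_const (lam k) * (Y (k, b) * Y (k, a)))" for k
        by (intro agree_below_mult agree_below_refl agree_below_mult_zero_zero XY X Y)
      ultimately show ?thesis
        unfolding M_def by (intro agree_below_add agree_below_sum)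
    qed
    show ?thesis
      unfolding \<Phi>_def S_def
      by (cases i) (auto intro!: agree_below_add agree_below_mult agree_below_refl N M)
  qed
  have ball: "majorized \<kappa> R (\<Phi> W i)" if W: "\<And>i. majorized \<kappa> R (W i)" for W i
  proof (cases "fst i \<in> I \<and> snd i \<in> I")
    case False
    then show ?thesis using \<kappa> R by (cases i) (auto simp: \<Phi>_def intro!: majorized_0)
  next
    case True
    obtain b a where i: "i = (b, a)" by (cases i)
    have ba: "b \<in> I" "a \<in> I" using True i by auto
    have WW: "majorized (8 * \<kappa> * \<kappa>) R (W p * W q)" for p q
      by (rule majorized_mult[OF W W R(1)])
    have N: "majorized (4 * n * \<kappa>\<^sup>2) R (N W b a)"
    proof -
      have "majorized (1/2 * (n * (8 * \<kappa> * \<kappa>))) R (N W b a)"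
        unfolding N_def n_def by (intro majorized_cmult majorized_sum WW fin R) auto
      then show ?thesis by (rule majorized_mono) (auto simp: power2_eq_square R)
    qed
    have V: "majorized (1 + \<kappa>) R (V W k l)" for k l
      unfolding V_def using majorized_1[OF R(1)] majorized_mono[OF majorized_0[of 0 R], of 1] R
      by (intro majorized_add W) auto
    have M: "majorized (8 * L * n * \<kappa>\<^sup>2 + 256 * n\<^sup>2 * c) R (M W b a)"
    proof -
      have "majorized (n * (L * (8 * \<kappa> * \<kappa>)) + n * (n * (8 * (1 + \<kappa>) * (8 * c * (1 + \<kappa>))))) R (M W b a)"
        unfolding M_def n_def
        by (intro majorized_add majorized_sum majorized_cmult WW Lk majorized_mult V Emaj fin R) auto
      \<comment> \<open>As \<kappa> \<le> 1, the two factors V contribute at most 4. Together with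
        the factors 8 of the two products this is the origin of 256 = 8 * 8 * 4 in D.\<close>
      moreover have "(1 + \<kappa>) * (1 + \<kappa>) \<le> 2 * 2" using \<kappa> by (intro mult_mono) auto
      then have "n\<^sup>2 * c * 64 * ((1 + \<kappa>) * (1 + \<kappa>)) \<le> n\<^sup>2 * c * 64 * (2 * 2)"
        using c by (intro mult_left_mono) auto
      then have "n * (L * (8 * \<kappa> * \<kappa>)) + n * (n * (8 * (1 + \<kappa>) * (8 * c * (1 + \<kappa>)))) \<le>
          8 * L * n * \<kappa>\<^sup>2 + 256 * n\<^sup>2 * c"
        by (simp add: power2_eq_square algebra_simps)
      ultimately show ?thesis using R(1) by (rule majorized_mono)
    qed
    have S: "majorized (g * (2 * L * (4 * n * \<kappa>\<^sup>2) + (8 * L * n * \<kappa>\<^sup>2 + 256 * n\<^sup>2 * c))) R (S W b a)"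
      unfolding S_def
    proof (intro majorized_cmult majorized_add N M R)
      show "\<bar>- 1 / (lam b - lam a)\<bar> \<le> g" using gk[OF ba(2,1)] by simp
      show "\<bar>lam a + lam b\<bar> \<le> 2 * L" using Lk[OF ba(1)] Lk[OF ba(2)] by linarith
    qed
    have tot: "4 * n * \<kappa>\<^sup>2 + g * (2 * L * (4 * n * \<kappa>\<^sup>2) + (8 * L * n * \<kappa>\<^sup>2 + 256 * n\<^sup>2 * c)) \<le> \<kappa>"
    proof -
      have "4 * n * \<kappa>\<^sup>2 + g * (2 * L * (4 * n * \<kappa>\<^sup>2) + (8 * L * n * \<kappa>\<^sup>2 + 256 * n\<^sup>2 * c)) = B * \<kappa> * \<kappa> + D * c"
        by (simp add: B_def D_def power2_eq_square algebra_simps)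
      also have "B * \<kappa> \<le> 1 / 2" using BD by (simp add: \<kappa>_def field_simps)
      then have "B * \<kappa> * \<kappa> + D * c \<le> 1 / 2 * \<kappa> + D * c" using \<kappa> by (intro add_right_mono mult_right_mono) auto
      also have "D * c \<le> 1 / 2 * \<kappa>"
      proof -
        have "D / (2 * D + 1) \<le> 1 / 2" using BD by (simp add: field_simps)
        then have "D / (2 * D + 1) * \<kappa> \<le> 1 / 2 * \<kappa>" using \<kappa> by (intro mult_right_mono) auto
        then show ?thesis by (simp add: c_def)
      qed
      finally show ?thesis by simp
    qed
    have "majorized (4 * n * \<kappa>\<^sup>2 + g * (2 * L * (4 * n * \<kappa>\<^sup>2) + (8 * L * n * \<kappa>\<^sup>2 + 256 * n\<^sup>2 * c))) R (\<Phi> W i)"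
    proof (cases "lam a = lam b")
      case True
      show ?thesis
        unfolding \<Phi>_def i using ba True n0 L0 g0 c R
        by (simp, intro majorized_mono[OF N]) auto
    next
      case False
      then show ?thesis unfolding \<Phi>_def i using ba majorized_add[OF N S] by simp
    qed
    then show ?thesis using tot R(1) by (rule majorized_mono)
  qed
  obtain W where W: "\<And>i. \<Phi> W i = W i" "\<And>i. majorized \<kappa> R (W i)" "\<And>i. fps_nth (W i) 0 = 0"
  proof (rule fps_fixpoint[of \<Phi> \<kappa> R])
    show "fps_nth (\<Phi> X i) 0 = 0" if "\<And>i. fps_nth (X i) 0 = 0" for X i using that by (rule \<Phi>0)
    show "agree_below (Suc m) (\<Phi> X i) (\<Phi> Y i)"
      if "\<And>i. fps_nth (X i) 0 = 0" "\<And>i. fps_nth (Y i) 0 = 0" "\<And>i. agree_below m (X i) (Y i)" for X Y m i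
      using that by (rule contr)
    show "majorized \<kappa> R (\<Phi> X i)" if "\<And>i. majorized \<kappa> R (X i)" for X i using that by (rule ball)
  qed (use \<kappa> R in auto)
  define U where "U = V W"
  define K where "K b a = (if lam a = lam b then 0 else S W b a)" for b a
  have W_eq: "W (b, a) = N W b a + K b a" if "b \<in> I" "a \<in> I" for b a
    using W(1)[of "(b, a)"] that by (simp add: \<Phi>_def K_def)
  have N_sym: "N W b a = N W a b" for a b
    unfolding N_def by (simp add: mult.commute)
  have M_sym: "M W b a = M W a b" for a b
  proof -
    have "(\<Sum>k\<in>I. \<Sum>l\<in>I. V W k b * (E k l * V W l a)) = (\<Sum>l\<in>I. \<Sum>k\<in>I. V W k b * (E k l * V W l a))"
      by (rule sum.swap)
    also have "\<dots> = (\<Sum>k\<in>I. \<Sum>l\<in>I. V W k a * (E k l * V W l b))"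
    proof (intro sum.cong refl)
      fix k l assume kl: "k \<in> I" "l \<in> I"
      have "E k l = E l k" using sym[OF kl] by (simp add: E_def)
      then show "V W l b * (E l k * V W k a) = V W k a * (E k l * V W l b)" by simp
    qed
    finally show ?thesis unfolding M_def by (simp add: mult.commute)
  qed
  have K_skew: "K a b = - K b a" for a b
  proof -
    have *: "fps_const (-1 / (lam a - lam b)) = - fps_const (-1 / (lam b - lam a))"
      by (simp add: fps_const_neg[symmetric] minus_divide_right)
    then show ?thesis
      unfolding K_def S_def N_sym[of a b] M_sym[of a b] *
      by (simp only: add.commute mult_minus_left minus_zero eq_commute if_distrib[of uminus])
  qed
  \<comment> \<open>Since K is skew, W + W^T = 2 N = - W^T W, which is the orthogonality of 1 +
    W.\<close>
  have WW: "(\<Sum>k\<in>I. W (k, i) * W (k, j)) = - (W (i, j) + W (j, i))" if "i \<in> I" "j \<in> I" for i j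
  proof -
    have "W (i, j) + W (j, i) = N W i j + N W i j"
      using K_skew[of j i] N_sym[of j i] by (simp add: W_eq that)
    also have "\<dots> = fps_const (-1/2 + -1/2) * (\<Sum>k\<in>I. W (k, i) * W (k, j))"
      unfolding N_def fps_const_add[symmetric] distrib_right ..
    also have "fps_const (-1/2 + -1/2) = (-1 :: real fps)"
      by (simp add: fps_const_neg[symmetric] del: fps_const_neg)
    finally show ?thesis by simp
  qed
  have d1: "(\<Sum>k\<in>I. (if k = i then 1 else 0) * f k) = f i" "(\<Sum>k\<in>I. f k * (if k = i then 1 else 0)) = f i"
    if "i \<in> I" for f :: "'i \<Rightarrow> real fps" and i
    by (simp_all only: sum_delta_mult[OF fin that])
  have orth: "(\<Sum>k\<in>I. U k i * U k j) = (if i = j then 1 else 0)" if "i \<in> I" "j \<in> I" for i j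
  proof -
    have "(\<Sum>k\<in>I. U k i * U k j) = (\<Sum>k\<in>I. (if k = i then 1 else 0) * (if k = j then 1 else 0)) +
       (\<Sum>k\<in>I. (if k = i then 1 else 0) * W (k, j)) + (\<Sum>k\<in>I. W (k, i) * (if k = j then 1 else 0)) +
       (\<Sum>k\<in>I. W (k, i) * W (k, j))"
      unfolding sum.distrib[symmetric] by (intro sum.cong refl) (simp only: U_def V_def distrib_left distrib_right add_ac)
    also have "\<dots> = (if i = j then 1 else 0)"
      unfolding d1[OF that(1)] d1[OF that(2)] WW[OF that] by simp
    finally show ?thesis .
  qed
  have "orthogonal_on I U" by (rule orthogonal_onI[OF fin orth])
  moreover have "fps_conv_radius (U i j) > 0" for i j
    unfolding U_def V_def
    by (intro conv_fps.P_add majorized_imp_conv_radius_pos[OF W(2) R(2)]) auto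
  moreover have "congruence_on I U A b a = 0" if ba: "b \<in> I" "a \<in> I" and neq: "lam b \<noteq> lam a" for b a
  proof -
    have d1k: "(\<Sum>l\<in>I. (if k = l then fps_const (lam k) else 0) * f l) = fps_const (lam k) * f k"
      if "k \<in> I" for f :: "'i \<Rightarrow> real fps" and k
    proof -
      have "(\<Sum>l\<in>I. (if k = l then fps_const (lam k) else 0) * f l) = (\<Sum>l\<in>I. (if k = l then 1 else 0) * (fps_const (lam k) * f l))"
        by (intro sum.cong refl) simp
      then show ?thesis by (simp only: sum_delta_mult[OF fin that])
    qed
    have A_eq: "A k l = (if k = l then fps_const (lam k) else 0) + E k l" for k l by (simp add: E_def)
    have "congruence_on I U A b a = (\<Sum>k\<in>I. U k b * (\<Sum>l\<in>I. (if k = l then fps_const (lam k) else 0) * U l a)) +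
        (\<Sum>k\<in>I. \<Sum>l\<in>I. U k b * (E k l * U l a))"
      unfolding congruence_on_def A_eq sum_distrib_left sum.distrib[symmetric]
      by (intro sum.cong refl) (simp only: distrib_left distrib_right mult.assoc)
    also have "(\<Sum>k\<in>I. U k b * (\<Sum>l\<in>I. (if k = l then fps_const (lam k) else 0) * U l a)) =
        (\<Sum>k\<in>I. U k b * (fps_const (lam k) * U k a))"
      by (intro sum.cong[OF refl]) (simp only: d1k)
    also have "\<dots> = (\<Sum>k\<in>I. (if k = b then 1 else 0) * (fps_const (lam k) * (if k = a then 1 else 0))) +
       (\<Sum>k\<in>I. (if k = b then 1 else 0) * (fps_const (lam k) * W (k, a))) +
       (\<Sum>k\<in>I. (W (k, b) * fps_const (lam k)) * (if k = a then 1 else 0)) +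
       (\<Sum>k\<in>I. fps_const (lam k) * (W (k, b) * W (k, a)))"
      unfolding sum.distrib[symmetric]
      by (intro sum.cong refl) (simp only: U_def V_def distrib_left distrib_right add_ac mult.assoc mult.left_commute)
    also have "\<dots> = fps_const (lam b) * W (b, a) + W (a, b) * fps_const (lam a) +
       (\<Sum>k\<in>I. fps_const (lam k) * (W (k, b) * W (k, a)))"
      unfolding d1[OF ba(1)] d1[OF ba(2)] using neq by auto
    finally have "congruence_on I U A b a =
        fps_const (lam b) * W (b, a) + fps_const (lam a) * W (a, b) + M W b a"
      by (simp add: M_def U_def mult.commute)
    \<comment> \<open>Symmetry of N pairs it with the sum of the eigenvalues, skewness of K pairs it
      with their difference. Inserting the definition of K as S then cancels everything.\<close>
    also have "\<dots> = fps_const (lam a + lam b) * N W b a + fps_const (lam b - lam a) * K b a + M W b a"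
      unfolding W_eq[OF ba] W_eq[OF ba(2,1)] K_skew[of a b] N_sym[of a b]
      by (simp add: fps_const_add[symmetric] fps_const_sub[symmetric] algebra_simps del: fps_const_add fps_const_sub)
    also have "fps_const (lam b - lam a) * K b a = fps_const ((lam b - lam a) * (-1 / (lam b - lam a))) *
       (fps_const (lam a + lam b) * N W b a + M W b a)"
      unfolding K_def S_def fps_const_mult[symmetric] using neq by (simp only: if_False mult.assoc) simp
    also have "(lam b - lam a) * (-1 / (lam b - lam a)) = -1" using neq by simp
    finally show ?thesis by (simp add: fps_const_neg[symmetric] del: fps_const_neg)
  qed
  ultimately show ?thesis using that by blast
qed

text \<open>If A(0) is scalar, its eigenvalues separate nothing. Therefore A i0 i0 is first
  subtracted from the diagonal and the highest common power of the variable divided out. The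
  resulting C has C(0) nonzero with entry 0 at (i0, i0), so C(0) is not scalar, has at least two
  distinct eigenvalues, and the index set splits into two proper subsets.\<close>

theorem rellich_on:
  fixes A :: "'i \<Rightarrow> 'i \<Rightarrow> real fps"
  assumes "finite I" "\<And>i j. i \<in> I \<Longrightarrow> j \<in> I \<Longrightarrow> A i j = A j i"
    "\<And>i j. i \<in> I \<Longrightarrow> j \<in> I \<Longrightarrow> fps_conv_radius (A i j) > 0"
  shows "conv_fps.diagonalizable_on I A"
  using assms
proof (induction I arbitrary: A rule: finite_psubset_induct)
  case (psubset I)
  note fin = \<open>finite I\<close> and sym = psubset.prems(1) and conv = psubset.prems(2)
  show ?case
  proof (cases "I = {}")
    case True then show ?thesis by (simp add: conv_fps.diagonalizable_on_empty)
  next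
    case False
    then obtain i0 where i0: "i0 \<in> I" by auto
    define f where "f = A i0 i0"
    define B where "B i j = A i j - (if i = j then f else 0)" for i j
    show ?thesis
    proof (cases "\<forall>i\<in>I. \<forall>j\<in>I. B i j = 0")
      case True
      then have "A i j = 0" if "i \<in> I" "j \<in> I" "i \<noteq> j" for i j
        using that by (force simp: B_def)
      then show ?thesis by (intro conv_fps.diagonalizable_on_diag fin)
    next
      case False
      define m where "m = (LEAST m. \<exists>i\<in>I. \<exists>j\<in>I. fps_nth (B i j) m \<noteq> 0)"
      have "\<exists>m. \<exists>i\<in>I. \<exists>j\<in>I. fps_nth (B i j) m \<noteq> 0"
        using False by (metis fps_nonzero_nth)
      then have m: "\<exists>i\<in>I. \<exists>j\<in>I. fps_nth (B i j) m \<noteq> 0"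
        unfolding m_def by (rule LeastI_ex)
      have below: "fps_nth (B i j) l = 0" if "i \<in> I" "j \<in> I" "l < m" for i j l
        using not_less_Least[OF that(3)[unfolded m_def]] that by blast
      define C where "C i j = fps_shift m (B i j)" for i j
      have BC: "B i j = fps_X ^ m * C i j" if "i \<in> I" "j \<in> I" for i j
        using below[OF that] by (simp add: C_def fps_eq_iff fps_X_power_mult_nth)
      have Csym: "C i j = C j i" if "i \<in> I" "j \<in> I" for i j
        using sym[OF that] by (simp add: C_def B_def)
      have Cconv: "fps_conv_radius (C i j) > 0" if "i \<in> I" "j \<in> I" for i j
        using conv[OF that] conv[OF i0 i0] fps_conv_radius_diff[of "A i j" f]
        by (auto simp: C_def B_def f_def min_def split: if_splits)
      have "real_ring.diagonalizable_on I (\<lambda>i j. fps_nth (C i j) 0)"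
        by (intro real_symmetric_diagonalizable_on fin) (metis Csym)
      then obtain u where u: "orthogonal_on I u"
        "\<And>i j. i \<in> I \<Longrightarrow> j \<in> I \<Longrightarrow> i \<noteq> j \<Longrightarrow> congruence_on I u (\<lambda>i j. fps_nth (C i j) 0) i j = 0"
        by (auto simp: real_ring.diagonalizable_on_def)
      define lam where "lam i = congruence_on I u (\<lambda>i j. fps_nth (C i j) 0) i i" for i
      define U where "U i j = fps_const (u i j)" for i j
      have "(\<Sum>k\<in>I. fps_const (a k) * fps_const (b k)) = fps_const (\<Sum>k\<in>I. a k * b k)" for a b :: "'i \<Rightarrow> real"
        by (auto simp: fps_eq_iff fps_sum_nth)
      then have orthU: "orthogonal_on I U"
        using u(1) by (auto simp: orthogonal_on_def U_def)
      define C1 where "C1 = congruence_on I U C"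
      have C1_0: "fps_nth (C1 i j) 0 = (if i = j then lam i else 0)" if "i \<in> I" "j \<in> I" for i j
        using u(2)[OF that] by (auto simp: C1_def U_def congruence_on_def fps_sum_nth lam_def)
      have C1_sym: "C1 i j = C1 j i" for i j
        unfolding C1_def by (rule congruence_on_sym) (rule Csym)
      have C1_conv: "fps_conv_radius (C1 i j) > 0" if "i \<in> I" "j \<in> I" for i j
        unfolding C1_def by (intro conv_fps.P_congruence_on Cconv that) (auto simp: U_def)
      obtain U1 where U1: "orthogonal_on I U1" "\<And>i j. i \<in> I \<Longrightarrow> j \<in> I \<Longrightarrow> fps_conv_radius (U1 i j) > 0"
        "\<And>i j. i \<in> I \<Longrightarrow> j \<in> I \<Longrightarrow> lam i \<noteq> lam j \<Longrightarrow> congruence_on I U1 C1 i j = 0"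
        using separate_eigenvalues_on[of I C1 lam, OF fin C1_sym C1_conv C1_0] by blast
      define C2 where "C2 = congruence_on I U1 C1"
      have C2_sym: "C2 i j = C2 j i" for i j
        unfolding C2_def by (rule congruence_on_sym) (rule C1_sym)
      have C2_conv: "fps_conv_radius (C2 i j) > 0" if "i \<in> I" "j \<in> I" for i j
        unfolding C2_def by (intro conv_fps.P_congruence_on C1_conv U1 that)
      define J where "J = {j\<in>I. lam j = lam i0}"
      \<comment> \<open>With a single eigenvalue C(0) would be lam i0 times the identity. Its entry
        at (i0, i0) is 0 by the choice of f, so C(0) would vanish, contrary to the choice of
        m.\<close>
      have "J \<noteq> I"
      proof
        assume "J = I"
        then have lam: "lam j = lam i0" if "j \<in> I" for j using that by (auto simp: J_def)
        have C0: "fps_nth (C i j) 0 = (if i = j then lam i0 else 0)" if ij: "i \<in> I" "j \<in> I" for i j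
        proof -
          \<comment> \<open>Congruence with the transpose of u undoes the congruence with u and
            recovers C(0).\<close>
          have u': "orthogonal_on I (\<lambda>i j. u j i)" using u(1) by (auto simp: orthogonal_on_def)
          have id: "congruence_on I (\<lambda>i j. \<Sum>k\<in>I. u i k * u j k) (\<lambda>i j. fps_nth (C i j) 0) i j = fps_nth (C i j) 0"
          proof -
            have "congruence_on I (\<lambda>i j. \<Sum>k\<in>I. u i k * u j k) (\<lambda>i j. fps_nth (C i j) 0) i j =
              (\<Sum>k\<in>I. \<Sum>l\<in>I. (if k = i then 1 else 0) * fps_nth (C k l) 0 * (if l = j then 1 else 0))"
              unfolding congruence_on_def using u(1) ij
              by (intro sum.cong refl) (auto simp: orthogonal_on_def)
            also have "\<dots> = (\<Sum>k\<in>I. (if k = i then 1 else 0) * fps_nth (C k j) 0)"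
              by (intro sum.cong[OF refl]) (simp only: sum_delta_mult[OF fin ij(2)])
            also have "\<dots> = fps_nth (C i j) 0" by (simp only: sum_delta_mult[OF fin ij(1)])
            finally show ?thesis .
          qed
          have "fps_nth (C i j) 0 = congruence_on I (\<lambda>i j. u j i) (congruence_on I u (\<lambda>i j. fps_nth (C i j) 0)) i j"
            unfolding congruence_on_mult[symmetric] id ..
          also have "\<dots> = (if i = j then lam i0 else 0) + 0 * congruence_on I (\<lambda>i j. u j i) (\<lambda>i j. 0) i j"
          proof (rule congruence_on_affine[OF fin u' ij])
            fix k l assume kl: "k \<in> I" "l \<in> I"
            show "congruence_on I u (\<lambda>i j. fps_nth (C i j) 0) k l = (if k = l then lam i0 else 0) + 0 * 0"
              using u(2)[OF kl] lam[OF kl(1)] by (auto simp: lam_def)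
          qed
          finally show ?thesis by simp
        qed
        have "fps_nth (C i0 i0) 0 = 0" by (simp add: C_def B_def f_def)
        then have "lam i0 = 0" using C0[OF i0 i0] by simp
        then have "fps_nth (C i j) 0 = 0" if "i \<in> I" "j \<in> I" for i j using C0[OF that] by simp
        then show False using m by (auto simp: C_def)
      qed
      moreover have "J \<subseteq> I" "i0 \<in> J" using i0 by (auto simp: J_def)
      ultimately have J: "J \<subset> I" "I - J \<subset> I" "I = J \<union> (I - J)" "J \<inter> (I - J) = {}" by auto
      have "conv_fps.diagonalizable_on I C2"
      proof (rule conv_fps.diagonalizable_on_Un[OF fin J(3,4)])
        show "conv_fps.diagonalizable_on J C2"
          by (rule psubset.IH[OF J(1)], rule C2_sym) (use J C2_conv in auto)
        show "conv_fps.diagonalizable_on (I - J) C2"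
          by (rule psubset.IH[OF J(2)], rule C2_sym) (use C2_conv in auto)
        fix k l assume kl: "k \<in> J" "l \<in> I - J"
        then have "C2 k l = 0" using U1(3)[of k l] by (auto simp: J_def C2_def)
        then show "C2 k l = 0 \<and> C2 l k = 0" using C2_sym[of l k] by simp
      qed
      then have "conv_fps.diagonalizable_on I C1"
        unfolding C2_def by (rule conv_fps.diagonalizable_on_congruence[OF fin U1(1), rotated]) (rule U1(2))
      then have "conv_fps.diagonalizable_on I C"
        unfolding C1_def by (rule conv_fps.diagonalizable_on_congruence[OF fin orthU, rotated]) (auto simp: U_def)
      moreover have "A k l = (if k = l then f else 0) + fps_X ^ m * C k l" if "k \<in> I" "l \<in> I" for k l
        using BC[OF that] by (simp add: B_def algebra_simps split: if_splits)
      ultimately show ?thesis by (rule conv_fps.diagonalizable_on_affine[OF fin])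
    qed
  qed
qed

subsection \<open>Eigenvectors of scaled matrices\<close>

text \<open>
  With \<open>y\<^sub>a = \<epsilon>\<^bsup>d a\<^esup> v\<^sub>a\<close> the eigenvalue equation becomes \<open>M y = \<lambda> z\<close> with \<open>z\<^sub>a = \<epsilon>\<^bsup>- d a\<^esup> v\<^sub>a\<close>.
  Coercivity gives \<open>c |y|\<^sup>2 \<le> y\<^sup>T M y = \<lambda>\<close> and boundedness \<open>\<lambda> |z\<^sub>a| \<le> C |y|\<close>. Comparing the orders
  in \<open>\<epsilon>\<close> shows that the limit \<open>w\<close> of \<open>v\<close> lives in a single block \<open>i\<close> and that \<open>\<lambda>\<close> has exact order \<open>2 i\<close>.
\<close>

locale scaled_eigenvector =
  fixes n :: nat and d :: "nat \<Rightarrow> nat" and M :: "real \<Rightarrow> nat \<Rightarrow> nat \<Rightarrow> real"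
    and H :: "nat \<Rightarrow> nat \<Rightarrow> real" and c :: real
    and v :: "real \<Rightarrow> nat \<Rightarrow> real" and w :: "nat \<Rightarrow> real" and lam :: "real \<Rightarrow> real"
  assumes M_lim: "\<And>a b. a < n \<Longrightarrow> b < n \<Longrightarrow> ((\<lambda>\<epsilon>. M \<epsilon> a b) \<longlongrightarrow> H a b) (at_right 0)"
    and c: "c > 0"
    and coercive: "\<And>x. c * (\<Sum>a<n. (x a)\<^sup>2) \<le> (\<Sum>a<n. \<Sum>b<n. x a * H a b * x b)"
    and v_lim: "\<And>a. a < n \<Longrightarrow> ((\<lambda>\<epsilon>. v \<epsilon> a) \<longlongrightarrow> w a) (at_right 0)"
    and v_unit: "\<forall>\<^sub>F \<epsilon> in at_right 0. (\<Sum>a<n. (v \<epsilon> a)\<^sup>2) = 1"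
    and eigen: "\<forall>\<^sub>F \<epsilon> in at_right 0. \<forall>a<n. (\<Sum>b<n. \<epsilon> ^ (d a + d b) * M \<epsilon> a b * v \<epsilon> b) = lam \<epsilon> * v \<epsilon> a"
begin

definition y :: "real \<Rightarrow> nat \<Rightarrow> real" where "y \<epsilon> a = \<epsilon> ^ d a * v \<epsilon> a"

definition q :: "real \<Rightarrow> real" where "q \<epsilon> = sqrt (\<Sum>a<n. (y \<epsilon> a)\<^sup>2)"

lemma pos: "\<forall>\<^sub>F \<epsilon> in at_right 0. (\<epsilon> :: real) > 0"
  by (rule eventually_at_right_less)

lemma q_nonneg: "q \<epsilon> \<ge> 0" by (simp add: q_def sum_nonneg)

lemma q_square: "(q \<epsilon>)\<^sup>2 = (\<Sum>a<n. (y \<epsilon> a)\<^sup>2)" by (simp add: q_def sum_nonneg)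

lemma abs_y_le: "a < n \<Longrightarrow> \<bar>y \<epsilon> a\<bar> \<le> q \<epsilon>"
  unfolding q_def by (rule real_le_rsqrt) (auto intro!: member_le_sum)

lemma row: "\<forall>\<^sub>F \<epsilon> in at_right 0. \<forall>a<n. (\<Sum>b<n. M \<epsilon> a b * y \<epsilon> b) = lam \<epsilon> / \<epsilon> ^ d a * v \<epsilon> a"
  using eigen pos
proof eventually_elim
  case (elim \<epsilon>)
  show ?case
  proof (intro allI impI)
    fix a assume a: "a < n"
    have "\<epsilon> ^ d a * (\<Sum>b<n. M \<epsilon> a b * y \<epsilon> b) = (\<Sum>b<n. \<epsilon> ^ (d a + d b) * M \<epsilon> a b * v \<epsilon> b)"
      unfolding sum_distrib_left by (intro sum.cong refl) (simp add: y_def power_add mult_ac)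
    also have "\<dots> = lam \<epsilon> * v \<epsilon> a" using elim a by blast
    finally show "(\<Sum>b<n. M \<epsilon> a b * y \<epsilon> b) = lam \<epsilon> / \<epsilon> ^ d a * v \<epsilon> a"
      using elim by (simp add: field_simps)
  qed
qed

lemma M_close:
  assumes "\<delta> > 0"
  shows "\<forall>\<^sub>F \<epsilon> in at_right 0. \<forall>a\<in>{..<n}. \<forall>b\<in>{..<n}. \<bar>M \<epsilon> a b - H a b\<bar> < \<delta>"
proof (intro eventually_ball_finite ballI finite_lessThan)
  fix a b assume "a \<in> {..<n}" "b \<in> {..<n}"
  then show "\<forall>\<^sub>F \<epsilon> in at_right 0. \<bar>M \<epsilon> a b - H a b\<bar> < \<delta>"
    using tendstoD[OF M_lim assms, of a b] by (simp add: dist_real_def)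
qed

text \<open>Pairing the equation M y = \<lambda> z with y gives y^T M y = \<lambda> |v|^2 =
  \<lambda>. Replacing M by H costs at most half of the coercivity once M is close to H.\<close>

lemma eigenvalue_lower: "\<forall>\<^sub>F \<epsilon> in at_right 0. c / 2 * (q \<epsilon>)\<^sup>2 \<le> lam \<epsilon>"
proof -
  \<comment> \<open>An entrywise error \<delta> changes the form by at most n^2 \<delta> |y|^2,
    hence by at most c / 2 |y|^2. The summand 1 keeps the denominator positive for n = 0.\<close>
  define \<delta> where "\<delta> = c / (2 * (real n)\<^sup>2 + 1)"
  have \<delta>: "\<delta> > 0" using c by (simp add: \<delta>_def add_nonneg_pos)
  have close: "\<forall>\<^sub>F \<epsilon> in at_right 0. \<forall>a\<in>{..<n}. \<forall>b\<in>{..<n}. \<bar>M \<epsilon> a b - H a b\<bar> < \<delta>"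
    by (rule M_close[OF \<delta>])
  from row close v_unit pos show ?thesis
  proof eventually_elim
    case (elim \<epsilon>)
    have "(\<Sum>a<n. \<Sum>b<n. y \<epsilon> a * M \<epsilon> a b * y \<epsilon> b) = (\<Sum>a<n. y \<epsilon> a * (\<Sum>b<n. M \<epsilon> a b * y \<epsilon> b))"
      by (simp add: sum_distrib_left mult.assoc)
    also have "\<dots> = (\<Sum>a<n. lam \<epsilon> * (v \<epsilon> a)\<^sup>2)"
    proof (intro sum.cong refl)
      fix a assume "a \<in> {..<n}"
      then have "(\<Sum>b<n. M \<epsilon> a b * y \<epsilon> b) = lam \<epsilon> / \<epsilon> ^ d a * v \<epsilon> a" using elim by blast
      then show "y \<epsilon> a * (\<Sum>b<n. M \<epsilon> a b * y \<epsilon> b) = lam \<epsilon> * (v \<epsilon> a)\<^sup>2"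
        using elim by (simp add: y_def power2_eq_square)
    qed
    also have "\<dots> = lam \<epsilon>" using elim by (simp add: sum_distrib_left[symmetric])
    finally have lam: "(\<Sum>a<n. \<Sum>b<n. y \<epsilon> a * M \<epsilon> a b * y \<epsilon> b) = lam \<epsilon>" .
    have "\<bar>(\<Sum>a<n. \<Sum>b<n. y \<epsilon> a * M \<epsilon> a b * y \<epsilon> b) - (\<Sum>a<n. \<Sum>b<n. y \<epsilon> a * H a b * y \<epsilon> b)\<bar> =
        \<bar>\<Sum>a<n. \<Sum>b<n. y \<epsilon> a * (M \<epsilon> a b - H a b) * y \<epsilon> b\<bar>"
      by (simp add: sum_subtractf algebra_simps)
    also have "\<dots> \<le> (\<Sum>a<n. \<Sum>b<n. \<bar>y \<epsilon> a * (M \<epsilon> a b - H a b) * y \<epsilon> b\<bar>)"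
      by (intro order_trans[OF sum_abs] sum_mono sum_abs)
    also have "\<dots> \<le> (\<Sum>a<n. \<Sum>b<n. q \<epsilon> * \<delta> * q \<epsilon>)"
      unfolding abs_mult using elim \<delta> q_nonneg
      by (intro sum_mono mult_mono abs_y_le) (auto intro: less_imp_le)
    also have "\<dots> = (real n)\<^sup>2 * \<delta> * (q \<epsilon>)\<^sup>2" by (simp add: power2_eq_square)
    also have "\<dots> \<le> c / 2 * (q \<epsilon>)\<^sup>2"
    proof (rule mult_right_mono)
      show "(real n)\<^sup>2 * \<delta> \<le> c / 2"
        using c by (simp add: \<delta>_def divide_le_eq add_pos_nonneg algebra_simps)
    qed simp
    finally have "\<bar>lam \<epsilon> - (\<Sum>a<n. \<Sum>b<n. y \<epsilon> a * H a b * y \<epsilon> b)\<bar> \<le> c / 2 * (q \<epsilon>)\<^sup>2" by (simp only: lam)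
    moreover have "c * (q \<epsilon>)\<^sup>2 = c / 2 * (q \<epsilon>)\<^sup>2 + c / 2 * (q \<epsilon>)\<^sup>2" by simp
    ultimately show ?case using coercive[of "y \<epsilon>"] unfolding q_square[symmetric] by linarith
  qed
qed

lemma eigenvalue_upper:
  "\<exists>C>0. \<forall>\<^sub>F \<epsilon> in at_right 0. \<forall>a<n. \<bar>lam \<epsilon>\<bar> * \<bar>v \<epsilon> a\<bar> \<le> \<epsilon> ^ d a * (C * q \<epsilon>)"
proof -
  \<comment> \<open>Entries of M are eventually within 1 of those of H, so h bounds them all. The
    inserted 1 makes h at least 1, also for n = 0.\<close>
  define h where "h = Max (insert 1 ((\<lambda>(a, b). \<bar>H a b\<bar> + 1) ` ({..<n} \<times> {..<n})))"
  have h: "\<bar>H a b\<bar> + 1 \<le> h" if "a < n" "b < n" for a b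
    unfolding h_def using that by (intro Max_ge) auto
  have h1: "h \<ge> 1" unfolding h_def by (intro Max_ge) auto
  have close: "\<forall>\<^sub>F \<epsilon> in at_right 0. \<forall>a\<in>{..<n}. \<forall>b\<in>{..<n}. \<bar>M \<epsilon> a b - H a b\<bar> < 1"
    by (rule M_close) simp
  from row close pos have "\<forall>\<^sub>F \<epsilon> in at_right 0. \<forall>a<n. \<bar>lam \<epsilon>\<bar> * \<bar>v \<epsilon> a\<bar> \<le> \<epsilon> ^ d a * ((real n + 1) * h * q \<epsilon>)"
  proof eventually_elim
    case (elim \<epsilon>)
    show ?case
    proof (intro allI impI)
      fix a assume a: "a < n"
      have "\<bar>lam \<epsilon>\<bar> * \<bar>v \<epsilon> a\<bar> = \<epsilon> ^ d a * \<bar>lam \<epsilon> / \<epsilon> ^ d a * v \<epsilon> a\<bar>"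
        using elim by (simp add: abs_mult)
      also have "lam \<epsilon> / \<epsilon> ^ d a * v \<epsilon> a = (\<Sum>b<n. M \<epsilon> a b * y \<epsilon> b)" using elim a by metis
      also have "\<bar>\<Sum>b<n. M \<epsilon> a b * y \<epsilon> b\<bar> \<le> (\<Sum>b<n. h * q \<epsilon>)"
      proof (rule order_trans[OF sum_abs sum_mono])
        fix b assume "b \<in> {..<n}"
        then have "\<bar>M \<epsilon> a b\<bar> \<le> h" using elim a h[of a b] by force
        then show "\<bar>M \<epsilon> a b * y \<epsilon> b\<bar> \<le> h * q \<epsilon>"
          unfolding abs_mult using \<open>b \<in> {..<n}\<close> h1 by (intro mult_mono abs_y_le) auto
      qed
      also have "\<dots> \<le> (real n + 1) * h * q \<epsilon>"
        using h1 q_nonneg[of \<epsilon>] by (simp add: algebra_simps)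
      finally show "\<bar>lam \<epsilon>\<bar> * \<bar>v \<epsilon> a\<bar> \<le> \<epsilon> ^ d a * ((real n + 1) * h * q \<epsilon>)"
        using elim by (simp add: mult_left_mono)
    qed
  qed
  moreover have "(real n + 1) * h > 0" using h1 by simp
  ultimately show ?thesis by blast
qed

lemma eventually_abs_v_ge:
  assumes "a < n" "w a \<noteq> 0"
  shows "\<forall>\<^sub>F \<epsilon> in at_right 0. \<bar>v \<epsilon> a\<bar> \<ge> \<bar>w a\<bar> / 2"
proof -
  have "\<forall>\<^sub>F \<epsilon> in at_right 0. \<bar>v \<epsilon> a\<bar> > \<bar>w a\<bar> / 2"
    using tendsto_rabs[OF v_lim[OF assms(1)]] assms(2) by (intro order_tendstoD) auto
  then show ?thesis by eventually_elim simp
qed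

text \<open>From below, the norm of y dominates its component at a, which is of order \<epsilon>^(d
  a) as w a \<noteq> 0. From above, c / 2 q^2 \<le> \<lambda> and \<lambda> |v a| \<le> C
  \<epsilon>^(d a) q combine, and one factor q cancels.\<close>

lemma q_bounds:
  assumes a: "a < n" "w a \<noteq> 0"
  shows "\<exists>C>0. \<forall>\<^sub>F \<epsilon> in at_right 0. q \<epsilon> \<le> C * \<epsilon> ^ d a"
    "\<exists>C>0. \<forall>\<^sub>F \<epsilon> in at_right 0. C * \<epsilon> ^ d a \<le> q \<epsilon>"
proof -
  have low: "\<forall>\<^sub>F \<epsilon> in at_right 0. \<bar>w a\<bar> / 2 * \<epsilon> ^ d a \<le> q \<epsilon>"
    using eventually_abs_v_ge[OF a] pos
  proof eventually_elim
    case (elim \<epsilon>)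
    have "\<bar>w a\<bar> / 2 * \<epsilon> ^ d a \<le> \<bar>y \<epsilon> a\<bar>"
      using elim by (simp add: y_def abs_mult mult.commute mult_left_mono)
    then show ?case using abs_y_le[OF a(1), of \<epsilon>] by linarith
  qed
  then show "\<exists>C>0. \<forall>\<^sub>F \<epsilon> in at_right 0. C * \<epsilon> ^ d a \<le> q \<epsilon>"
    using a by (intro exI[of _ "\<bar>w a\<bar> / 2"]) auto
  obtain C where C: "C > 0" "\<forall>\<^sub>F \<epsilon> in at_right 0. \<forall>a<n. \<bar>lam \<epsilon>\<bar> * \<bar>v \<epsilon> a\<bar> \<le> \<epsilon> ^ d a * (C * q \<epsilon>)"
    using eigenvalue_upper by blast
  from C(2) low eigenvalue_lower eventually_abs_v_ge[OF a] pos
  have "\<forall>\<^sub>F \<epsilon> in at_right 0. q \<epsilon> \<le> (4 * C / (c * \<bar>w a\<bar>)) * \<epsilon> ^ d a"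
  proof eventually_elim
    case (elim \<epsilon>)
    have "\<bar>w a\<bar> / 2 * \<epsilon> ^ d a > 0" using elim a by simp
    then have q: "q \<epsilon> > 0" using elim by linarith
    have "c / 2 * (q \<epsilon>)\<^sup>2 * (\<bar>w a\<bar> / 2) \<le> \<bar>lam \<epsilon>\<bar> * \<bar>v \<epsilon> a\<bar>"
      using elim c by (intro mult_mono) auto
    also have "\<dots> \<le> \<epsilon> ^ d a * (C * q \<epsilon>)" using elim a by blast
    finally have "q \<epsilon> * (c / 2 * q \<epsilon> * (\<bar>w a\<bar> / 2)) \<le> q \<epsilon> * (\<epsilon> ^ d a * C)"
      by (simp add: power2_eq_square mult_ac)
    then have "c / 2 * q \<epsilon> * (\<bar>w a\<bar> / 2) \<le> \<epsilon> ^ d a * C" using q by (simp only: mult_le_cancel_left_pos)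
    then show ?case using c a by (simp add: field_simps)
  qed
  moreover have "4 * C / (c * \<bar>w a\<bar>) > 0" using C c a by simp
  ultimately show "\<exists>C>0. \<forall>\<^sub>F \<epsilon> in at_right 0. q \<epsilon> \<le> C * \<epsilon> ^ d a" by blast
qed

lemma power_order:
  assumes "C > 0" "D > 0" "\<forall>\<^sub>F \<epsilon> in at_right 0. C * \<epsilon> ^ i \<le> D * (\<epsilon> :: real) ^ j"
  shows "j \<le> i"
proof (rule ccontr)
  assume "\<not> j \<le> i"
  then have ij: "j - i > 0" "j = i + (j - i)" by auto
  have "((\<lambda>\<epsilon>. D * \<epsilon> ^ (j - i)) \<longlongrightarrow> D * 0 ^ (j - i)) (at_right (0 :: real))"
    by (intro tendsto_intros)
  then have "\<forall>\<^sub>F \<epsilon> in at_right 0. D * (\<epsilon> :: real) ^ (j - i) < C"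
    by (rule order_tendstoD(2)) (simp add: zero_power[OF ij(1)] assms(1))
  with assms(3) pos have "\<forall>\<^sub>F \<epsilon> :: real in at_right 0. False"
  proof eventually_elim
    case (elim \<epsilon>)
    have "D * \<epsilon> ^ j = (D * \<epsilon> ^ (j - i)) * \<epsilon> ^ i" by (subst ij(2)) (simp add: power_add mult_ac)
    also have "\<dots> < C * \<epsilon> ^ i" using elim by (intro mult_strict_right_mono) auto
    finally show False using elim by simp
  qed
  then show False by (simp add: trivial_limit_at_right_real eventually_False)
qed

text \<open>The norm q has the exact order d a for every index a in the support of w, and an exact
  order is unique.\<close>

lemma same_block:
  assumes a: "a < n" "w a \<noteq> 0" and b: "b < n" "w b \<noteq> 0"
  shows "d a = d b"
proof -
  have "d b \<le> d a" if a: "a < n" "w a \<noteq> 0" and b: "b < n" "w b \<noteq> 0" for a b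
  proof -
    obtain C where C: "C > 0" "\<forall>\<^sub>F \<epsilon> in at_right 0. C * \<epsilon> ^ d a \<le> q \<epsilon>" using q_bounds[OF a] by blast
    obtain D where D: "D > 0" "\<forall>\<^sub>F \<epsilon> in at_right 0. q \<epsilon> \<le> D * \<epsilon> ^ d b" using q_bounds[OF b] by blast
    have "\<forall>\<^sub>F \<epsilon> in at_right 0. C * \<epsilon> ^ d a \<le> D * \<epsilon> ^ d b"
      using C(2) D(2) by eventually_elim linarith
    then show ?thesis using power_order C D by blast
  qed
  then show ?thesis using a b by (intro antisym) auto
qed

text \<open>The eigenvalue lies between constant multiples of q^2 and of \<epsilon>^(d a) q, and
  both have the exact order 2 d a.\<close>

lemma eigenvalue_order:
  assumes a: "a < n" "w a \<noteq> 0"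
    and lam: "\<forall>\<^sub>F \<epsilon> in at_right 0. lam \<epsilon> = \<epsilon> ^ m * g \<epsilon>" "(g \<longlongrightarrow> l) (at_right 0)" "l \<noteq> 0"
  shows "m = 2 * d a"
proof (rule antisym)
  have g: "\<forall>\<^sub>F \<epsilon> in at_right 0. \<bar>g \<epsilon>\<bar> < 2 * \<bar>l\<bar>" "\<forall>\<^sub>F \<epsilon> in at_right 0. \<bar>g \<epsilon>\<bar> > \<bar>l\<bar> / 2"
    using order_tendstoD(2)[OF tendsto_rabs[OF lam(2)], of "2 * \<bar>l\<bar>"]
      order_tendstoD(1)[OF tendsto_rabs[OF lam(2)], of "\<bar>l\<bar> / 2"] lam(3) by auto
  obtain C where C: "C > 0" "\<forall>\<^sub>F \<epsilon> in at_right 0. C * \<epsilon> ^ d a \<le> q \<epsilon>" using q_bounds[OF a] by blast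
  have "\<forall>\<^sub>F \<epsilon> in at_right 0. (c / 2 * C\<^sup>2) * \<epsilon> ^ (2 * d a) \<le> (2 * \<bar>l\<bar>) * \<epsilon> ^ m"
    using lam(1) g(1) C(2) eigenvalue_lower pos
  proof eventually_elim
    case (elim \<epsilon>)
    have "(C * \<epsilon> ^ d a)\<^sup>2 \<le> (q \<epsilon>)\<^sup>2" using elim C by (intro power_mono) auto
    then have "c / 2 * (C * \<epsilon> ^ d a)\<^sup>2 \<le> c / 2 * (q \<epsilon>)\<^sup>2" using c by (intro mult_left_mono) auto
    also have "\<dots> \<le> \<epsilon> ^ m * g \<epsilon>" using elim by simp
    also have "\<dots> \<le> \<epsilon> ^ m * (2 * \<bar>l\<bar>)" using elim by (intro mult_left_mono) auto
    finally show ?case by (simp add: power_mult_distrib power_mult[symmetric] mult_ac)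
  qed
  then show "m \<le> 2 * d a" by (rule power_order[rotated 2]) (use c C lam in auto)
  obtain B where B: "B > 0" "\<forall>\<^sub>F \<epsilon> in at_right 0. \<forall>a<n. \<bar>lam \<epsilon>\<bar> * \<bar>v \<epsilon> a\<bar> \<le> \<epsilon> ^ d a * (B * q \<epsilon>)"
    using eigenvalue_upper by blast
  obtain D where D: "D > 0" "\<forall>\<^sub>F \<epsilon> in at_right 0. q \<epsilon> \<le> D * \<epsilon> ^ d a" using q_bounds[OF a] by blast
  have "\<forall>\<^sub>F \<epsilon> in at_right 0. (\<bar>l\<bar> / 2 * (\<bar>w a\<bar> / 2)) * \<epsilon> ^ m \<le> (B * D) * \<epsilon> ^ (2 * d a)"
    using lam(1) g(2) B(2) D(2) eventually_abs_v_ge[OF a] pos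
  proof eventually_elim
    case (elim \<epsilon>)
    have "\<epsilon> ^ m * (\<bar>l\<bar> / 2) * (\<bar>w a\<bar> / 2) \<le> (\<epsilon> ^ m * \<bar>g \<epsilon>\<bar>) * \<bar>v \<epsilon> a\<bar>"
      using elim by (intro mult_mono mult_left_mono) auto
    also have "\<dots> = \<bar>lam \<epsilon>\<bar> * \<bar>v \<epsilon> a\<bar>" using elim by (simp add: abs_mult)
    also have "\<dots> \<le> \<epsilon> ^ d a * (B * q \<epsilon>)" using elim a by blast
    also have "\<dots> \<le> \<epsilon> ^ d a * (B * (D * \<epsilon> ^ d a))" using elim B by (intro mult_left_mono) auto
    also have "\<dots> = (B * D) * \<epsilon> ^ (2 * d a)"
      unfolding mult_2 power_add by (simp only: mult_ac)
    finally show ?case by (simp only: mult_ac)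
  qed
  then show "2 * d a \<le> m" by (rule power_order[rotated 2]) (use a B D lam in auto)
qed

text \<open>Positivity of q keeps the eigenvalue away from the zero series, whose leading term would
  be 0 by convention.\<close>

lemma eigenvalue_nonzero:
  assumes a: "a < n" "w a \<noteq> 0"
  shows "\<forall>\<^sub>F \<epsilon> in at_right 0. lam \<epsilon> \<noteq> 0"
proof -
  obtain C where C: "C > 0" "\<forall>\<^sub>F \<epsilon> in at_right 0. C * \<epsilon> ^ d a \<le> q \<epsilon>" using q_bounds[OF a] by blast
  from C(2) eigenvalue_lower pos show ?thesis
  proof eventually_elim
    case (elim \<epsilon>)
    have "0 < C * \<epsilon> ^ d a" using elim C by simp
    then have "q \<epsilon> > 0" using elim by linarith
    then have "c / 2 * (q \<epsilon>)\<^sup>2 > 0" using c by simp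
    then show ?case using elim by simp
  qed
qed

text \<open>
  Row operations \<open>p\<close> that clear the columns of the blocks below \<open>i\<close> produce the Schur complement;
  they leave the limit of row \<open>a\<close> of \<open>\<epsilon>\<^bsup>- i\<^esup> M y\<close> unchanged because \<open>\<epsilon>\<^bsup>- i\<^esup> \<lambda> z\<^sub>b\<close> tends to 0 for \<open>d b < i\<close>.
\<close>

lemma schur_eigenvector:
  assumes lam: "\<forall>\<^sub>F \<epsilon> in at_right 0. lam \<epsilon> = \<epsilon> ^ (2 * i) * g \<epsilon>" "(g \<longlongrightarrow> l) (at_right 0)"
    and supp: "\<And>a. a < n \<Longrightarrow> w a \<noteq> 0 \<Longrightarrow> d a = i" and w: "\<exists>a<n. w a \<noteq> 0"
    and a: "a < n" "d a = i"
    and clear: "\<And>b. b < n \<Longrightarrow> d b < i \<Longrightarrow> H a b + (\<Sum>r\<in>{r. r < n \<and> d r < i}. p r * H r b) = 0"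
  shows "(\<Sum>b\<in>{b. b < n \<and> d b = i}. (H a b + (\<Sum>r\<in>{r. r < n \<and> d r < i}. p r * H r b)) * w b) = l * w a"
proof -
  define L where "L = {r. r < n \<and> d r < i}"
  have finL: "finite L" by (simp add: L_def)
  \<comment> \<open>At this scale Y stays bounded. It tends to w on block i and to 0 on later
    blocks. On earlier blocks only boundedness is known, but there the coefficients tend to 0
    because \<open>p\<close> clears these columns.\<close>
  define Y where "Y \<epsilon> b = y \<epsilon> b / \<epsilon> ^ i" for \<epsilon> b
  obtain a0 where a0: "a0 < n" "w a0 \<noteq> 0" using w by blast
  then have da0: "d a0 = i" using supp by blast
  obtain C where C: "C > 0" "\<forall>\<^sub>F \<epsilon> in at_right 0. q \<epsilon> \<le> C * \<epsilon> ^ i" using q_bounds[OF a0] da0 by auto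
  have Ybd: "\<forall>\<^sub>F \<epsilon> in at_right 0. norm (Y \<epsilon> b) \<le> C" if b: "b < n" for b
    using C(2) pos
  proof eventually_elim
    case (elim \<epsilon>)
    have "\<bar>y \<epsilon> b\<bar> \<le> C * \<epsilon> ^ i" using abs_y_le[OF b, of \<epsilon>] elim by linarith
    then show ?case using elim by (simp add: Y_def field_simps)
  qed
  have coef: "((\<lambda>\<epsilon>. M \<epsilon> a b + (\<Sum>r\<in>L. p r * M \<epsilon> r b)) \<longlongrightarrow> H a b + (\<Sum>r\<in>L. p r * H r b)) (at_right 0)"
    if "b < n" for b
    using that a by (intro tendsto_intros M_lim) (auto simp: L_def)
  have term_lim: "((\<lambda>\<epsilon>. (M \<epsilon> a b + (\<Sum>r\<in>L. p r * M \<epsilon> r b)) * Y \<epsilon> b) \<longlongrightarrow>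
      (if d b = i then (H a b + (\<Sum>r\<in>L. p r * H r b)) * w b else 0)) (at_right 0)" if b: "b < n" for b
  proof -
    consider "d b < i" | "d b = i" | "d b > i" by linarith
    then show ?thesis
    proof cases
      case 1
      then have "H a b + (\<Sum>r\<in>L. p r * H r b) = 0" using clear b by (simp add: L_def)
      then have coef0: "((\<lambda>\<epsilon>. M \<epsilon> a b + (\<Sum>r\<in>L. p r * M \<epsilon> r b)) \<longlongrightarrow> 0) (at_right 0)"
        using coef[OF b] by simp
      have "((\<lambda>\<epsilon>. (M \<epsilon> a b + (\<Sum>r\<in>L. p r * M \<epsilon> r b)) * Y \<epsilon> b) \<longlongrightarrow> 0) (at_right 0)"
      proof (rule Lim_null_comparison[rotated])
        show "((\<lambda>\<epsilon>. norm (M \<epsilon> a b + (\<Sum>r\<in>L. p r * M \<epsilon> r b)) * C) \<longlongrightarrow> 0) (at_right 0)"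
          using coef0 by (intro tendsto_mult_left_zero tendsto_norm_zero)
        show "\<forall>\<^sub>F \<epsilon> in at_right 0. norm ((M \<epsilon> a b + (\<Sum>r\<in>L. p r * M \<epsilon> r b)) * Y \<epsilon> b)
            \<le> norm (M \<epsilon> a b + (\<Sum>r\<in>L. p r * M \<epsilon> r b)) * C"
          using Ybd[OF b] by eventually_elim (unfold norm_mult, intro mult_left_mono, auto)
      qed
      then show ?thesis using 1 by simp
    next
      case 2
      have "\<forall>\<^sub>F \<epsilon> in at_right 0. v \<epsilon> b = Y \<epsilon> b"
        using pos by eventually_elim (simp add: Y_def y_def 2)
      then have "((\<lambda>\<epsilon>. Y \<epsilon> b) \<longlongrightarrow> w b) (at_right 0)"
        using v_lim[OF b] by (rule Lim_transform_eventually[rotated])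
      then show ?thesis using coef[OF b] 2 by (auto intro!: tendsto_mult)
    next
      case 3
      have "\<forall>\<^sub>F \<epsilon> in at_right 0. \<epsilon> ^ (d b - i) * v \<epsilon> b = Y \<epsilon> b"
        using pos
      proof eventually_elim
        case (elim \<epsilon>)
        have "\<epsilon> ^ d b = \<epsilon> ^ i * \<epsilon> ^ (d b - i)" using 3 by (simp add: power_add[symmetric])
        then show ?case using elim by (simp add: Y_def y_def)
      qed
      moreover have "((\<lambda>\<epsilon>. \<epsilon> ^ (d b - i) * v \<epsilon> b) \<longlongrightarrow> 0) (at_right 0)"
      proof -
        have "((\<lambda>\<epsilon>. \<epsilon> ^ (d b - i) * v \<epsilon> b) \<longlongrightarrow> 0 ^ (d b - i) * w b) (at_right 0)"
          by (intro tendsto_intros v_lim b)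
        moreover have "0 ^ (d b - i) * w b = 0" using 3 by simp
        ultimately show ?thesis by (simp only:)
      qed
      ultimately have "((\<lambda>\<epsilon>. Y \<epsilon> b) \<longlongrightarrow> 0) (at_right 0)"
        by (rule Lim_transform_eventually[rotated])
      from tendsto_mult[OF coef[OF b] this] show ?thesis using 3 by simp
    qed
  qed
  have lhs: "((\<lambda>\<epsilon>. \<Sum>b<n. (M \<epsilon> a b + (\<Sum>r\<in>L. p r * M \<epsilon> r b)) * Y \<epsilon> b) \<longlongrightarrow>
      (\<Sum>b<n. if d b = i then (H a b + (\<Sum>r\<in>L. p r * H r b)) * w b else 0)) (at_right 0)"
    by (intro tendsto_sum term_lim) auto
  have "\<forall>\<^sub>F \<epsilon> in at_right 0. g \<epsilon> * v \<epsilon> a + (\<Sum>r\<in>L. p r * (g \<epsilon> * (\<epsilon> ^ (i - d r) * v \<epsilon> r))) =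
      (\<Sum>b<n. (M \<epsilon> a b + (\<Sum>r\<in>L. p r * M \<epsilon> r b)) * Y \<epsilon> b)"
    using row lam(1) pos
  proof eventually_elim
    case (elim \<epsilon>)
    have MY: "(\<Sum>b<n. M \<epsilon> r b * Y \<epsilon> b) = g \<epsilon> * (\<epsilon> ^ (i - d r) * v \<epsilon> r)" if r: "r < n" "d r \<le> i" for r
    proof -
      have "(\<Sum>b<n. M \<epsilon> r b * Y \<epsilon> b) = (\<Sum>b<n. M \<epsilon> r b * y \<epsilon> b) / \<epsilon> ^ i"
        by (simp add: Y_def sum_divide_distrib)
      also have "\<dots> = \<epsilon> ^ (2 * i) * g \<epsilon> / \<epsilon> ^ d r * v \<epsilon> r / \<epsilon> ^ i" using elim r by simp
      also have "\<epsilon> ^ (2 * i) = \<epsilon> ^ i * (\<epsilon> ^ d r * \<epsilon> ^ (i - d r))"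
        using r by (simp add: power_add[symmetric] mult_2)
      finally show ?thesis using elim by simp
    qed
    have "(\<Sum>b<n. (M \<epsilon> a b + (\<Sum>r\<in>L. p r * M \<epsilon> r b)) * Y \<epsilon> b) =
        (\<Sum>b<n. M \<epsilon> a b * Y \<epsilon> b) + (\<Sum>b<n. \<Sum>r\<in>L. p r * (M \<epsilon> r b * Y \<epsilon> b))"
      by (simp add: distrib_right sum.distrib sum_distrib_right mult.assoc)
    also have "(\<Sum>b<n. \<Sum>r\<in>L. p r * (M \<epsilon> r b * Y \<epsilon> b)) = (\<Sum>r\<in>L. p r * (\<Sum>b<n. M \<epsilon> r b * Y \<epsilon> b))"
      unfolding sum_distrib_left by (rule sum.swap)
    also have "\<dots> = (\<Sum>r\<in>L. p r * (g \<epsilon> * (\<epsilon> ^ (i - d r) * v \<epsilon> r)))"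
      by (intro sum.cong refl) (simp add: L_def MY)
    also have "(\<Sum>b<n. M \<epsilon> a b * Y \<epsilon> b) = g \<epsilon> * v \<epsilon> a" using MY[of a] a by simp
    finally show ?case by simp
  qed
  moreover have "((\<lambda>\<epsilon>. g \<epsilon> * v \<epsilon> a + (\<Sum>r\<in>L. p r * (g \<epsilon> * (\<epsilon> ^ (i - d r) * v \<epsilon> r)))) \<longlongrightarrow>
      l * w a + (\<Sum>r\<in>L. p r * (l * (0 ^ (i - d r) * w r)))) (at_right 0)"
    using a by (intro tendsto_intros lam v_lim) (auto simp: L_def)
  \<comment> \<open>For r in L the exponent i - d r is positive, so the rows used for elimination
    contribute nothing to the right-hand side in the limit.\<close>
  moreover have "(\<Sum>r\<in>L. p r * (l * (0 ^ (i - d r) * w r))) = 0"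
    by (intro sum.neutral) (auto simp: L_def)
  ultimately have "((\<lambda>\<epsilon>. \<Sum>b<n. (M \<epsilon> a b + (\<Sum>r\<in>L. p r * M \<epsilon> r b)) * Y \<epsilon> b) \<longlongrightarrow> l * w a) (at_right 0)"
    by (auto intro: Lim_transform_eventually)
  then have "(\<Sum>b<n. if d b = i then (H a b + (\<Sum>r\<in>L. p r * H r b)) * w b else 0) = l * w a"
    using lhs by (intro tendsto_unique[OF trivial_limit_at_right_real])
  then show ?thesis
    by (simp add: L_def sum.inter_filter[symmetric] lessThan_def Collect_conj_eq[symmetric])
qed

end

subsection \<open>Taylor expansion of kernels\<close>

lemma partial_deriv_cong:
  assumes "open U" "z \<in> U" "\<And>u. u \<in> U \<Longrightarrow> f u = g u"
  shows "partial_deriv b f z = partial_deriv b g z"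
  unfolding partial_deriv_def
proof (rule deriv_cong_ev)
  have "((\<lambda>t. z + t *\<^sub>R b) \<longlongrightarrow> z + 0 *\<^sub>R b) (nhds 0)"
    by (intro tendsto_intros filterlim_ident)
  then have "\<forall>\<^sub>F t in nhds 0. z + t *\<^sub>R b \<in> U" using assms by (auto intro: topological_tendstoD)
  then show "\<forall>\<^sub>F t in nhds 0. f (z + t *\<^sub>R b) = g (z + t *\<^sub>R b)"
    by eventually_elim (rule assms(3))
qed simp

lemma iter_partial_cong:
  assumes "open U" "\<And>u. u \<in> U \<Longrightarrow> f u = g u" "z \<in> U"
  shows "iter_partial bs f z = iter_partial bs g z"
  using assms(3)
proof (induction bs arbitrary: z)
  case Nil then show ?case using assms by (simp add: iter_partial_def)
next
  case (Cons b bs)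
  then show ?case
    using partial_deriv_cong[OF assms(1), of z "iter_partial bs f" "iter_partial bs g" b]
    by (simp add: iter_partial_def)
qed

lemma iter_partial_append: "iter_partial (bs @ cs) f = iter_partial bs (iter_partial cs f)"
  by (simp add: iter_partial_def)

lemma iter_partial_Cons: "iter_partial (b # bs) f = partial_deriv b (iter_partial bs f)"
  by (simp add: iter_partial_def)

lemma directional_derivative_shift:
  fixes f :: "'v::real_normed_vector \<Rightarrow> real"
  assumes "((\<lambda>\<tau>. f ((z + s *\<^sub>R b) + \<tau> *\<^sub>R b)) has_real_derivative D) (at 0)"
  shows "((\<lambda>s. f (z + s *\<^sub>R b)) has_real_derivative D) (at s)"
proof -
  have "(\<lambda>\<tau>. f ((z + s *\<^sub>R b) + \<tau> *\<^sub>R b)) = (\<lambda>\<tau>. f (z + (\<tau> + s) *\<^sub>R b))"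
    by (intro ext arg_cong[of _ _ f]) (simp add: algebra_simps)
  then show ?thesis using assms DERIV_shift[of "\<lambda>s. f (z + s *\<^sub>R b)" D 0 s] by simp
qed

text \<open>A directional form of the fact that continuous partial derivatives imply
  differentiability. Directions are added one at a time: the new increment starts at a point already
  displaced in the earlier directions, and continuity of g c at z controls its slope there.\<close>

lemma directional_derivative_sum:
  fixes f :: "'v::real_normed_vector \<Rightarrow> real" and e :: "'c \<Rightarrow> 'v"
  assumes "finite S" and U: "open U" "z \<in> U"
    and deriv: "\<And>c u. c \<in> S \<Longrightarrow> u \<in> U \<Longrightarrow> ((\<lambda>t. f (u + t *\<^sub>R e c)) has_real_derivative g c u) (at 0)"
    and cont: "\<And>c. c \<in> S \<Longrightarrow> continuous_on U (g c)"
  shows "((\<lambda>t. f (z + t *\<^sub>R (\<Sum>c\<in>S. x c *\<^sub>R e c))) has_real_derivative (\<Sum>c\<in>S. x c * g c z)) (at 0)"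
  using assms(1) deriv cont
proof (induction S rule: finite_induct)
  case empty then show ?case by simp
next
  case (insert c S)
  define w where "w = (\<Sum>c\<in>S. x c *\<^sub>R e c)"
  define F where "F t = f (z + t *\<^sub>R w + (t * x c) *\<^sub>R e c) - f (z + t *\<^sub>R w)" for t
  have "(F has_real_derivative x c * g c z) (at 0)"
    unfolding DERIV_def
  proof (rule LIM_I)
    fix r :: real assume r: "r > 0"
    define r' where "r' = r / (2 * (\<bar>x c\<bar> + 1))"
    have r': "r' > 0" using r by (simp add: r'_def)
    have "\<forall>\<^sub>F u in nhds z. dist (g c u) (g c z) < r'"
      using insert.prems(2)[of c] U r' by (intro tendstoD) (auto simp: continuous_on_eq_continuous_at isCont_def tendsto_nhds_iff)
    moreover have "\<forall>\<^sub>F u in nhds z. u \<in> U" using U by (simp add: eventually_nhds_in_open)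
    ultimately have "\<forall>\<^sub>F u in nhds z. u \<in> U \<and> dist (g c u) (g c z) < r'" by eventually_elim simp
    then obtain \<delta> where \<delta>: "\<delta> > 0" "\<And>u. dist u z < \<delta> \<Longrightarrow> u \<in> U \<and> dist (g c u) (g c z) < r'"
      unfolding eventually_nhds_metric by blast
    define B where "B = norm w + \<bar>x c\<bar> * norm (e c) + 1"
    have B: "B > 0" by (simp add: B_def add_nonneg_pos)
    have "norm ((F (0 + h) - F 0) / h - x c * g c z) < r" if h: "h \<noteq> 0" "norm (h - 0) < \<delta> / B" for h
    proof -
      \<comment> \<open>With the linear part at z removed, the slope of G is a difference of two
        values of g c near z, hence at most r'. The mean value estimate then bounds the error of the
        difference quotient of F.\<close>
      define G where "G s = f (z + h *\<^sub>R w + s *\<^sub>R e c) - s * g c z" for s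
      have near: "dist (z + h *\<^sub>R w + s *\<^sub>R e c) z < \<delta>" if "s \<in> closed_segment 0 (h * x c)" for s
      proof -
        have "\<bar>s\<bar> \<le> \<bar>h * x c\<bar>" using segment_bound1[OF that] by simp
        then have "norm (h *\<^sub>R w + s *\<^sub>R e c) \<le> \<bar>h\<bar> * norm w + \<bar>h * x c\<bar> * norm (e c)"
          by (intro order_trans[OF norm_triangle_ineq] add_mono) (auto intro: mult_right_mono)
        also have "\<dots> \<le> \<bar>h\<bar> * B" by (simp add: B_def abs_mult algebra_simps)
        also have "\<dots> < \<delta>" using h B by (simp add: field_simps)
        finally show ?thesis by (simp add: dist_norm add.assoc)
      qed
      have "norm (G (h * x c) - G 0) \<le> r' * norm (h * x c - 0)"
      proof (rule field_differentiable_bound[where S = "closed_segment 0 (h * x c)"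
            and f' = "\<lambda>s. g c (z + h *\<^sub>R w + s *\<^sub>R e c) - g c z"])
        fix s assume s: "s \<in> closed_segment 0 (h * x c)"
        note u = \<delta>(2)[OF near[OF s]]
        have "((\<lambda>s. f (z + h *\<^sub>R w + s *\<^sub>R e c)) has_real_derivative g c (z + h *\<^sub>R w + s *\<^sub>R e c)) (at s)"
          by (rule directional_derivative_shift, rule insert.prems(1)) (use u in auto)
        then have "(G has_real_derivative g c (z + h *\<^sub>R w + s *\<^sub>R e c) - g c z) (at s)"
          unfolding G_def by (auto intro!: derivative_eq_intros)
        then show "(G has_real_derivative g c (z + h *\<^sub>R w + s *\<^sub>R e c) - g c z) (at s within closed_segment 0 (h * x c))"
          by (rule has_field_derivative_at_within)
        show "norm (g c (z + h *\<^sub>R w + s *\<^sub>R e c) - g c z) \<le> r'"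
          using u by (simp add: dist_norm)
      qed auto
      moreover have "G (h * x c) - G 0 = h * ((F (0 + h) - F 0) / h - x c * g c z)"
        using h by (simp add: G_def F_def field_simps)
      ultimately have "\<bar>h\<bar> * \<bar>(F (0 + h) - F 0) / h - x c * g c z\<bar> \<le> \<bar>h\<bar> * (r' * \<bar>x c\<bar>)"
        by (simp add: abs_mult mult_ac)
      then have "\<bar>(F (0 + h) - F 0) / h - x c * g c z\<bar> \<le> r' * \<bar>x c\<bar>"
        using h by (subst (asm) mult_le_cancel_left_pos) auto
      also have "\<dots> \<le> r' * (\<bar>x c\<bar> + 1)" using r' by simp
      also have "\<dots> = r / 2" by (simp add: r'_def field_simps)
      also have "\<dots> < r" using r by simp
      finally show ?thesis by simp
    qed
    then show "\<exists>s>0. \<forall>h. h \<noteq> 0 \<and> norm (h - 0) < s \<longrightarrow> norm ((F (0 + h) - F 0) / h - x c * g c z) < r"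
      using \<delta>(1) B by (intro exI[of _ "\<delta> / B"]) auto
  qed
  moreover have "((\<lambda>t. f (z + t *\<^sub>R w)) has_real_derivative (\<Sum>c\<in>S. x c * g c z)) (at 0)"
    unfolding w_def using insert.prems by (intro insert.IH) auto
  ultimately have "((\<lambda>t. F t + f (z + t *\<^sub>R w)) has_real_derivative x c * g c z + (\<Sum>c\<in>S. x c * g c z)) (at 0)"
    by (rule DERIV_add)
  then show ?case
    using insert.hyps by (simp add: F_def w_def algebra_simps)
qed

text \<open>Schwarz's theorem for two directions. The second difference over a small parallelogram
  is symmetric in a and b, and two applications of the mean value theorem make it s^2 times a value
  of either mixed derivative near z.\<close>

lemma mixed_directional_derivatives_eq:
  fixes f :: "'v::real_normed_vector \<Rightarrow> real"
  assumes U: "open U" "z \<in> U"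
    and fa: "\<And>u. u \<in> U \<Longrightarrow> ((\<lambda>t. f (u + t *\<^sub>R a)) has_real_derivative fa u) (at 0)"
    and fb: "\<And>u. u \<in> U \<Longrightarrow> ((\<lambda>t. f (u + t *\<^sub>R b)) has_real_derivative fb u) (at 0)"
    and fab: "\<And>u. u \<in> U \<Longrightarrow> ((\<lambda>t. fa (u + t *\<^sub>R b)) has_real_derivative fab u) (at 0)"
    and fba: "\<And>u. u \<in> U \<Longrightarrow> ((\<lambda>t. fb (u + t *\<^sub>R a)) has_real_derivative fba u) (at 0)"
    and cont: "continuous_on U fab" "continuous_on U fba"
  shows "fab z = fba z"
proof (rule ccontr)
  have second_difference: "\<exists>\<theta> \<theta>'. 0 \<le> \<theta> \<and> \<theta> \<le> s \<and> 0 \<le> \<theta>' \<and> \<theta>' \<le> s \<and>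
      f (z + s *\<^sub>R a + s *\<^sub>R b) - f (z + s *\<^sub>R a) - f (z + s *\<^sub>R b) + f z = s\<^sup>2 * fab (z + \<theta> *\<^sub>R a + \<theta>' *\<^sub>R b)"
    if s: "s > 0" and sU: "\<And>\<theta> \<theta>'. 0 \<le> \<theta> \<Longrightarrow> \<theta> \<le> s \<Longrightarrow> 0 \<le> \<theta>' \<Longrightarrow> \<theta>' \<le> s \<Longrightarrow> z + \<theta> *\<^sub>R a + \<theta>' *\<^sub>R b \<in> U"
      and fa: "\<And>u. u \<in> U \<Longrightarrow> ((\<lambda>t. f (u + t *\<^sub>R a)) has_real_derivative fa u) (at 0)"
      and fab: "\<And>u. u \<in> U \<Longrightarrow> ((\<lambda>t. fa (u + t *\<^sub>R b)) has_real_derivative fab u) (at 0)"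
    for s a b fa fab
  proof -
    define \<phi> where "\<phi> t = f (z + s *\<^sub>R b + t *\<^sub>R a) - f (z + t *\<^sub>R a)" for t
    have "\<exists>\<theta>>0. \<theta> < s \<and> \<phi> s - \<phi> 0 = (s - 0) * (fa (z + s *\<^sub>R b + \<theta> *\<^sub>R a) - fa (z + \<theta> *\<^sub>R a))"
    proof (rule MVT2[OF s])
      fix t assume t: "0 \<le> t" "t \<le> s"
      show "(\<phi> has_real_derivative fa (z + s *\<^sub>R b + t *\<^sub>R a) - fa (z + t *\<^sub>R a)) (at t)"
        unfolding \<phi>_def
      proof (rule DERIV_diff; rule directional_derivative_shift; rule fa)
        show "z + s *\<^sub>R b + t *\<^sub>R a \<in> U" using sU[of t s] s t by (simp add: algebra_simps)
        show "z + t *\<^sub>R a \<in> U" using sU[of t 0] s t by simp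
      qed
    qed
    then obtain \<theta> where \<theta>: "\<theta> > 0" "\<theta> < s" "\<phi> s - \<phi> 0 = s * (fa (z + s *\<^sub>R b + \<theta> *\<^sub>R a) - fa (z + \<theta> *\<^sub>R a))"
      by auto
    have "\<exists>\<theta>'>0. \<theta>' < s \<and> fa (z + \<theta> *\<^sub>R a + s *\<^sub>R b) - fa (z + \<theta> *\<^sub>R a + 0 *\<^sub>R b) = (s - 0) * fab (z + \<theta> *\<^sub>R a + \<theta>' *\<^sub>R b)"
    proof (rule MVT2[OF s])
      fix t assume t: "0 \<le> t" "t \<le> s"
      show "((\<lambda>t. fa (z + \<theta> *\<^sub>R a + t *\<^sub>R b)) has_real_derivative fab (z + \<theta> *\<^sub>R a + t *\<^sub>R b)) (at t)"
        by (rule directional_derivative_shift, rule fab, rule sU) (use \<theta> t in auto)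
    qed
    then obtain \<theta>' where \<theta>': "\<theta>' > 0" "\<theta>' < s"
      "fa (z + \<theta> *\<^sub>R a + s *\<^sub>R b) - fa (z + \<theta> *\<^sub>R a) = s * fab (z + \<theta> *\<^sub>R a + \<theta>' *\<^sub>R b)" by auto
    have "f (z + s *\<^sub>R a + s *\<^sub>R b) - f (z + s *\<^sub>R a) - f (z + s *\<^sub>R b) + f z = \<phi> s - \<phi> 0"
      by (simp add: \<phi>_def algebra_simps)
    also have "\<dots> = s\<^sup>2 * fab (z + \<theta> *\<^sub>R a + \<theta>' *\<^sub>R b)"
      using \<theta>(3) \<theta>'(3) by (simp add: power2_eq_square algebra_simps)
    finally show ?thesis using \<theta> \<theta>' by (intro exI[of _ \<theta>] exI[of _ \<theta>']) auto
  qed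
  assume neq: "fab z \<noteq> fba z"
  \<comment> \<open>With r half of the gap, no number is at distance less than r from both
    \<open>fab z\<close> and \<open>fba z\<close>.\<close>
  define r where "r = \<bar>fab z - fba z\<bar> / 2"
  have r: "r > 0" using neq by (simp add: r_def)
  have "\<forall>\<^sub>F u in nhds z. dist (fab u) (fab z) < r" "\<forall>\<^sub>F u in nhds z. dist (fba u) (fba z) < r"
    using cont U r by (auto intro!: tendstoD simp: continuous_on_eq_continuous_at isCont_def tendsto_nhds_iff)
  moreover have "\<forall>\<^sub>F u in nhds z. u \<in> U" using U by (simp add: eventually_nhds_in_open)
  ultimately have "\<forall>\<^sub>F u in nhds z. u \<in> U \<and> dist (fab u) (fab z) < r \<and> dist (fba u) (fba z) < r"
    by eventually_elim simp
  then obtain \<delta> where \<delta>: "\<delta> > 0"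
    "\<And>u. dist u z < \<delta> \<Longrightarrow> u \<in> U \<and> dist (fab u) (fab z) < r \<and> dist (fba u) (fba z) < r"
    unfolding eventually_nhds_metric by blast
  define B where "B = norm a + norm b + 1"
  have B: "B > 0" by (simp add: B_def add_nonneg_pos)
  define s where "s = \<delta> / (2 * B)"
  have s: "s > 0" "s * B < \<delta>" using \<delta> B by (simp_all add: s_def)
  have near: "dist (z + \<theta> *\<^sub>R a + \<theta>' *\<^sub>R b) z < \<delta>" if "0 \<le> \<theta>" "\<theta> \<le> s" "0 \<le> \<theta>'" "\<theta>' \<le> s" for \<theta> \<theta>'
  proof -
    have "norm (\<theta> *\<^sub>R a + \<theta>' *\<^sub>R b) \<le> s * norm a + s * norm b"
      using that by (intro order_trans[OF norm_triangle_ineq] add_mono) (auto intro: mult_right_mono)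
    also have "\<dots> \<le> s * B" using s by (simp add: B_def algebra_simps)
    also have "\<dots> < \<delta>" by (rule s)
    finally show ?thesis by (simp add: dist_norm add.assoc)
  qed
  obtain \<theta> \<theta>' where 1: "0 \<le> \<theta>" "\<theta> \<le> s" "0 \<le> \<theta>'" "\<theta>' \<le> s"
    "f (z + s *\<^sub>R a + s *\<^sub>R b) - f (z + s *\<^sub>R a) - f (z + s *\<^sub>R b) + f z = s\<^sup>2 * fab (z + \<theta> *\<^sub>R a + \<theta>' *\<^sub>R b)"
    using second_difference[of s a b fa fab, OF s(1) _ fa fab] \<delta>(2)[OF near] by metis
  have near': "dist (z + \<theta>' *\<^sub>R b + \<theta> *\<^sub>R a) z < \<delta>" if "0 \<le> \<theta>" "\<theta> \<le> s" "0 \<le> \<theta>'" "\<theta>' \<le> s" for \<theta> \<theta>'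
    using near[OF that] by (simp add: add_ac)
  obtain \<eta> \<eta>' where 2: "0 \<le> \<eta>" "\<eta> \<le> s" "0 \<le> \<eta>'" "\<eta>' \<le> s"
    "f (z + s *\<^sub>R b + s *\<^sub>R a) - f (z + s *\<^sub>R b) - f (z + s *\<^sub>R a) + f z = s\<^sup>2 * fba (z + \<eta> *\<^sub>R b + \<eta>' *\<^sub>R a)"
    using second_difference[of s b a fb fba, OF s(1) _ fb fba] \<delta>(2)[OF near'] by metis
  have "s\<^sup>2 * fab (z + \<theta> *\<^sub>R a + \<theta>' *\<^sub>R b) = s\<^sup>2 * fba (z + \<eta> *\<^sub>R b + \<eta>' *\<^sub>R a)"
    unfolding 1(5)[symmetric] 2(5)[symmetric] by (simp add: algebra_simps)
  then have eq: "fab (z + \<theta> *\<^sub>R a + \<theta>' *\<^sub>R b) = fba (z + \<eta> *\<^sub>R b + \<eta>' *\<^sub>R a)" using s by simp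
  have "dist (fab (z + \<theta> *\<^sub>R a + \<theta>' *\<^sub>R b)) (fab z) < r" "dist (fba (z + \<eta> *\<^sub>R b + \<eta>' *\<^sub>R a)) (fba z) < r"
    using \<delta>(2)[OF near[OF 1(1-4)]] \<delta>(2)[OF near'[OF 2(3,4,1,2)]] by auto
  moreover have "\<bar>fab z - fba z\<bar> \<le> \<bar>x - fab z\<bar> + \<bar>x - fba z\<bar>" for x by arith
  note this[of "fba (z + \<eta> *\<^sub>R b + \<eta>' *\<^sub>R a)"]
  moreover have False if "p < d / 2" "q < d / 2" "d \<le> p + q" for p q d :: real using that by linarith
  ultimately show False unfolding eq r_def dist_real_def by blast
qed

text \<open>Only derivatives along one family of directions are permuted, because C^{q,q} offers
  derivatives in the first argument only after those in the second. A kernel gives one instance in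
  the second argument and, for each of its derivatives there, one instance in the first.\<close>

locale iterated_partials =
  fixes e :: "'c::finite \<Rightarrow> 'v::real_normed_vector" and f :: "'v \<Rightarrow> real" and U :: "'v set" and N :: nat
  assumes U: "open U"
    and cont: "\<And>us. length us \<le> N \<Longrightarrow> continuous_on U (iter_partial (map e us) f)"
    and deriv: "\<And>c us z. length us < N \<Longrightarrow> z \<in> U \<Longrightarrow>
      ((\<lambda>t. iter_partial (map e us) f (z + t *\<^sub>R e c)) has_real_derivative iter_partial (map e (c # us)) f z) (at 0)"
begin

lemma iter_partial_swap:
  assumes "length us + 2 \<le> N" "z \<in> U"
  shows "iter_partial (map e (a # b # us)) f z = iter_partial (map e (b # a # us)) f z"
proof (rule mixed_directional_derivatives_eq[OF U assms(2)])
  show "((\<lambda>t. iter_partial (map e us) f (u + t *\<^sub>R e b)) has_real_derivative iter_partial (map e (b # us)) f u) (at 0)"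
    "((\<lambda>t. iter_partial (map e us) f (u + t *\<^sub>R e a)) has_real_derivative iter_partial (map e (a # us)) f u) (at 0)"
    if "u \<in> U" for u using deriv that assms by auto
  show "((\<lambda>t. iter_partial (map e (b # us)) f (u + t *\<^sub>R e a)) has_real_derivative iter_partial (map e (a # b # us)) f u) (at 0)"
    if "u \<in> U" for u using assms that by (intro deriv) auto
  show "((\<lambda>t. iter_partial (map e (a # us)) f (u + t *\<^sub>R e b)) has_real_derivative iter_partial (map e (b # a # us)) f u) (at 0)"
    if "u \<in> U" for u using assms that by (intro deriv) auto
  show "continuous_on U (iter_partial (map e (a # b # us)) f)" "continuous_on U (iter_partial (map e (b # a # us)) f)"
    using assms by (auto intro!: cont simp del: list.map)
qed

lemma iter_partial_Cons_cong:
  assumes "\<And>z. z \<in> U \<Longrightarrow> iter_partial (map e us) f z = iter_partial (map e vs) f z" "z \<in> U"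
  shows "iter_partial (map e (c # us)) f z = iter_partial (map e (c # vs)) f z"
  using partial_deriv_cong[OF U assms(2,1)] by (simp add: iter_partial_Cons)

lemma iter_partial_move_to_front:
  assumes "c \<in> set us" "length us \<le> N" "z \<in> U"
  shows "iter_partial (map e us) f z = iter_partial (map e (c # remove1 c us)) f z"
  using assms
proof (induction us arbitrary: z)
  case (Cons a us)
  show ?case
  proof (cases "a = c")
    case False
    then have c: "c \<in> set us" using Cons.prems by auto
    have "iter_partial (map e (a # us)) f z = iter_partial (map e (a # c # remove1 c us)) f z"
      using Cons.prems c by (intro iter_partial_Cons_cong Cons.IH) auto
    also have "\<dots> = iter_partial (map e (c # a # remove1 c us)) f z"
    proof (rule iter_partial_swap)
      have "length us > 0" using c by auto
      then show "length (remove1 c us) + 2 \<le> N" using Cons.prems c by (auto simp: length_remove1)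
    qed (rule Cons.prems)
    finally show ?thesis using False by simp
  qed simp
qed simp

lemma iter_partial_perm:
  assumes "mset us = mset vs" "length us \<le> N" "z \<in> U"
  shows "iter_partial (map e us) f z = iter_partial (map e vs) f z"
  using assms
proof (induction us arbitrary: vs z)
  case (Cons c us)
  have c: "c \<in> set vs" using Cons.prems(1) by (metis list.set_intros(1) mset_eq_setD)
  have "length vs \<le> N" using Cons.prems(1,2) by (metis size_mset)
  then have "iter_partial (map e vs) f z = iter_partial (map e (c # remove1 c vs)) f z"
    by (intro iter_partial_move_to_front c Cons.prems)
  also have "\<dots> = iter_partial (map e (c # us)) f z"
  proof (rule iter_partial_Cons_cong[symmetric])
    fix z assume "z \<in> U"
    moreover have "mset us = mset (remove1 c vs)" using Cons.prems(1) by (metis add_mset_remove_trivial mset.simps(2) mset_remove1)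
    ultimately show "iter_partial (map e us) f z = iter_partial (map e (remove1 c vs)) f z"
      using Cons.prems(2) by (intro Cons.IH) auto
  qed (rule Cons.prems)
  finally show ?case by simp
qed simp

text \<open>The sum over all lists of length s, weighted by the coordinates of w, is the s-th
  derivative along the line in direction w, and one more derivative puts one coordinate in front.
  Lists are used instead of multi-indices here since no multinomial coefficients arise.\<close>

lemma line_derivative:
  fixes x :: "'c \<Rightarrow> real"
  defines "w \<equiv> \<Sum>c\<in>UNIV. x c *\<^sub>R e c"
  assumes s: "s < N" and z: "z + t *\<^sub>R w \<in> U"
  shows "((\<lambda>t. \<Sum>us | length us = s. prod_list (map x us) * iter_partial (map e us) f (z + t *\<^sub>R w)) has_real_derivative
      (\<Sum>us | length us = Suc s. prod_list (map x us) * iter_partial (map e us) f (z + t *\<^sub>R w))) (at t)"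
proof -
  have "((\<lambda>t. iter_partial (map e us) f (z + t *\<^sub>R w)) has_real_derivative
      (\<Sum>c\<in>UNIV. x c * iter_partial (map e (c # us)) f (z + t *\<^sub>R w))) (at t)" if "length us = s" for us
  proof (rule directional_derivative_shift)
    show "((\<lambda>\<tau>. iter_partial (map e us) f ((z + t *\<^sub>R w) + \<tau> *\<^sub>R w)) has_real_derivative
      (\<Sum>c\<in>UNIV. x c * iter_partial (map e (c # us)) f (z + t *\<^sub>R w))) (at 0)"
      unfolding w_def
      by (rule directional_derivative_sum[OF finite U]) (use deriv cont s that z in \<open>auto simp: w_def simp del: list.map\<close>)
  qed
  then have "((\<lambda>t. \<Sum>us | length us = s. prod_list (map x us) * iter_partial (map e us) f (z + t *\<^sub>R w)) has_real_derivative
      (\<Sum>us | length us = s. prod_list (map x us) * (\<Sum>c\<in>UNIV. x c * iter_partial (map e (c # us)) f (z + t *\<^sub>R w)))) (at t)"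
    by (intro DERIV_sum DERIV_cmult) auto
  also have "(\<Sum>us | length us = s. prod_list (map x us) * (\<Sum>c\<in>UNIV. x c * iter_partial (map e (c # us)) f (z + t *\<^sub>R w))) =
      (\<Sum>(us, c)\<in>{us. length us = s} \<times> UNIV. prod_list (map x (c # us)) * iter_partial (map e (c # us)) f (z + t *\<^sub>R w))"
    by (simp add: sum.cartesian_product[symmetric] sum_distrib_left mult_ac del: list.map(2)) (simp add: mult_ac)
  also have "\<dots> = (\<Sum>us | length us = Suc s. prod_list (map x us) * iter_partial (map e us) f (z + t *\<^sub>R w))"
    by (rule sum.reindex_bij_witness[of _ "\<lambda>us. (tl us, hd us)" "\<lambda>(us, c). c # us"])
      (auto simp: length_Suc_conv)
  finally show ?thesis .
qed

end

text \<open>The Taylor polynomial vanishes and only the Lagrange remainder is left. For n = 0 the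
  point t = h serves.\<close>

lemma taylor_zero:
  fixes diff :: "nat \<Rightarrow> real \<Rightarrow> real"
  assumes h: "h > 0"
    and deriv: "\<And>m t. m < n \<Longrightarrow> 0 \<le> t \<Longrightarrow> t \<le> h \<Longrightarrow> (diff m has_real_derivative diff (Suc m) t) (at t)"
    and zero: "\<And>m. m < n \<Longrightarrow> diff m 0 = 0"
  shows "\<exists>t. 0 \<le> t \<and> t \<le> h \<and> diff 0 h = diff n t / fact n * h ^ n"
proof (cases "n = 0")
  case True then show ?thesis using h by (intro exI[of _ h]) auto
next
  case False
  then have "\<exists>t>0. t < h \<and> diff 0 h = (\<Sum>m<n. diff m 0 / fact m * h ^ m) + diff n t / fact n * h ^ n"
    using deriv by (intro Maclaurin h) auto
  then show ?thesis using zero by (auto intro: less_imp_le)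
qed

section \<open>Lists of coordinates and multi-indices\<close>

definition mi_of_list :: "'d::finite list \<Rightarrow> 'd \<Rightarrow> nat" where
  "mi_of_list us = (\<lambda>i. count_list us i)"

lemma mi_degree_mi_of_list: "mi_degree (mi_of_list us) = length us"
proof (induction us)
  case (Cons c us)
  have "mi_degree (mi_of_list (c # us)) = (\<Sum>i\<in>UNIV. (if c = i then 1 else 0) + count_list us i)"
    unfolding mi_degree_def mi_of_list_def by (intro sum.cong) auto
  also have "\<dots> = length (c # us)"
    using Cons by (simp add: sum.distrib mi_degree_def mi_of_list_def)
  finally show ?case .
qed (simp add: mi_degree_def mi_of_list_def)

lemma monomial_mi_of_list: "monomial (mi_of_list us) x = prod_list (map (vec_nth x) us)"
proof (induction us)
  case (Cons c us)
  have "monomial (mi_of_list (c # us)) x = (\<Prod>i\<in>UNIV. (if c = i then vec_nth x i else 1) * vec_nth x i ^ mi_of_list us i)"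
    unfolding monomial_def mi_of_list_def by (intro prod.cong) auto
  also have "\<dots> = vec_nth x c * monomial (mi_of_list us) x"
    by (simp add: prod.distrib monomial_def)
  finally show ?case using Cons by simp
qed (simp add: monomial_def mi_of_list_def)

text \<open>As there are finitely many coordinates, every exponent function is a multiset. This
  gives access to the count of permutations of a multiset.\<close>

definition mi_mset :: "('d::finite \<Rightarrow> nat) \<Rightarrow> 'd multiset" where
  "mi_mset \<alpha> = Abs_multiset \<alpha>"

lemma count_mi_mset: "count (mi_mset \<alpha>) = \<alpha>"
  by (simp add: mi_mset_def)

lemma mi_of_list_eq_iff: "mi_of_list us = \<alpha> \<longleftrightarrow> mset us = mi_mset \<alpha>"
  by (auto simp: mi_of_list_def multiset_eq_iff count_mi_mset count_mset fun_eq_iff)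

lemma mi_of_list_mi_list: "mi_of_list (mi_list \<alpha>) = \<alpha>"
proof -
  obtain us where "mset us = mi_mset \<alpha>" using ex_mset by blast
  then have "mi_of_list us = \<alpha>" by (simp add: mi_of_list_eq_iff)
  then have "\<forall>i. count_list us i = \<alpha> i" by (auto simp: mi_of_list_def)
  then have "\<forall>i. count_list (mi_list \<alpha>) i = \<alpha> i"
    unfolding mi_list_def by (rule someI[where P = "\<lambda>us. \<forall>i. count_list us i = \<alpha> i"])
  then show ?thesis by (simp add: mi_of_list_def fun_eq_iff)
qed

lemma length_mi_list: "length (mi_list \<alpha>) = mi_degree \<alpha>"
  using mi_degree_mi_of_list[of "mi_list \<alpha>"] by (simp add: mi_of_list_mi_list)

text \<open>The multinomial coefficient: the lists with exponents \<alpha> are the permutations of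
  one multiset. Coordinates outside its support contribute the factor 0! = 1.\<close>

lemma card_lists_with_mi:
  "real (card {us. mi_of_list us = \<alpha>}) = fact (mi_degree \<alpha>) / mi_fact \<alpha>"
proof -
  have "{us. mi_of_list us = \<alpha>} = permutations_of_multiset (mi_mset \<alpha>)"
    by (simp add: mi_of_list_eq_iff permutations_of_multiset_def)
  moreover have "real (card (permutations_of_multiset (mi_mset \<alpha>)) * (\<Prod>x\<in>set_mset (mi_mset \<alpha>). fact (\<alpha> x))) = fact (mi_degree \<alpha>)"
  proof -
    have "size (mi_mset \<alpha>) = mi_degree \<alpha>"
      proof -
      have "mset (mi_list \<alpha>) = mi_mset \<alpha>" using mi_of_list_mi_list[of \<alpha>] by (simp only: mi_of_list_eq_iff)
      from arg_cong[OF this, of size] show ?thesis by (simp add: length_mi_list)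
    qed
    then show ?thesis
      using card_permutations_of_multiset_aux[of "mi_mset \<alpha>"] by (simp add: count_mi_mset)
  qed
  moreover have "(\<Prod>x\<in>set_mset (mi_mset \<alpha>). fact (\<alpha> x)) = (\<Prod>x\<in>UNIV. fact (\<alpha> x) :: real)"
  proof (rule prod.mono_neutral_left)
    show "\<forall>i\<in>UNIV - set_mset (mi_mset \<alpha>). fact (\<alpha> i) = (1 :: real)"
      by (auto simp: count_mi_mset not_in_iff)
  qed auto
  ultimately show ?thesis
    by (simp add: mi_fact_def field_simps)
qed

lemma finite_mi_degree: "finite {\<alpha> :: 'd::finite \<Rightarrow> nat. mi_degree \<alpha> = s}"
proof -
  have "{\<alpha> :: 'd \<Rightarrow> nat. mi_degree \<alpha> = s} \<subseteq> mi_of_list ` {us. length us = s}"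
  proof
    fix \<alpha> :: "'d \<Rightarrow> nat" assume "\<alpha> \<in> {\<alpha>. mi_degree \<alpha> = s}"
    then show "\<alpha> \<in> mi_of_list ` {us. length us = s}"
      using mi_of_list_mi_list[of \<alpha>] length_mi_list[of \<alpha>] by (intro image_eqI[of _ _ "mi_list \<alpha>"]) auto
  qed
  moreover have "finite {us :: 'd list. length us = s}" using finite_lists_length_eq[of "UNIV :: 'd set" s] by simp
  ultimately show ?thesis by (rule finite_subset[OF _ finite_imageI])
qed

text \<open>Lists are grouped by their exponents. The class sizes convert a Taylor sum over lists
  into one over multi-indices and are the source of the factorials in the Wronskian.\<close>

lemma sum_lists_by_mi:
  fixes g :: "('d::finite \<Rightarrow> nat) \<Rightarrow> real"
  shows "(\<Sum>us | length us = s. g (mi_of_list us)) = (\<Sum>\<alpha> | mi_degree \<alpha> = s. fact s / mi_fact \<alpha> * g \<alpha>)"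
proof -
  have fin: "finite {us :: 'd list. length us = s}" using finite_lists_length_eq[of "UNIV :: 'd set" s] by simp
  have "(\<Sum>us | length us = s. g (mi_of_list us)) =
      (\<Sum>\<alpha> | mi_degree \<alpha> = s. \<Sum>us\<in>{us. us \<in> {us. length us = s} \<and> mi_of_list us = \<alpha>}. g (mi_of_list us))"
    by (rule sum.group[symmetric]) (auto simp: fin finite_mi_degree mi_degree_mi_of_list)
  also have "\<dots> = (\<Sum>\<alpha> | mi_degree \<alpha> = s. fact s / mi_fact \<alpha> * g \<alpha>)"
  proof (rule sum.cong[OF refl])
    fix \<alpha> :: "'d \<Rightarrow> nat" assume "\<alpha> \<in> {\<alpha>. mi_degree \<alpha> = s}"
    then have eq: "{us. us \<in> {us. length us = s} \<and> mi_of_list us = \<alpha>} = {us. mi_of_list us = \<alpha>}"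
      by (auto simp: mi_degree_mi_of_list)
    have "(\<Sum>us | mi_of_list us = \<alpha>. g (mi_of_list us)) = (\<Sum>us | mi_of_list us = \<alpha>. g \<alpha>)"
      by (intro sum.cong) auto
    then show "(\<Sum>us\<in>{us. us \<in> {us. length us = s} \<and> mi_of_list us = \<alpha>}. g (mi_of_list us)) = fact s / mi_fact \<alpha> * g \<alpha>"
      unfolding eq using card_lists_with_mi[of \<alpha>] \<open>\<alpha> \<in> {\<alpha>. mi_degree \<alpha> = s}\<close> by simp
  qed
  finally show ?thesis .
qed

section \<open>Contracted Taylor expansion of a kernel in both arguments\<close>

abbreviation kernel_partial :: "(real ^ 'd::finite \<Rightarrow> real ^ 'd \<Rightarrow> real) \<Rightarrow> 'd list \<Rightarrow> 'd list \<Rightarrow> (real ^ 'd) \<times> (real ^ 'd) \<Rightarrow> real" where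
  "kernel_partial k us vs \<equiv> iter_partial (xy_directions us vs) (case_prod k)"

lemma C_classE:
  assumes "C_class N k"
  obtains U where "open U" "(0, 0) \<in> U"
    "iterated_partials (\<lambda>c. (0, axis c 1)) (case_prod k) U N"
    "\<And>vs. length vs \<le> N \<Longrightarrow> iterated_partials (\<lambda>c. (axis c 1, 0)) (iter_partial (map (\<lambda>c. (0, axis c 1)) vs) (case_prod k)) U N"
proof -
  let ?ex = "\<lambda>c. (axis c 1, 0) :: (real ^ 'a) \<times> (real ^ 'a)"
  let ?ey = "\<lambda>c. (0, axis c 1) :: (real ^ 'a) \<times> (real ^ 'a)"
  obtain U where U: "open U" "(0, 0) \<in> U"
    and all: "\<forall>us vs. length us \<le> N \<and> length vs \<le> N \<longrightarrow>
           (\<forall>b bs. xy_directions us vs = b # bs \<longrightarrow>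
              (\<forall>z\<in>U. (\<lambda>t. iter_partial bs (case_prod k) (z + t *\<^sub>R b)) differentiable (at 0))) \<and>
           continuous_on U (iter_partial (xy_directions us vs) (case_prod k))"
    using assms unfolding C_class_def by (elim exE conjE) (rule that)
  have diff: "(\<lambda>t. iter_partial bs (case_prod k) (z + t *\<^sub>R b)) differentiable (at 0)"
    if "length us \<le> N" "length vs \<le> N" "xy_directions us vs = b # bs" "z \<in> U" for us vs b bs z
    using all[rule_format, of us vs, THEN conjunct1, rule_format, of b bs z] that by blast
  have cont: "continuous_on U (kernel_partial k us vs)" if "length us \<le> N" "length vs \<le> N" for us vs
    using all[rule_format, of us vs, THEN conjunct2] that by blast
  have D: "((\<lambda>t. iter_partial bs (case_prod k) (z + t *\<^sub>R b)) has_real_derivative iter_partial (b # bs) (case_prod k) z) (at 0)"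
    if "length us \<le> N" "length vs \<le> N" "xy_directions us vs = b # bs" "z \<in> U" for us vs b bs z
    unfolding iter_partial_Cons partial_deriv_def
    by (rule diff[OF that, folded DERIV_deriv_iff_real_differentiable])
  have "iterated_partials ?ey (case_prod k) U N"
  proof
    show "continuous_on U (iter_partial (map ?ey vs) (case_prod k))" if "length vs \<le> N" for vs
      using cont[of "[]" vs] that by (simp add: xy_directions_def)
    show "((\<lambda>t. iter_partial (map ?ey vs) (case_prod k) (z + t *\<^sub>R ?ey c)) has_real_derivative
        iter_partial (map ?ey (c # vs)) (case_prod k) z) (at 0)" if "length vs < N" "z \<in> U" for c vs z
      using D[of "[]" "c # vs" "?ey c" "map ?ey vs" z] that by (simp add: xy_directions_def)
  qed (rule U)
  moreover have "iterated_partials ?ex (iter_partial (map ?ey vs) (case_prod k)) U N" if vs: "length vs \<le> N" for vs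
  proof
    show "continuous_on U (iter_partial (map ?ex us) (iter_partial (map ?ey vs) (case_prod k)))" if "length us \<le> N" for us
      using cont[of us vs] that vs by (simp add: xy_directions_def iter_partial_append)
    show "((\<lambda>t. iter_partial (map ?ex us) (iter_partial (map ?ey vs) (case_prod k)) (z + t *\<^sub>R ?ex c)) has_real_derivative
        iter_partial (map ?ex (c # us)) (iter_partial (map ?ey vs) (case_prod k)) z) (at 0)"
      if "length us < N" "z \<in> U" for c us z
      using D[of "c # us" vs "?ex c" "map ?ex us @ map ?ey vs" z] that vs
      by (simp add: xy_directions_def iter_partial_append flip: append_Cons)
  qed (rule U)
  ultimately show ?thesis using U that by blast
qed

lemma kernel_partial_eq: "kernel_partial k us vs = iter_partial (map (\<lambda>c. (axis c 1, 0)) us) (iter_partial (map (\<lambda>c. (0, axis c 1)) vs) (case_prod k))"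
  by (simp add: xy_directions_def iter_partial_append)

text \<open>Reordering \<open>vs\<close> must be an identity on a whole neighbourhood, as
  derivatives in the first argument are still to follow. Reordering \<open>us\<close> comes last and
  is needed only at the origin.\<close>

lemma kernel_partial_at_0:
  assumes "C_class N k" "length us \<le> N" "length vs \<le> N"
  shows "kernel_partial k us vs (0, 0) = mixed_partial (mi_of_list us) (mi_of_list vs) k 0 0"
proof -
  let ?ex = "\<lambda>c. (axis c 1, 0) :: (real ^ 'a) \<times> (real ^ 'a)"
  let ?ey = "\<lambda>c. (0, axis c 1) :: (real ^ 'a) \<times> (real ^ 'a)"
  obtain U where U: "open U" "(0, 0) \<in> U" and y: "iterated_partials ?ey (case_prod k) U N"
    and x: "\<And>vs. length vs \<le> N \<Longrightarrow> iterated_partials ?ex (iter_partial (map ?ey vs) (case_prod k)) U N"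
    using C_classE[OF assms(1)] by blast
  have eq: "mset us = mset (mi_list (mi_of_list us))" for us :: "'a list"
    using mi_of_list_eq_iff[of us "mi_of_list us"] mi_of_list_eq_iff[of "mi_list (mi_of_list us)" "mi_of_list us"]
    by (simp add: mi_of_list_mi_list)
  have "kernel_partial k us vs (0, 0) = kernel_partial k us (mi_list (mi_of_list vs)) (0, 0)"
    unfolding kernel_partial_eq
    by (rule iter_partial_cong[OF U(1) _ U(2)]) (rule iterated_partials.iter_partial_perm[OF y eq assms(3)])
  also have "\<dots> = kernel_partial k (mi_list (mi_of_list us)) (mi_list (mi_of_list vs)) (0, 0)"
    unfolding kernel_partial_eq
    using assms by (intro iterated_partials.iter_partial_perm[OF x eq _ U(2)])
      (auto simp: length_mi_list mi_degree_mi_of_list)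
  finally show ?thesis by (simp add: mixed_partial_def)
qed

lemma sum_axis: "(\<Sum>c\<in>UNIV. vec_nth x c *\<^sub>R (0, axis c 1)) = (0, x)"
  "(\<Sum>c\<in>UNIV. vec_nth x c *\<^sub>R (axis c 1, 0)) = (x, 0)"
  for x :: "real ^ 'd::finite"
proof -
  have "(\<Sum>c\<in>UNIV. vec_nth x c *\<^sub>R axis c 1) = x"
    by (simp add: Finite_Cartesian_Product.vec_eq_iff axis_def if_distrib[of "\<lambda>y. _ * y"] cong: if_cong)
  then show "(\<Sum>c\<in>UNIV. vec_nth x c *\<^sub>R (0, axis c 1)) = (0, x)"
    "(\<Sum>c\<in>UNIV. vec_nth x c *\<^sub>R (axis c 1, 0)) = (x, 0)"
    by (simp_all add: prod_eq_iff fst_sum snd_sum)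
qed

text \<open>
  Contracting \<open>k(\<epsilon> x\<^sub>a, \<delta> x\<^sub>b)\<close> with coefficient vectors that annihilate the monomials of degree
  less than \<open>i\<close> in the first and less than \<open>j\<close> in the second argument makes the Taylor expansion start
  at \<open>\<epsilon>\<^sup>i \<delta>\<^sup>j\<close>. The remainder is expanded first in \<open>\<delta>\<close> and then, at the intermediate point, in \<open>\<epsilon>\<close>,
  which is the order in which the partial derivatives are taken.
\<close>

lemma kernel_form_limit:
  fixes x :: "nat \<Rightarrow> real ^ 'd::finite" and \<alpha> \<beta> :: "nat \<Rightarrow> real"
  assumes k: "C_class N k" and ij: "i \<le> N" "j \<le> N"
    and \<alpha>: "\<And>us. length us < i \<Longrightarrow> (\<Sum>a<n. \<alpha> a * prod_list (map (vec_nth (x a)) us)) = 0"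
    and \<beta>: "\<And>vs. length vs < j \<Longrightarrow> (\<Sum>b<n. \<beta> b * prod_list (map (vec_nth (x b)) vs)) = 0"
  shows "((\<lambda>\<epsilon>. (\<Sum>a<n. \<Sum>b<n. \<alpha> a * \<beta> b * k (\<epsilon> *\<^sub>R x a) (\<epsilon> *\<^sub>R x b)) / \<epsilon> ^ (i + j)) \<longlongrightarrow>
     1 / (fact i * fact j) * (\<Sum>us | length us = i. \<Sum>vs | length vs = j.
        (\<Sum>a<n. \<alpha> a * prod_list (map (vec_nth (x a)) us)) * (\<Sum>b<n. \<beta> b * prod_list (map (vec_nth (x b)) vs)) *
        kernel_partial k us vs (0, 0))) (at_right 0)"
proof -
  let ?ex = "\<lambda>c. (axis c 1, 0) :: (real ^ 'd) \<times> (real ^ 'd)"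
  let ?ey = "\<lambda>c. (0, axis c 1) :: (real ^ 'd) \<times> (real ^ 'd)"
  let ?m = "\<lambda>us a. prod_list (map (vec_nth (x a)) us)"
  obtain U where U: "open U" "(0, 0) \<in> U" and y: "iterated_partials ?ey (case_prod k) U N"
    and x: "\<And>vs. length vs \<le> N \<Longrightarrow> iterated_partials ?ex (iter_partial (map ?ey vs) (case_prod k)) U N"
    using C_classE[OF k] by blast
  obtain \<delta> where \<delta>: "\<delta> > 0" "ball (0, 0) \<delta> \<subseteq> U" using U by (meson open_contains_ball)
  \<comment> \<open>Scaled nodes with \<epsilon> < \<delta> / B stay in the ball of radius \<delta>:
    two of them enter, hence the factor 2, and the summand 1 covers nodes that are all zero.\<close>
  define B where "B = 2 * (\<Sum>a<n. norm (x a)) + 1"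
  have xB: "norm (x a) \<le> (\<Sum>a<n. norm (x a))" if "a < n" for a
    using that by (intro member_le_sum) auto
  have B: "B > 0" by (simp add: B_def add_nonneg_pos sum_nonneg)
  have inU: "(s *\<^sub>R x a, t *\<^sub>R x b) \<in> U" if "a < n" "b < n" "0 \<le> s" "s \<le> \<epsilon>" "0 \<le> t" "t \<le> \<epsilon>" "\<epsilon> < \<delta> / B" for a b s t \<epsilon>
  proof -
    have "norm (s *\<^sub>R x a, t *\<^sub>R x b) \<le> norm (s *\<^sub>R x a) + norm (t *\<^sub>R x b)" by (rule norm_Pair_le)
    also have "\<dots> \<le> \<epsilon> * norm (x a) + \<epsilon> * norm (x b)"
      using that by (intro add_mono) (auto intro: mult_right_mono)
    also have "\<dots> \<le> \<epsilon> * (\<Sum>a<n. norm (x a)) + \<epsilon> * (\<Sum>a<n. norm (x a))"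
      using that by (intro add_mono mult_left_mono xB) auto
    also have "\<dots> \<le> \<epsilon> * B" using that by (simp add: B_def algebra_simps)
    also have "\<dots> < \<delta>" using that B by (simp add: field_simps)
    finally show ?thesis using \<delta>(2) by (auto simp: dist_norm zero_prod_def[symmetric])
  qed
  define F where "F s t = (\<Sum>a<n. \<Sum>b<n. \<alpha> a * \<beta> b * (\<Sum>vs | length vs = j. ?m vs b * (\<Sum>us | length us = i. ?m us a *
      kernel_partial k us vs (s *\<^sub>R x a, t *\<^sub>R x b))))" for s t
  have taylor: "\<exists>s t. 0 \<le> s \<and> s \<le> \<epsilon> \<and> 0 \<le> t \<and> t \<le> \<epsilon> \<and>
     (\<Sum>a<n. \<Sum>b<n. \<alpha> a * \<beta> b * k (\<epsilon> *\<^sub>R x a) (\<epsilon> *\<^sub>R x b)) = F s t / (fact i * fact j) * \<epsilon> ^ (i + j)"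
    if \<epsilon>: "\<epsilon> > 0" "\<epsilon> < \<delta> / B" for \<epsilon>
  proof -
    \<comment> \<open>The m-th derivative in t of the contracted form, with the first arguments
      frozen at \<epsilon> x_a. At t = 0 the second arguments coincide, so for m < j it reduces to
      moments of \<beta>, which vanish.\<close>
    define G where "G m t = (\<Sum>a<n. \<Sum>b<n. \<alpha> a * \<beta> b * (\<Sum>vs | length vs = m. ?m vs b *
        iter_partial (map ?ey vs) (case_prod k) (\<epsilon> *\<^sub>R x a, t *\<^sub>R x b)))" for m t
    have "\<exists>t. 0 \<le> t \<and> t \<le> \<epsilon> \<and> G 0 \<epsilon> = G j t / fact j * \<epsilon> ^ j"
    proof (rule taylor_zero[OF \<epsilon>(1)])
      fix m t assume m: "m < j" and t: "0 \<le> t" "t \<le> \<epsilon>"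
      show "(G m has_real_derivative G (Suc m) t) (at t)"
        unfolding G_def
      proof (intro DERIV_sum DERIV_cmult)
        fix a b assume ab: "a \<in> {..<n}" "b \<in> {..<n}"
        have "(\<epsilon> *\<^sub>R x a, 0) + t *\<^sub>R (\<Sum>c\<in>UNIV. vec_nth (x b) c *\<^sub>R ?ey c) \<in> U"
          unfolding sum_axis using inU[of a b \<epsilon> \<epsilon> t] ab t \<epsilon> by simp
        from iterated_partials.line_derivative[OF y _ this, of m] m ij
        show "((\<lambda>t. \<Sum>vs | length vs = m. ?m vs b * iter_partial (map ?ey vs) (case_prod k) (\<epsilon> *\<^sub>R x a, t *\<^sub>R x b))
           has_real_derivative (\<Sum>vs | length vs = Suc m. ?m vs b * iter_partial (map ?ey vs) (case_prod k) (\<epsilon> *\<^sub>R x a, t *\<^sub>R x b))) (at t)"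
          unfolding sum_axis by simp
      qed
    next
      fix m assume m: "m < j"
      have "G m 0 = (\<Sum>a<n. \<Sum>b<n. \<Sum>vs | length vs = m. (\<alpha> a * iter_partial (map ?ey vs) (case_prod k) (\<epsilon> *\<^sub>R x a, 0)) * (\<beta> b * ?m vs b))"
        unfolding G_def by (simp add: sum_distrib_left mult_ac)
      also have "\<dots> = (\<Sum>a<n. \<Sum>vs | length vs = m. \<Sum>b<n. (\<alpha> a * iter_partial (map ?ey vs) (case_prod k) (\<epsilon> *\<^sub>R x a, 0)) * (\<beta> b * ?m vs b))"
        by (rule sum.cong[OF refl], rule sum.swap)
      also have "\<dots> = 0"
        unfolding sum_distrib_left[symmetric] using \<beta> m by (simp add: sum.neutral)
      finally show "G m 0 = 0" .
    qed
    then obtain t where t: "0 \<le> t" "t \<le> \<epsilon>" "G 0 \<epsilon> = G j t / fact j * \<epsilon> ^ j" by blast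
    \<comment> \<open>The j-th derivative at the intermediate point t just found, now regarded as a
      function of the scale s of the first arguments: \<open>E 0 \<epsilon>\<close> equals
      \<open>G j t\<close>. At s = 0 the first arguments coincide and the moments of \<alpha>
      appear.\<close>
    define E where "E m s = (\<Sum>a<n. \<Sum>b<n. \<alpha> a * \<beta> b * (\<Sum>vs | length vs = j. ?m vs b * (\<Sum>us | length us = m. ?m us a *
      kernel_partial k us vs (s *\<^sub>R x a, t *\<^sub>R x b))))" for m s
    have "\<exists>s. 0 \<le> s \<and> s \<le> \<epsilon> \<and> E 0 \<epsilon> = E i s / fact i * \<epsilon> ^ i"
    proof (rule taylor_zero[OF \<epsilon>(1)])
      fix m s assume m: "m < i" and s: "0 \<le> s" "s \<le> \<epsilon>"
      show "(E m has_real_derivative E (Suc m) s) (at s)"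
        unfolding E_def kernel_partial_eq
      proof (intro DERIV_sum DERIV_cmult)
        fix a b vs assume ab: "a \<in> {..<n}" "b \<in> {..<n}" and vs: "vs \<in> {vs :: 'd list. length vs = j}"
        have "(0, t *\<^sub>R x b) + s *\<^sub>R (\<Sum>c\<in>UNIV. vec_nth (x a) c *\<^sub>R ?ex c) \<in> U"
          unfolding sum_axis using inU[of a b s \<epsilon> t] ab s t \<epsilon> by simp
        from iterated_partials.line_derivative[OF x _ this, of vs m] m ij vs
        show "((\<lambda>s. \<Sum>us | length us = m. ?m us a * iter_partial (map ?ex us) (iter_partial (map ?ey vs) (case_prod k)) (s *\<^sub>R x a, t *\<^sub>R x b))
           has_real_derivative (\<Sum>us | length us = Suc m. ?m us a * iter_partial (map ?ex us) (iter_partial (map ?ey vs) (case_prod k)) (s *\<^sub>R x a, t *\<^sub>R x b))) (at s)"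
          unfolding sum_axis by simp
      qed
    next
      fix m assume m: "m < i"
      have "E m 0 = (\<Sum>b<n. \<Sum>a<n. \<Sum>vs | length vs = j. \<Sum>us | length us = m.
          (\<beta> b * ?m vs b * kernel_partial k us vs (0, t *\<^sub>R x b)) * (\<alpha> a * ?m us a))"
        unfolding E_def by (subst sum.swap) (simp add: sum_distrib_left mult_ac)
      also have "\<dots> = (\<Sum>b<n. \<Sum>vs | length vs = j. \<Sum>us | length us = m. \<Sum>a<n.
          (\<beta> b * ?m vs b * kernel_partial k us vs (0, t *\<^sub>R x b)) * (\<alpha> a * ?m us a))"
        by (rule sum.cong[OF refl], rule trans[OF sum.swap], rule sum.cong[OF refl], rule sum.swap)
      also have "\<dots> = 0"
        unfolding sum_distrib_left[symmetric] using \<alpha> m by (simp add: sum.neutral)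
      finally show "E m 0 = 0" .
    qed
    then obtain s where s: "0 \<le> s" "s \<le> \<epsilon>" "E 0 \<epsilon> = E i s / fact i * \<epsilon> ^ i" by blast
    have "(\<Sum>a<n. \<Sum>b<n. \<alpha> a * \<beta> b * k (\<epsilon> *\<^sub>R x a) (\<epsilon> *\<^sub>R x b)) = G 0 \<epsilon>"
      by (simp add: G_def iter_partial_def)
    also have "\<dots> = G j t / fact j * \<epsilon> ^ j" by (rule t)
    also have "G j t = E 0 \<epsilon>" by (simp add: G_def E_def xy_directions_def)
    also have "E 0 \<epsilon> = F s t / fact i * \<epsilon> ^ i" unfolding s(3) by (simp add: E_def F_def)
    finally show ?thesis using s t by (intro exI[of _ s] exI[of _ t]) (simp add: power_add field_simps)
  qed
  have "\<exists>p. \<epsilon> > 0 \<longrightarrow> \<epsilon> < \<delta> / B \<longrightarrow> 0 \<le> fst p \<and> fst p \<le> \<epsilon> \<and> 0 \<le> snd p \<and> snd p \<le> \<epsilon> \<and>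
     (\<Sum>a<n. \<Sum>b<n. \<alpha> a * \<beta> b * k (\<epsilon> *\<^sub>R x a) (\<epsilon> *\<^sub>R x b)) = F (fst p) (snd p) / (fact i * fact j) * \<epsilon> ^ (i + j)" for \<epsilon>
  proof (cases "\<epsilon> > 0 \<and> \<epsilon> < \<delta> / B")
    case True
    then obtain s t where "0 \<le> s \<and> s \<le> \<epsilon> \<and> 0 \<le> t \<and> t \<le> \<epsilon> \<and>
     (\<Sum>a<n. \<Sum>b<n. \<alpha> a * \<beta> b * k (\<epsilon> *\<^sub>R x a) (\<epsilon> *\<^sub>R x b)) = F s t / (fact i * fact j) * \<epsilon> ^ (i + j)"
      using taylor by blast
    then show ?thesis by (intro exI[of _ "(s, t)"]) simp
  qed auto
  \<comment> \<open>The intermediate points depend on \<epsilon>. Both lie between 0 and \<epsilon>,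
    so they tend to 0, and continuity of the derivatives at the origin gives the limit.\<close>
  then obtain p where p: "\<forall>\<epsilon>. \<epsilon> > 0 \<longrightarrow> \<epsilon> < \<delta> / B \<longrightarrow> 0 \<le> fst (p \<epsilon>) \<and> fst (p \<epsilon>) \<le> \<epsilon> \<and> 0 \<le> snd (p \<epsilon>) \<and> snd (p \<epsilon>) \<le> \<epsilon> \<and>
     (\<Sum>a<n. \<Sum>b<n. \<alpha> a * \<beta> b * k (\<epsilon> *\<^sub>R x a) (\<epsilon> *\<^sub>R x b)) = F (fst (p \<epsilon>)) (snd (p \<epsilon>)) / (fact i * fact j) * \<epsilon> ^ (i + j)"
    using choice[of "\<lambda>\<epsilon> p. \<epsilon> > 0 \<longrightarrow> \<epsilon> < \<delta> / B \<longrightarrow> 0 \<le> fst p \<and> fst p \<le> \<epsilon> \<and> 0 \<le> snd p \<and> snd p \<le> \<epsilon> \<and>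
     (\<Sum>a<n. \<Sum>b<n. \<alpha> a * \<beta> b * k (\<epsilon> *\<^sub>R x a) (\<epsilon> *\<^sub>R x b)) = F (fst p) (snd p) / (fact i * fact j) * \<epsilon> ^ (i + j)"]
    by blast
  define S T where "S \<epsilon> = fst (p \<epsilon>)" and "T \<epsilon> = snd (p \<epsilon>)" for \<epsilon>
  have ST: "0 \<le> S \<epsilon> \<and> S \<epsilon> \<le> \<epsilon> \<and> 0 \<le> T \<epsilon> \<and> T \<epsilon> \<le> \<epsilon> \<and>
     (\<Sum>a<n. \<Sum>b<n. \<alpha> a * \<beta> b * k (\<epsilon> *\<^sub>R x a) (\<epsilon> *\<^sub>R x b)) = F (S \<epsilon>) (T \<epsilon>) / (fact i * fact j) * \<epsilon> ^ (i + j)"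
    if "\<epsilon> > 0" "\<epsilon> < \<delta> / B" for \<epsilon>
    using p that by (simp add: S_def T_def)
  have ev: "\<forall>\<^sub>F \<epsilon> in at_right 0. 0 < \<epsilon> \<and> \<epsilon> < \<delta> / B"
    using \<delta>(1) B by (intro eventually_conj eventually_at_right_less eventually_at_rightI[of 0 "\<delta> / B"]) auto
  have S0: "(S \<longlongrightarrow> 0) (at_right 0)"
    by (rule tendsto_sandwich[of "\<lambda>_. 0" _ _ "\<lambda>\<epsilon>. \<epsilon>"])
      (use ev ST in \<open>auto elim!: eventually_mono\<close>)
  have T0: "(T \<longlongrightarrow> 0) (at_right 0)"
    by (rule tendsto_sandwich[of "\<lambda>_. 0" _ _ "\<lambda>\<epsilon>. \<epsilon>"])
      (use ev ST in \<open>auto elim!: eventually_mono\<close>)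
  have cont: "isCont (kernel_partial k us vs) (0, 0)" if "length us = i" "length vs = j" for us vs
    using iterated_partials.cont[OF x, of vs us] that ij U
    by (simp add: kernel_partial_eq continuous_on_eq_continuous_at)
  have "((\<lambda>\<epsilon>. F (S \<epsilon>) (T \<epsilon>)) \<longlongrightarrow> F 0 0) (at_right 0)"
    unfolding F_def
  proof (intro tendsto_sum tendsto_mult tendsto_const)
    fix a b us vs assume "a \<in> {..<n}" "b \<in> {..<n}" "vs \<in> {vs :: 'd list. length vs = j}" "us \<in> {us :: 'd list. length us = i}"
    then have c: "isCont (kernel_partial k us vs) (0 *\<^sub>R x a, 0 *\<^sub>R x b)" using cont[of us vs] by simp
    show "((\<lambda>\<epsilon>. kernel_partial k us vs (S \<epsilon> *\<^sub>R x a, T \<epsilon> *\<^sub>R x b)) \<longlongrightarrow> kernel_partial k us vs (0 *\<^sub>R x a, 0 *\<^sub>R x b)) (at_right 0)"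
      by (rule isCont_tendsto_compose[OF c]) (intro tendsto_intros S0 T0)
  qed
  then have "((\<lambda>\<epsilon>. 1 / (fact i * fact j) * F (S \<epsilon>) (T \<epsilon>)) \<longlongrightarrow> 1 / (fact i * fact j) * F 0 0) (at_right 0)"
    by (intro tendsto_mult_left)
  moreover have "\<forall>\<^sub>F \<epsilon> in at_right 0. 1 / (fact i * fact j) * F (S \<epsilon>) (T \<epsilon>) =
      (\<Sum>a<n. \<Sum>b<n. \<alpha> a * \<beta> b * k (\<epsilon> *\<^sub>R x a) (\<epsilon> *\<^sub>R x b)) / \<epsilon> ^ (i + j)"
    using ev
  proof eventually_elim
    case (elim \<epsilon>)
    then show ?case using ST[of \<epsilon>] by simp
  qed
  ultimately have "((\<lambda>\<epsilon>. (\<Sum>a<n. \<Sum>b<n. \<alpha> a * \<beta> b * k (\<epsilon> *\<^sub>R x a) (\<epsilon> *\<^sub>R x b)) / \<epsilon> ^ (i + j)) \<longlongrightarrow>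
      1 / (fact i * fact j) * F 0 0) (at_right 0)"
    by (rule Lim_transform_eventually)
  moreover have "F 0 0 = (\<Sum>us | length us = i. \<Sum>vs | length vs = j.
        (\<Sum>a<n. \<alpha> a * ?m us a) * (\<Sum>b<n. \<beta> b * ?m vs b) * kernel_partial k us vs (0, 0))"
  proof -
    have "F 0 0 = (\<Sum>a<n. \<Sum>b<n. \<Sum>vs | length vs = j. \<Sum>us | length us = i. \<alpha> a * ?m us a * (\<beta> b * ?m vs b) * kernel_partial k us vs (0, 0))"
      unfolding F_def by (simp add: sum_distrib_left mult_ac)
    also have "\<dots> = (\<Sum>a<n. \<Sum>vs | length vs = j. \<Sum>b<n. \<Sum>us | length us = i. \<alpha> a * ?m us a * (\<beta> b * ?m vs b) * kernel_partial k us vs (0, 0))"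
      by (rule sum.cong[OF refl], rule sum.swap)
    also have "\<dots> = (\<Sum>vs | length vs = j. \<Sum>a<n. \<Sum>us | length us = i. \<Sum>b<n. \<alpha> a * ?m us a * (\<beta> b * ?m vs b) * kernel_partial k us vs (0, 0))"
      by (rule trans[OF sum.swap], rule sum.cong[OF refl], rule sum.cong[OF refl], rule sum.swap)
    also have "\<dots> = (\<Sum>vs | length vs = j. \<Sum>us | length us = i. \<Sum>a<n. \<Sum>b<n. \<alpha> a * ?m us a * (\<beta> b * ?m vs b) * kernel_partial k us vs (0, 0))"
      by (rule sum.cong[OF refl], rule sum.swap)
    also have "\<dots> = (\<Sum>vs | length vs = j. \<Sum>us | length us = i. (\<Sum>a<n. \<alpha> a * ?m us a) * (\<Sum>b<n. \<beta> b * ?m vs b) * kernel_partial k us vs (0, 0))"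
      by (rule sum.cong[OF refl], rule sum.cong[OF refl], subst sum_product) (simp only: sum_distrib_right)
    finally show ?thesis by (rule trans[OF _ sum.swap])
  qed
  ultimately show ?thesis by simp
qed

text \<open>The multinomial class sizes cancel i! and j! and leave 1 / (\<mu>! \<nu>!), which is
  exactly the normalisation of the Wronskian entries.\<close>

lemma kernel_form_limit_mi:
  fixes x :: "nat \<Rightarrow> real ^ 'd::finite" and \<alpha> \<beta> :: "nat \<Rightarrow> real"
  assumes k: "C_class N k" and ij: "i \<le> N" "j \<le> N"
    and \<alpha>: "\<And>\<mu>. mi_degree \<mu> < i \<Longrightarrow> (\<Sum>a<n. \<alpha> a * monomial \<mu> (x a)) = 0"
    and \<beta>: "\<And>\<nu>. mi_degree \<nu> < j \<Longrightarrow> (\<Sum>b<n. \<beta> b * monomial \<nu> (x b)) = 0"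
  shows "((\<lambda>\<epsilon>. (\<Sum>a<n. \<Sum>b<n. \<alpha> a * \<beta> b * k (\<epsilon> *\<^sub>R x a) (\<epsilon> *\<^sub>R x b)) / \<epsilon> ^ (i + j)) \<longlongrightarrow>
     (\<Sum>\<mu> | mi_degree \<mu> = i. \<Sum>\<nu> | mi_degree \<nu> = j. (\<Sum>a<n. \<alpha> a * monomial \<mu> (x a)) *
        (mixed_partial \<mu> \<nu> k 0 0 / (mi_fact \<mu> * mi_fact \<nu>)) * (\<Sum>b<n. \<beta> b * monomial \<nu> (x b)))) (at_right 0)"
proof -
  define A where "A \<mu> = (\<Sum>a<n. \<alpha> a * monomial \<mu> (x a))" for \<mu>
  define B where "B \<mu> = (\<Sum>b<n. \<beta> b * monomial \<mu> (x b))" for \<mu>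
  have A: "(\<Sum>a<n. \<alpha> a * prod_list (map (vec_nth (x a)) us)) = A (mi_of_list us)" for us
    by (simp add: A_def monomial_mi_of_list)
  have B: "(\<Sum>b<n. \<beta> b * prod_list (map (vec_nth (x b)) us)) = B (mi_of_list us)" for us
    by (simp add: B_def monomial_mi_of_list)
  have "1 / (fact i * fact j) * (\<Sum>us | length us = i. \<Sum>vs | length vs = j.
      A (mi_of_list us) * B (mi_of_list vs) * kernel_partial k us vs (0, 0)) =
    1 / (fact i * fact j) * (\<Sum>us | length us = i. \<Sum>vs | length vs = j.
      A (mi_of_list us) * B (mi_of_list vs) * mixed_partial (mi_of_list us) (mi_of_list vs) k 0 0)"
    using ij by (simp add: kernel_partial_at_0[OF k])
  also have "(\<Sum>us | length us = i. \<Sum>vs | length vs = j.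
      A (mi_of_list us) * B (mi_of_list vs) * mixed_partial (mi_of_list us) (mi_of_list vs) k 0 0) =
      (\<Sum>us | length us = i. \<Sum>\<nu> | mi_degree \<nu> = j.
        fact j / mi_fact \<nu> * (A (mi_of_list us) * B \<nu> * mixed_partial (mi_of_list us) \<nu> k 0 0))"
    by (rule sum.cong[OF refl], rule sum_lists_by_mi)
  also have "\<dots> = (\<Sum>\<mu> | mi_degree \<mu> = i. fact i / mi_fact \<mu> * (\<Sum>\<nu> | mi_degree \<nu> = j.
      fact j / mi_fact \<nu> * (A \<mu> * B \<nu> * mixed_partial \<mu> \<nu> k 0 0)))"
    by (rule sum_lists_by_mi)
  also have "1 / (fact i * fact j) * \<dots> = (\<Sum>\<mu> | mi_degree \<mu> = i. \<Sum>\<nu> | mi_degree \<nu> = j.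
      A \<mu> * (mixed_partial \<mu> \<nu> k 0 0 / (mi_fact \<mu> * mi_fact \<nu>)) * B \<nu>)"
    unfolding sum_distrib_left by (intro sum.cong refl) (simp add: field_simps)
  finally have eq: "1 / (fact i * fact j) * (\<Sum>us | length us = i. \<Sum>vs | length vs = j.
      A (mi_of_list us) * B (mi_of_list vs) * kernel_partial k us vs (0, 0)) = \<dots>" .
  have "(\<Sum>a<n. \<alpha> a * prod_list (map (vec_nth (x a)) us)) = 0" if "length us < i" for us
    using \<alpha>[of "mi_of_list us"] that by (simp add: A A_def mi_degree_mi_of_list)
  moreover have "(\<Sum>b<n. \<beta> b * prod_list (map (vec_nth (x b)) us)) = 0" if "length us < j" for us
    using \<beta>[of "mi_of_list us"] that by (simp add: B B_def mi_degree_mi_of_list)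
  ultimately show ?thesis
    using kernel_form_limit[OF k ij, where n = n and \<alpha> = \<alpha> and \<beta> = \<beta> and x = x] eq unfolding A B A_def[symmetric] B_def[symmetric] by simp
qed

subsection \<open>Smoothness of radial kernels\<close>

text \<open>Formulated with directional derivatives, since \<open>C_class\<close> is. The derivative
  may be any function with the right values on U, so nothing depends on its values outside
  U.\<close>

primrec smooth_on :: "nat \<Rightarrow> 'v::real_normed_vector set \<Rightarrow> ('v \<Rightarrow> real) \<Rightarrow> bool" where
  "smooth_on 0 U f \<longleftrightarrow> continuous_on U f"
| "smooth_on (Suc N) U f \<longleftrightarrow> continuous_on U f \<and>
     (\<forall>b. \<exists>g. (\<forall>z\<in>U. ((\<lambda>t. f (z + t *\<^sub>R b)) has_real_derivative g z) (at 0)) \<and> smooth_on N U g)"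

lemma smooth_on_imp_continuous_on: "smooth_on N U f \<Longrightarrow> continuous_on U f"
  by (cases N) auto

lemma smooth_on_SucE:
  assumes "smooth_on (Suc N) U f"
  obtains g where "\<And>z. z \<in> U \<Longrightarrow> ((\<lambda>t. f (z + t *\<^sub>R b)) has_real_derivative g z) (at 0)" "smooth_on N U g"
proof -
  have "\<exists>g. (\<forall>z\<in>U. ((\<lambda>t. f (z + t *\<^sub>R b)) has_real_derivative g z) (at 0)) \<and> smooth_on N U g"
    using assms by simp
  then show ?thesis using that by blast
qed

lemma smooth_on_Suc_imp: "smooth_on (Suc N) U f \<Longrightarrow> smooth_on N U f"
proof (induction N arbitrary: f)
  case (Suc N)
  have "\<exists>g. (\<forall>z\<in>U. ((\<lambda>t. f (z + t *\<^sub>R b)) has_real_derivative g z) (at 0)) \<and> smooth_on N U g" for b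
  proof -
    obtain g where "\<And>z. z \<in> U \<Longrightarrow> ((\<lambda>t. f (z + t *\<^sub>R b)) has_real_derivative g z) (at 0)" "smooth_on (Suc N) U g"
      using smooth_on_SucE[OF Suc.prems, of b] by blast
    then show ?thesis using Suc.IH[of g] by blast
  qed
  then show ?case using smooth_on_imp_continuous_on[OF Suc.prems] by simp
qed simp

lemma smooth_on_const: "smooth_on N U (\<lambda>_. c)"
  by (induction N arbitrary: c) (auto intro!: exI[of _ "\<lambda>_. 0"])

lemma smooth_on_add: "smooth_on N U f \<Longrightarrow> smooth_on N U g \<Longrightarrow> smooth_on N U (\<lambda>z. f z + g z)"
proof (induction N arbitrary: f g)
  case (Suc N)
  have "\<exists>h. (\<forall>z\<in>U. ((\<lambda>t. f (z + t *\<^sub>R b) + g (z + t *\<^sub>R b)) has_real_derivative h z) (at 0)) \<and> smooth_on N U h" for b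
  proof -
    obtain f' where f': "\<And>z. z \<in> U \<Longrightarrow> ((\<lambda>t. f (z + t *\<^sub>R b)) has_real_derivative f' z) (at 0)" "smooth_on N U f'"
      using smooth_on_SucE[OF Suc.prems(1), of b] by blast
    obtain g' where g': "\<And>z. z \<in> U \<Longrightarrow> ((\<lambda>t. g (z + t *\<^sub>R b)) has_real_derivative g' z) (at 0)" "smooth_on N U g'"
      using smooth_on_SucE[OF Suc.prems(2), of b] by blast
    show ?thesis
      using Suc.IH[OF f'(2) g'(2)] f'(1) g'(1) by (intro exI[of _ "\<lambda>z. f' z + g' z"]) (auto intro: DERIV_add)
  qed
  then show ?case
    using smooth_on_imp_continuous_on[OF Suc.prems(1)] smooth_on_imp_continuous_on[OF Suc.prems(2)]
    by (auto intro: continuous_on_add)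
qed (auto intro: continuous_on_add)

lemma smooth_on_mult: "smooth_on N U f \<Longrightarrow> smooth_on N U g \<Longrightarrow> smooth_on N U (\<lambda>z. f z * g z)"
proof (induction N arbitrary: f g)
  case (Suc N)
  have "\<exists>h. (\<forall>z\<in>U. ((\<lambda>t. f (z + t *\<^sub>R b) * g (z + t *\<^sub>R b)) has_real_derivative h z) (at 0)) \<and> smooth_on N U h" for b
  proof -
    obtain f' where f': "\<And>z. z \<in> U \<Longrightarrow> ((\<lambda>t. f (z + t *\<^sub>R b)) has_real_derivative f' z) (at 0)" "smooth_on N U f'"
      using smooth_on_SucE[OF Suc.prems(1), of b] by blast
    obtain g' where g': "\<And>z. z \<in> U \<Longrightarrow> ((\<lambda>t. g (z + t *\<^sub>R b)) has_real_derivative g' z) (at 0)" "smooth_on N U g'"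
      using smooth_on_SucE[OF Suc.prems(2), of b] by blast
    have "((\<lambda>t. f (z + t *\<^sub>R b) * g (z + t *\<^sub>R b)) has_real_derivative f' z * g z + g' z * f z) (at 0)" if "z \<in> U" for z
      using DERIV_mult[OF f'(1)[OF that] g'(1)[OF that]] by simp
    moreover have "smooth_on N U (\<lambda>z. f' z * g z + g' z * f z)"
      by (rule smooth_on_add[OF Suc.IH[OF f'(2) smooth_on_Suc_imp[OF Suc.prems(2)]] Suc.IH[OF g'(2) smooth_on_Suc_imp[OF Suc.prems(1)]]])
    ultimately show ?thesis by (intro exI[of _ "\<lambda>z. f' z * g z + g' z * f z"]) auto
  qed
  then show ?case
    using smooth_on_imp_continuous_on[OF Suc.prems(1)] smooth_on_imp_continuous_on[OF Suc.prems(2)]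
    by (auto intro: continuous_on_mult)
qed (auto intro: continuous_on_mult)

lemma smooth_on_sum: "finite I \<Longrightarrow> (\<And>i. i \<in> I \<Longrightarrow> smooth_on N U (f i)) \<Longrightarrow> smooth_on N U (\<lambda>z. \<Sum>i\<in>I. f i z)"
  by (induction I rule: finite_induct) (auto intro: smooth_on_const smooth_on_add)

lemma smooth_on_power: "smooth_on N U f \<Longrightarrow> smooth_on N U (\<lambda>z. f z ^ m)"
  by (induction m) (auto intro: smooth_on_const smooth_on_mult)

lemma smooth_on_inner_left:
  fixes b :: "'v::real_inner"
  shows "smooth_on N U (\<lambda>z. inner z b)"
proof (cases N)
  case (Suc M)
  have "((\<lambda>t. inner (z + t *\<^sub>R c) b) has_real_derivative inner c b) (at 0)" for z c
    by (auto intro!: derivative_eq_intros simp: inner_add_left)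
  then show ?thesis using Suc
    by (auto intro!: exI[of _ "\<lambda>_. inner _ b"] smooth_on_const continuous_intros)
qed (auto intro!: continuous_intros)

lemma smooth_on_inner_self: "smooth_on N U (\<lambda>z :: 'v::real_inner. inner z z)"
proof (cases N)
  case (Suc M)
  have "((\<lambda>t. inner (z + t *\<^sub>R c) (z + t *\<^sub>R c)) has_real_derivative 2 * inner z c) (at 0)" for z c :: 'v
  proof -
    have "(\<lambda>t. inner (z + t *\<^sub>R c) (z + t *\<^sub>R c)) = (\<lambda>t. inner z z + t * (2 * inner z c) + t * t * inner c c)"
      by (auto simp: inner_add_left inner_add_right inner_commute algebra_simps)
    then show ?thesis by (auto intro!: derivative_eq_intros)
  qed
  then show ?thesis using Suc
    by (auto intro!: exI[of _ "\<lambda>z. 2 * inner z _"] smooth_on_mult smooth_on_const smooth_on_inner_left continuous_intros)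
qed (auto intro!: continuous_intros)

lemma smooth_on_iter_partial:
  assumes "smooth_on N U g" "\<And>z. z \<in> U \<Longrightarrow> f z = g z" "open U" "length bs \<le> N"
  shows "\<exists>h. smooth_on (N - length bs) U h \<and> (\<forall>z\<in>U. iter_partial bs f z = h z)"
  using assms(4)
proof (induction bs)
  case Nil then show ?case using assms by (auto simp: iter_partial_def)
next
  case (Cons b bs)
  then obtain h where h: "smooth_on (N - length bs) U h" "\<And>z. z \<in> U \<Longrightarrow> iter_partial bs f z = h z" by auto
  have "N - length bs = Suc (N - length (b # bs))" using Cons.prems by simp
  then obtain h' where h': "\<And>z. z \<in> U \<Longrightarrow> ((\<lambda>t. h (z + t *\<^sub>R b)) has_real_derivative h' z) (at 0)"
    "smooth_on (N - length (b # bs)) U h'"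
    using smooth_on_SucE[of "N - length (b # bs)" U h b] h(1) by metis
  have "iter_partial (b # bs) f z = h' z" if "z \<in> U" for z
  proof -
    have "iter_partial (b # bs) f z = partial_deriv b h z"
      unfolding iter_partial_Cons by (rule partial_deriv_cong[OF assms(3) that h(2)])
    also have "\<dots> = h' z" unfolding partial_deriv_def by (rule DERIV_imp_deriv[OF h'(1)[OF that]])
    finally show ?thesis .
  qed
  then show ?case using h'(2) by blast
qed

text \<open>The closure of the functions |z|^s g(|z|) under the operations that differentiation
  produces. The index s records an order of vanishing at the origin. It is an integer because
  differentiation passes through |z|^(s - 2), and the value 0 at the origin is imposed for every
  s.\<close>

inductive radial_flat :: "real \<Rightarrow> int \<Rightarrow> ('v::real_inner \<Rightarrow> real) \<Rightarrow> bool" for r where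
  base: "ereal r < fps_conv_radius g \<Longrightarrow>
    radial_flat r s (\<lambda>z. if z = 0 then 0 else norm z powi s * eval_fps g (norm z))"
| inner: "radial_flat r s f \<Longrightarrow> radial_flat r (s + 1) (\<lambda>z. inner z b * f z)"
| cmult: "radial_flat r s f \<Longrightarrow> radial_flat r s (\<lambda>z. c * f z)"
| add: "radial_flat r s f \<Longrightarrow> radial_flat r s g \<Longrightarrow> radial_flat r s (\<lambda>z. f z + g z)"

lemma radial_flat_0: "radial_flat r s f \<Longrightarrow> f 0 = 0"
  by (induction rule: radial_flat.induct) auto

lemma norm_line_derivative:
  fixes z b :: "'v::real_inner"
  assumes "z \<noteq> 0"
  shows "((\<lambda>t. norm (z + t *\<^sub>R b)) has_real_derivative inner z b / norm z) (at 0)"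
proof -
  define q where "q = inner z z"
  have q: "q > 0" "norm z = sqrt q" using assms by (simp_all add: q_def norm_eq_sqrt_inner)
  have eq: "(\<lambda>t. norm (z + t *\<^sub>R b)) = (\<lambda>t. sqrt (q + t * (2 * inner z b) + t * t * inner b b))"
    by (auto simp: q_def norm_eq_sqrt_inner inner_add_left inner_add_right inner_commute algebra_simps)
  show ?thesis unfolding eq q(2) using q(1)
    by (auto intro!: derivative_eq_intros simp: field_simps)
qed

lemma line_eventually_nonzero:
  fixes z b :: "'v::real_normed_vector"
  assumes "z \<noteq> 0"
  shows "\<forall>\<^sub>F t in nhds 0. z + t *\<^sub>R b \<noteq> 0"
proof -
  have "((\<lambda>t. z + t *\<^sub>R b) \<longlongrightarrow> z + 0 *\<^sub>R b) (nhds 0)" by (intro tendsto_intros filterlim_ident)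
  then show ?thesis using assms by (auto intro: tendsto_imp_eventually_ne)
qed

lemma radial_flat_derivative:
  assumes "radial_flat r s f"
  shows "\<exists>f'. radial_flat r (s - 1) f' \<and>
    (\<forall>z. z \<noteq> 0 \<longrightarrow> norm z < r \<longrightarrow> ((\<lambda>t. f (z + t *\<^sub>R b)) has_real_derivative f' z) (at 0))"
  using assms
proof (induction rule: radial_flat.induct)
  case (base g s)
  \<comment> \<open>The derivative of |z|^s g(|z|) in direction b is <z, b> |z|^(s - 2) h(|z|) with
    h(t) = s g(t) + t g'(t). The exponent falls by 2, and the inner product restores 1.\<close>
  define h where "h = fps_const (of_int s) * g + fps_X * fps_deriv g"
  have "fps_conv_radius g \<le> fps_conv_radius h"
  proof -
    have "fps_conv_radius g \<le> fps_conv_radius (fps_const (of_int s) * g)"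
      by (rule order_trans[OF _ fps_conv_radius_mult]) simp
    moreover have "fps_conv_radius g \<le> fps_conv_radius (fps_X * fps_deriv g)"
      by (rule order_trans[OF _ fps_conv_radius_mult]) (simp add: fps_conv_radius_deriv)
    ultimately show ?thesis unfolding h_def
      by (intro order_trans[OF _ fps_conv_radius_add]) simp
  qed
  then have h: "ereal r < fps_conv_radius h" using base by (rule less_le_trans[rotated])
  define f' where "f' z = inner z b * (if z = 0 then 0 else norm z powi (s - 2) * eval_fps h (norm z))" for z
  have "radial_flat r (s - 2 + 1) f'" unfolding f'_def by (intro radial_flat.intros h)
  moreover have "((\<lambda>t. if z + t *\<^sub>R b = 0 then 0 else norm (z + t *\<^sub>R b) powi s * eval_fps g (norm (z + t *\<^sub>R b)))
      has_real_derivative f' z) (at 0)" if z: "z \<noteq> 0" "norm z < r" for z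
  proof -
    have "ereal (norm z) \<le> ereal r" using z by simp
    then have rad: "ereal (norm (norm (z + 0 *\<^sub>R b))) < fps_conv_radius g"
      using order_le_less_trans[OF _ base] by simp
    have chain: "((\<lambda>t. eval_fps g (norm (z + t *\<^sub>R b))) has_real_derivative
        eval_fps (fps_deriv g) (norm (z + 0 *\<^sub>R b)) * (inner z b / norm z)) (at 0)"
      by (rule DERIV_chain2[where f = "eval_fps g" and g = "\<lambda>t. norm (z + t *\<^sub>R b)" and x = 0])
        (rule has_field_derivative_eval_fps[OF rad], rule norm_line_derivative[OF z(1)])
    have "((\<lambda>t. norm (z + t *\<^sub>R b) powi s * eval_fps g (norm (z + t *\<^sub>R b))) has_real_derivative
       (of_int s * norm z powi (s - 1) * (inner z b / norm z)) * eval_fps g (norm z) +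
       norm z powi s * (eval_fps (fps_deriv g) (norm z) * (inner z b / norm z))) (at 0)"
      using z chain by (auto intro!: derivative_eq_intros norm_line_derivative)
    moreover have "(of_int s * norm z powi (s - 1) * (inner z b / norm z)) * eval_fps g (norm z) +
       norm z powi s * (eval_fps (fps_deriv g) (norm z) * (inner z b / norm z)) = f' z"
    proof -
      have "eval_fps h (norm z) = of_int s * eval_fps g (norm z) + norm z * eval_fps (fps_deriv g) (norm z)"
        using rad by (simp add: h_def eval_fps_add eval_fps_mult fps_conv_radius_deriv less_le_trans[OF _ fps_conv_radius_mult] less_le_trans[OF _ fps_conv_radius_deriv])
      moreover have "norm z powi s = norm z powi (s - 2) * (norm z * norm z)" "norm z powi (s - 1) = norm z powi (s - 2) * norm z"
        using z power_int_add[of "norm z" "s - 2" 2] power_int_add[of "norm z" "s - 2" 1]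
        by (simp_all add: power2_eq_square)
      ultimately show ?thesis using z by (simp add: f'_def field_simps)
    qed
    ultimately have D: "((\<lambda>t. norm (z + t *\<^sub>R b) powi s * eval_fps g (norm (z + t *\<^sub>R b))) has_real_derivative f' z) (at 0)"
      by simp
    have "\<forall>\<^sub>F t in nhds 0. (if z + t *\<^sub>R b = 0 then 0 else norm (z + t *\<^sub>R b) powi s * eval_fps g (norm (z + t *\<^sub>R b))) =
       norm (z + t *\<^sub>R b) powi s * eval_fps g (norm (z + t *\<^sub>R b))"
      using line_eventually_nonzero[OF z(1), of b] by eventually_elim simp
    then show ?thesis using D by (subst DERIV_cong_ev[OF refl _ refl])
  qed
  ultimately show ?case by auto
next
  case (inner s f c)
  then obtain f' where f': "radial_flat r (s - 1) f'"
    "\<And>z. z \<noteq> 0 \<Longrightarrow> norm z < r \<Longrightarrow> ((\<lambda>t. f (z + t *\<^sub>R b)) has_real_derivative f' z) (at 0)" by auto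
  have "radial_flat r s (\<lambda>z. inner b c * f z + inner z c * f' z)"
    using radial_flat.inner[OF f'(1), of c] inner.hyps by (intro radial_flat.add radial_flat.cmult) auto
  moreover have "((\<lambda>t. inner (z + t *\<^sub>R b) c * f (z + t *\<^sub>R b)) has_real_derivative inner b c * f z + inner z c * f' z) (at 0)"
    if "z \<noteq> 0" "norm z < r" for z
    using f'(2)[OF that] by (auto intro!: derivative_eq_intros simp: inner_add_left)
  ultimately show ?case by auto
next
  case (cmult s f c)
  then obtain f' where f': "radial_flat r (s - 1) f'"
    "\<And>z. z \<noteq> 0 \<Longrightarrow> norm z < r \<Longrightarrow> ((\<lambda>t. f (z + t *\<^sub>R b)) has_real_derivative f' z) (at 0)" by auto
  then show ?case by (intro exI[of _ "\<lambda>z. c * f' z"]) (auto intro: radial_flat.cmult DERIV_cmult)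
next
  case (add s f g)
  then obtain f' g' where f': "radial_flat r (s - 1) f'"
    "\<And>z. z \<noteq> 0 \<Longrightarrow> norm z < r \<Longrightarrow> ((\<lambda>t. f (z + t *\<^sub>R b)) has_real_derivative f' z) (at 0)"
    and g': "radial_flat r (s - 1) g'"
    "\<And>z. z \<noteq> 0 \<Longrightarrow> norm z < r \<Longrightarrow> ((\<lambda>t. g (z + t *\<^sub>R b)) has_real_derivative g' z) (at 0)" by auto
  then show ?case by (intro exI[of _ "\<lambda>z. f' z + g' z"]) (auto intro: radial_flat.add DERIV_add)
qed

text \<open>On the ball g is bounded by compactness, and by the Cauchy-Schwarz inequality each inner
  product contributes one power of |z|.\<close>

lemma radial_flat_bound:
  fixes f :: "'v::real_inner \<Rightarrow> real"
  assumes "radial_flat r s f"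
  shows "\<exists>C\<ge>0. \<forall>z. z \<noteq> 0 \<longrightarrow> norm z < r \<longrightarrow> \<bar>f z\<bar> \<le> C * norm z powi s"
  using assms
proof (induction rule: radial_flat.induct)
  case (base g s)
  have "continuous_on (cball 0 r) (eval_fps g)"
  proof (rule continuous_on_subset[OF continuous_on_eval_fps], rule subsetI)
    fix t :: real assume "t \<in> cball 0 r"
    then have "ereal \<bar>t\<bar> \<le> ereal r" by simp
    also note base
    finally show "t \<in> eball 0 (fps_conv_radius g)" by (simp add: eball_def)
  qed
  then have "bounded (eval_fps g ` cball 0 r)" by (intro compact_imp_bounded compact_continuous_image compact_cball)
  then obtain C where "\<forall>t\<in>cball 0 r. norm (eval_fps g t) \<le> C" by (auto simp: bounded_iff)
  then have C: "\<bar>eval_fps g t\<bar> \<le> \<bar>C\<bar>" if "\<bar>t\<bar> \<le> r" for t using that by force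
  show ?case
  proof (intro exI[of _ "\<bar>C\<bar>"] conjI allI impI)
    fix z :: 'v assume "z \<noteq> 0" "norm z < r"
    then show "\<bar>if z = 0 then 0 else norm z powi s * eval_fps g (norm z)\<bar> \<le> \<bar>C\<bar> * norm z powi s"
      using mult_right_mono[OF C[of "norm z"], of "norm z powi s"] by (simp add: abs_mult mult.commute)
  qed simp
next
  case (inner s f b)
  then obtain C where C: "C \<ge> 0" "\<And>z. z \<noteq> 0 \<Longrightarrow> norm z < r \<Longrightarrow> \<bar>f z\<bar> \<le> C * norm z powi s" by auto
  show ?case
  proof (intro exI[of _ "norm b * C"] conjI allI impI)
    fix z :: 'v assume z: "z \<noteq> 0" "norm z < r"
    have "\<bar>inner z b * f z\<bar> \<le> (norm z * norm b) * (C * norm z powi s)"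
      unfolding abs_mult using z C(2)[OF z] by (intro mult_mono Cauchy_Schwarz_ineq2) auto
    also have "\<dots> = norm b * C * norm z powi (s + 1)" using z by (simp add: power_int_add mult_ac)
    finally show "\<bar>inner z b * f z\<bar> \<le> norm b * C * norm z powi (s + 1)" .
  qed (use C in simp)
next
  case (cmult s f c)
  then obtain C where C: "C \<ge> 0" "\<And>z. z \<noteq> 0 \<Longrightarrow> norm z < r \<Longrightarrow> \<bar>f z\<bar> \<le> C * norm z powi s" by auto
  then show ?case
    by (intro exI[of _ "\<bar>c\<bar> * C"]) (auto simp: abs_mult mult.assoc intro: mult_left_mono)
next
  case (add s f g)
  then obtain C D where C: "C \<ge> 0" "\<And>z. z \<noteq> 0 \<Longrightarrow> norm z < r \<Longrightarrow> \<bar>f z\<bar> \<le> C * norm z powi s"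
    and D: "D \<ge> 0" "\<And>z. z \<noteq> 0 \<Longrightarrow> norm z < r \<Longrightarrow> \<bar>g z\<bar> \<le> D * norm z powi s" by auto
  show ?case
  proof (intro exI[of _ "C + D"] conjI allI impI)
    fix z :: 'v assume z: "z \<noteq> 0" "norm z < r"
    show "\<bar>f z + g z\<bar> \<le> (C + D) * norm z powi s"
      using C(2)[OF z] D(2)[OF z] by (simp add: distrib_right)
  qed (use C D in simp)
qed

lemma radial_flat_isCont:
  assumes "radial_flat r s f"
  shows "z \<noteq> 0 \<Longrightarrow> norm z < r \<Longrightarrow> isCont f z"
  using assms
proof (induction rule: radial_flat.induct)
  case (base g s)
  have "ereal (norm z) \<le> ereal r" using base.prems by simp
  then have "ereal (norm (norm z)) < fps_conv_radius g"
    using order_le_less_trans[OF _ base.hyps] by simp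
  then have "isCont (\<lambda>z. norm z powi s * eval_fps g (norm z)) z"
    using base.prems by (intro continuous_intros isCont_o2[OF _ DERIV_isCont[OF has_field_derivative_eval_fps]]) auto
  moreover have "\<forall>\<^sub>F w in nhds z. (if w = 0 then 0 else norm w powi s * eval_fps g (norm w)) = norm w powi s * eval_fps g (norm w)"
    using t1_space_nhds[OF base.prems(1)] by eventually_elim simp
  ultimately show ?case by (subst isCont_cong)
qed (auto intro!: continuous_intros)

lemma radial_flat_tendsto_0:
  assumes f: "radial_flat r s f" and s: "s \<ge> 1" and r: "r > 0"
  shows "isCont f 0"
proof -
  obtain C where C: "C \<ge> 0" "\<And>z. z \<noteq> 0 \<Longrightarrow> norm z < r \<Longrightarrow> \<bar>f z\<bar> \<le> C * norm z powi s"
    using radial_flat_bound[OF f] by blast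
  have "(f \<longlongrightarrow> 0) (at 0)"
  proof (rule Lim_null_comparison)
    have "\<forall>\<^sub>F z in at 0. z \<noteq> 0 \<and> norm z < min r 1"
      using r by (auto simp: eventually_at intro!: exI[of _ "min r 1"])
    then show "\<forall>\<^sub>F z in at 0. norm (f z) \<le> C * norm z"
    proof eventually_elim
      case (elim z)
      have "norm z powi s \<le> norm z powi 1" using elim s by (intro power_int_decreasing) auto
      then have "C * norm z powi s \<le> C * norm z" using C(1) by (intro mult_left_mono) auto
      then show ?case using C(2)[of z] elim by simp
    qed
    show "((\<lambda>z. C * norm z) \<longlongrightarrow> 0) (at 0)" by (intro tendsto_mult_right_zero tendsto_norm_zero tendsto_ident_at)
  qed
  then show ?thesis by (simp add: isCont_def radial_flat_0[OF f])
qed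

text \<open>Vanishing to order at least 2 makes the difference quotient at the origin O(|t|),
  whatever the direction.\<close>

lemma radial_flat_derivative_0:
  fixes f :: "'v::real_inner \<Rightarrow> real"
  assumes f: "radial_flat r s f" and s: "s \<ge> 2" and r: "r > 0"
  shows "((\<lambda>t. f (0 + t *\<^sub>R b)) has_real_derivative 0) (at 0)"
proof -
  obtain C where C: "C \<ge> 0" "\<And>z. z \<noteq> 0 \<Longrightarrow> norm z < r \<Longrightarrow> \<bar>f z\<bar> \<le> C * norm z powi s"
    using radial_flat_bound[OF f] by blast
  show ?thesis
    unfolding DERIV_def
  proof (rule Lim_null_comparison)
    have "\<forall>\<^sub>F t in at 0. t \<noteq> 0 \<and> \<bar>t\<bar> < min r 1 / (norm b + 1)"
      using r by (auto simp: eventually_at add_nonneg_pos intro!: exI[of _ "min r 1 / (norm b + 1)"])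
    then show "\<forall>\<^sub>F t in at 0. norm ((f (0 + (0 + t) *\<^sub>R b) - f (0 + 0 *\<^sub>R b)) / t) \<le> C * (norm b)\<^sup>2 * \<bar>t\<bar>"
    proof eventually_elim
      case (elim t)
      show ?case
      proof (cases "b = 0")
        case False
        have "\<bar>t\<bar> * (norm b + 1) < min r 1" using elim by (simp add: pos_less_divide_eq add_nonneg_pos)
        moreover have "norm (t *\<^sub>R b) \<le> \<bar>t\<bar> * (norm b + 1)" by (simp add: algebra_simps)
        ultimately have tb: "norm (t *\<^sub>R b) < min r 1" by linarith
        have "norm (t *\<^sub>R b) powi s \<le> norm (t *\<^sub>R b) powi 2"
          using tb s elim False by (intro power_int_decreasing) auto
        then have "C * norm (t *\<^sub>R b) powi s \<le> C * (norm b)\<^sup>2 * \<bar>t\<bar> * \<bar>t\<bar>"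
          using C(1) mult_left_mono[of "norm (t *\<^sub>R b) powi s" "(norm (t *\<^sub>R b))\<^sup>2" C]
          by (simp add: power2_eq_square mult_ac)
        then have "\<bar>f (t *\<^sub>R b)\<bar> \<le> C * (norm b)\<^sup>2 * \<bar>t\<bar> * \<bar>t\<bar>"
          using C(2)[of "t *\<^sub>R b"] tb elim False by simp
        then show ?thesis using elim by (simp add: radial_flat_0[OF f] divide_le_eq)
      qed (simp add: radial_flat_0[OF f])
    qed
    show "((\<lambda>t. C * (norm b)\<^sup>2 * \<bar>t\<bar>) \<longlongrightarrow> 0) (at 0)"
      by (intro tendsto_mult_right_zero tendsto_rabs_zero tendsto_ident_at)
  qed
qed

text \<open>Each derivative lowers s by 1, so after N of them an order of at least 1 is left, which
  is what continuity at the origin takes. As long as a derivative remains to be taken, s \<ge> 2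
  makes it 0 at the origin, in agreement with the value that members of the class have
  there.\<close>

lemma radial_flat_smooth_on:
  assumes "radial_flat r s f" "s \<ge> int N + 1" "r > 0"
  shows "smooth_on N (ball 0 r) f"
  using assms(1,2)
proof (induction N arbitrary: s f)
  case 0
  have "isCont f z" if "z \<in> ball 0 r" for z
    using radial_flat_isCont[OF 0(1), of z] radial_flat_tendsto_0[OF 0(1) _ assms(3)] 0(2) that by (cases "z = 0") auto
  then show ?case by (simp add: continuous_at_imp_continuous_on)
next
  case (Suc N)
  have "isCont f z" if "z \<in> ball 0 r" for z
    using radial_flat_isCont[OF Suc.prems(1), of z] radial_flat_tendsto_0[OF Suc.prems(1) _ assms(3)] Suc.prems(2) that
    by (cases "z = 0") auto
  moreover have "\<exists>g. (\<forall>z\<in>ball 0 r. ((\<lambda>t. f (z + t *\<^sub>R b)) has_real_derivative g z) (at 0)) \<and> smooth_on N (ball 0 r) g" for b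
  proof -
    obtain f' where f': "radial_flat r (s - 1) f'"
      "\<And>z. z \<noteq> 0 \<Longrightarrow> norm z < r \<Longrightarrow> ((\<lambda>t. f (z + t *\<^sub>R b)) has_real_derivative f' z) (at 0)"
      using radial_flat_derivative[OF Suc.prems(1), of b] by blast
    have "((\<lambda>t. f (z + t *\<^sub>R b)) has_real_derivative f' z) (at 0)" if "z \<in> ball 0 r" for z
      using f'(2)[of z] that radial_flat_derivative_0[OF Suc.prems(1) _ assms(3), of b] Suc.prems(2) radial_flat_0[OF f'(1)]
      by (cases "z = 0") auto
    moreover have "smooth_on N (ball 0 r) f'" using f'(1) Suc.prems by (intro Suc.IH[of "s - 1"]) auto
    ultimately show ?thesis by blast
  qed
  ultimately show ?case by (simp add: continuous_at_imp_continuous_on)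
qed

lemma eval_fps_split:
  fixes F :: "real fps"
  assumes "ereal \<bar>t\<bar> < fps_conv_radius F"
  shows "eval_fps F t = (\<Sum>m<N. fps_nth F m * t ^ m) + t ^ N * eval_fps (fps_shift N F) t"
proof -
  have "summable (\<lambda>m. fps_nth F m * t ^ m)"
    using assms by (intro summable_fps) auto
  from suminf_split_initial_segment[OF this, of N]
  have "eval_fps F t = (\<Sum>m. fps_nth F (m + N) * t ^ (m + N)) + (\<Sum>m<N. fps_nth F m * t ^ m)"
    by (simp add: eval_fps_def)
  also have "(\<Sum>m. fps_nth F (m + N) * t ^ (m + N)) = (\<Sum>m. t ^ N * (fps_nth (fps_shift N F) m * t ^ m))"
    by (simp add: power_add mult_ac)
  also have "\<dots> = t ^ N * eval_fps (fps_shift N F) t"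
    unfolding eval_fps_def using assms by (intro suminf_mult summable_fps) auto
  finally show ?thesis by simp
qed

lemma radial_smooth_on:
  fixes \<psi> :: "real \<Rightarrow> real"
  assumes \<psi>: "\<psi> has_fps_expansion \<Psi>" and odd: "\<And>m. odd m \<Longrightarrow> m < 2 * p + 1 \<Longrightarrow> fps_nth \<Psi> m = 0"
  shows "\<exists>r>0. \<exists>f. smooth_on (2 * p) (ball (0 :: 'v::real_inner) r) f \<and> (\<forall>z\<in>ball 0 r. \<psi> (norm z) = f z)"
proof -
  have conv: "fps_conv_radius \<Psi> > 0" and ev: "\<forall>\<^sub>F t in nhds 0. eval_fps \<Psi> t = \<psi> t"
    using \<psi> by (auto simp: has_fps_expansion_def)
  obtain r1 where r1: "r1 > 0" "ereal r1 < fps_conv_radius \<Psi>"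
    using conv ereal_dense2[of 0 "fps_conv_radius \<Psi>"] by (auto simp: zero_ereal_def)
  obtain r2 where r2: "r2 > 0" "\<And>t. dist t 0 < r2 \<Longrightarrow> eval_fps \<Psi> t = \<psi> t"
    using ev unfolding eventually_nhds_metric by blast
  define r where "r = min r1 r2"
  have r: "r > 0" "ereal r < fps_conv_radius \<Psi>"
    using r1 r2 order_le_less_trans[of "ereal r" "ereal r1" "fps_conv_radius \<Psi>"] by (auto simp: r_def)
  \<comment> \<open>Flatness of order 2 p + 1 permits 2 p derivatives, that is, p in each argument
    of the kernel.\<close>
  define N where "N = 2 * p + 1"
  define rest where "rest z = (if z = 0 then 0 else norm z powi int N * eval_fps (fps_shift N \<Psi>) (norm z))" for z :: 'v
  define poly where "poly z = (\<Sum>m<N. (if even m then fps_nth \<Psi> m else 0) * inner z z ^ (m div 2))" for z :: 'v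
  have "radial_flat r (int N) rest"
    unfolding rest_def using r by (intro radial_flat.base) simp
  then have "smooth_on (2 * p) (ball 0 r) rest"
    by (rule radial_flat_smooth_on) (use r in \<open>auto simp: N_def\<close>)
  moreover have "smooth_on (2 * p) (ball 0 r) poly"
    unfolding poly_def by (intro smooth_on_sum smooth_on_mult smooth_on_const smooth_on_power smooth_on_inner_self) auto
  ultimately have "smooth_on (2 * p) (ball 0 r) (\<lambda>z. poly z + rest z)" by (intro smooth_on_add)
  moreover have "\<psi> (norm z) = poly z + rest z" if z: "z \<in> ball 0 r" for z
  proof -
    have nz: "norm z < r" using z by simp
    have "ereal \<bar>norm z\<bar> < fps_conv_radius \<Psi>"
      using order_less_trans[OF _ r(2), of "ereal (norm z)"] nz by simp
    note split = eval_fps_split[OF this, of N]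
    have "\<psi> (norm z) = eval_fps \<Psi> (norm z)" using r2(2)[of "norm z"] nz by (simp add: r_def)
    also have "\<dots> = (\<Sum>m<N. fps_nth \<Psi> m * norm z ^ m) + norm z ^ N * eval_fps (fps_shift N \<Psi>) (norm z)"
      by (rule split)
    also have "(\<Sum>m<N. fps_nth \<Psi> m * norm z ^ m) = poly z"
      unfolding poly_def
    proof (intro sum.cong refl)
      fix m assume "m \<in> {..<N}"
      show "fps_nth \<Psi> m * norm z ^ m = (if even m then fps_nth \<Psi> m else 0) * inner z z ^ (m div 2)"
      proof (cases "even m")
        case True
        then have "norm z ^ m = (norm z ^ 2) ^ (m div 2)" by (simp add: power_mult[symmetric])
        then show ?thesis using True by (simp add: power2_norm_eq_inner)
      next
        case False then show ?thesis using odd[of m] \<open>m \<in> {..<N}\<close> by (simp add: N_def)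
      qed
    qed
    also have "norm z ^ N * eval_fps (fps_shift N \<Psi>) (norm z) = rest z"
    proof (cases "z = 0")
      case True then show ?thesis by (simp add: rest_def N_def)
    next
      case False then show ?thesis by (simp add: rest_def)
    qed
    finally show ?thesis .
  qed
  ultimately show ?thesis using r(1) by blast
qed

section \<open>Radial kernels as functions of the difference of the arguments\<close>

lemma iter_partial_compose:
  assumes "\<And>w b t. L (w + t *\<^sub>R b) = L w + t *\<^sub>R L b"
  shows "iter_partial bs (\<lambda>w. F (L w)) w = iter_partial (map L bs) F (L w)"
proof (induction bs arbitrary: w)
  case (Cons b bs)
  have "iter_partial (b # bs) (\<lambda>w. F (L w)) w = partial_deriv b (\<lambda>w. iter_partial (map L bs) F (L w)) w"
    unfolding iter_partial_Cons using Cons by presburger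
  then show ?case by (simp add: iter_partial_Cons partial_deriv_def assms)
qed (simp add: iter_partial_def)

text \<open>The kernel is a radial function composed with the linear map L(y, z) = y - z. Mixed
  derivatives become derivatives of the radial function in the image directions, and p of them in
  each argument amount to at most 2 p.\<close>

lemma radial_C_class:
  fixes k :: "real ^ 'd::finite \<Rightarrow> real ^ 'd \<Rightarrow> real"
  assumes k: "\<And>y z. k y z = \<psi> (norm (y - z))" and \<psi>: "\<psi> has_fps_expansion \<Psi>"
    and odd: "\<And>m. odd m \<Longrightarrow> m < 2 * p + 1 \<Longrightarrow> fps_nth \<Psi> m = 0"
  shows "C_class p k"
proof -
  obtain r f where r: "r > 0" and f: "smooth_on (2 * p) (ball (0 :: real ^ 'd) r) f"
    "\<And>z. z \<in> ball 0 r \<Longrightarrow> \<psi> (norm z) = f z"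
    using radial_smooth_on[OF \<psi> odd, where 'v = "real ^ 'd"] by blast
  define L where "L w = fst w - snd w" for w :: "(real ^ 'd) \<times> (real ^ 'd)"
  have L: "L (w + t *\<^sub>R b) = L w + t *\<^sub>R L b" for w b t by (simp add: L_def algebra_simps)
  define F where "F z = \<psi> (norm z)" for z :: "real ^ 'd"
  have kF: "case_prod k = (\<lambda>w. F (L w))" by (auto simp: k F_def L_def)
  define U where "U = L -` ball 0 r"
  have contL: "continuous_on A L" for A unfolding L_def by (intro continuous_intros)
  have U: "open U" unfolding U_def using contL by (intro open_vimage) auto
  have iter: "\<exists>h. smooth_on (2 * p - length bs) (ball 0 r) h \<and> (\<forall>z\<in>ball 0 r. iter_partial (map L bs) F z = h z)"
    if "length bs \<le> 2 * p" for bs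
    using smooth_on_iter_partial[OF f(1), of F "map L bs"] f(2) that by (simp add: F_def)
  show ?thesis
    unfolding C_class_def
  proof (intro exI[of _ U] conjI allI impI ballI)
    show "open U" by (rule U)
    show "(0, 0) \<in> U" using r by (simp add: U_def L_def)
    fix us vs :: "'d list" assume len: "length us \<le> p \<and> length vs \<le> p"
    then have len': "length (xy_directions us vs) \<le> 2 * p" by (simp add: xy_directions_def)
    show "continuous_on U (iter_partial (xy_directions us vs) (case_prod k))"
    proof -
      obtain h where h: "smooth_on (2 * p - length (xy_directions us vs)) (ball 0 r) h"
        "\<forall>z\<in>ball 0 r. iter_partial (map L (xy_directions us vs)) F z = h z" using iter[OF len'] by blast
      have "continuous_on U (\<lambda>w. h (L w))"
        using continuous_on_compose2[OF smooth_on_imp_continuous_on[OF h(1)] contL[of U]] by (auto simp: U_def)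
      moreover have "iter_partial (xy_directions us vs) (case_prod k) w = h (L w)" if "w \<in> U" for w
        using h(2) that unfolding kF iter_partial_compose[of L, OF L] by (simp add: U_def)
      ultimately show ?thesis by (subst continuous_on_cong[OF refl]) auto
    qed
    fix b bs z assume bs: "xy_directions us vs = b # bs" and z: "z \<in> U"
    have "length bs \<le> 2 * p" using len' bs by simp
    then obtain h where h: "smooth_on (2 * p - length bs) (ball 0 r) h"
        "\<forall>z\<in>ball 0 r. iter_partial (map L bs) F z = h z" using iter by blast
    have "2 * p - length bs = Suc (2 * p - length (b # bs))" using len' bs by simp
    then obtain h' where h': "\<And>z. z \<in> ball 0 r \<Longrightarrow> ((\<lambda>t. h (z + t *\<^sub>R L b)) has_real_derivative h' z) (at 0)"
      using smooth_on_SucE[of "2 * p - length (b # bs)" "ball 0 r" h "L b"] h(1) by metis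
    have "((\<lambda>t. z + t *\<^sub>R b) \<longlongrightarrow> z + 0 *\<^sub>R b) (nhds 0)" by (intro tendsto_intros filterlim_ident)
    then have "\<forall>\<^sub>F t in nhds 0. z + t *\<^sub>R b \<in> U" using z U by (auto intro: topological_tendstoD)
    then have "\<forall>\<^sub>F t in nhds 0. iter_partial bs (case_prod k) (z + t *\<^sub>R b) = h (L z + t *\<^sub>R L b)"
    proof eventually_elim
      case (elim t)
      then have "L z + t *\<^sub>R L b \<in> ball 0 r" by (simp add: U_def L)
      then show ?case using h(2) unfolding kF iter_partial_compose[of L, OF L] L by blast
    qed
    moreover have "((\<lambda>t. h (L z + t *\<^sub>R L b)) has_real_derivative h' (L z)) (at 0)"
      using z by (intro h') (simp add: U_def)
    ultimately have "((\<lambda>t. iter_partial bs (case_prod k) (z + t *\<^sub>R b)) has_real_derivative h' (L z)) (at 0)"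
      by (subst DERIV_cong_ev[OF refl _ refl])
    then show "(\<lambda>t. iter_partial bs (case_prod k) (z + t *\<^sub>R b)) differentiable (at 0)"
      using real_differentiable_def by blast
  qed
qed

lemma regularity_index_odd_nth:
  assumes "regularity_index \<Psi> \<ge> enat (p + 1)" "odd m" "m < 2 * p + 1"
  shows "fps_nth \<Psi> m = 0"
proof (rule ccontr)
  assume nz: "fps_nth \<Psi> m \<noteq> 0"
  \<comment> \<open>An odd index below 2 p + 1 has the form 2 r - 1 with r \<le> p, so a nonzero
    coefficient there would bound the regularity index by p.\<close>
  obtain r where r: "m = 2 * r - 1" "1 \<le> r" "r \<le> p"
    using assms(2,3) by (intro that[of "(m + 1) div 2"]) (auto elim!: oddE)
  have "regularity_index \<Psi> \<le> enat r"
    unfolding regularity_index_def using r nz by (intro INF_lower) auto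
  then have "enat (p + 1) \<le> enat r" using assms(1) by (rule order_trans[rotated])
  then show False using r by simp
qed

lemma C_class_mono: "C_class N k \<Longrightarrow> M \<le> N \<Longrightarrow> C_class M k"
  unfolding C_class_def by (meson order_trans)

subsection \<open>Leading terms of eigensystems\<close>

text \<open>Multiplying U^T H U = \<Lambda> by U on the left and using U U^T = 1 gives H U = U
  \<Lambda>.\<close>

lemma congruence_on_diagonal_eigenvector:
  fixes H u :: "'i \<Rightarrow> 'i \<Rightarrow> 'a::comm_ring_1"
  assumes fin: "finite I" and u: "orthogonal_on I u"
    and diag: "\<And>i j. i \<in> I \<Longrightarrow> j \<in> I \<Longrightarrow> i \<noteq> j \<Longrightarrow> congruence_on I u H i j = 0"
    and a: "a \<in> I" and i: "i \<in> I"
  shows "(\<Sum>b\<in>I. H a b * u b i) = congruence_on I u H i i * u a i"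
proof -
  have "(\<Sum>b\<in>I. H a b * u b i) = (\<Sum>k\<in>I. (if a = k then 1 else 0) * (\<Sum>b\<in>I. H k b * u b i))"
    by (simp only: sum_delta_mult[OF fin a])
  also have "\<dots> = (\<Sum>k\<in>I. (\<Sum>j\<in>I. u a j * u k j) * (\<Sum>b\<in>I. H k b * u b i))"
    using u a by (intro sum.cong refl) (auto simp: orthogonal_on_def)
  also have "\<dots> = (\<Sum>k\<in>I. \<Sum>j\<in>I. u a j * (u k j * (\<Sum>b\<in>I. H k b * u b i)))"
    by (simp only: sum_distrib_right mult.assoc)
  also have "\<dots> = (\<Sum>j\<in>I. \<Sum>k\<in>I. u a j * (u k j * (\<Sum>b\<in>I. H k b * u b i)))" by (rule sum.swap)
  also have "\<dots> = (\<Sum>j\<in>I. u a j * congruence_on I u H j i)"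
    by (simp only: congruence_on_def sum_distrib_left mult.assoc)
  also have "\<dots> = (\<Sum>j\<in>I. (if j = i then 1 else 0) * (u a j * congruence_on I u H j j))"
  proof (intro sum.cong refl)
    fix j assume "j \<in> I"
    then show "u a j * congruence_on I u H j i = (if j = i then 1 else 0) * (u a j * congruence_on I u H j j)"
      using diag[of j i] i by simp
  qed
  also have "\<dots> = u a i * congruence_on I u H i i" by (rule sum_delta_mult(2)[OF fin i])
  finally show ?thesis by (simp only: mult.commute)
qed

text \<open>In an eigenbasis the form is a weighted sum of squares. Its weights are nonnegative by
  semidefiniteness and nonzero by nonsingularity, and the constant is a lower bound for
  them.\<close>

lemma psd_nonsingular_imp_coercive:
  fixes H :: "nat \<Rightarrow> nat \<Rightarrow> real"
  assumes sym: "\<And>a b. a < n \<Longrightarrow> b < n \<Longrightarrow> H a b = H b a"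
    and psd: "\<And>x. 0 \<le> (\<Sum>a<n. \<Sum>b<n. x a * H a b * x b)"
    and nonsing: "\<And>x. (\<And>a. a < n \<Longrightarrow> (\<Sum>b<n. H a b * x b) = 0) \<Longrightarrow> (\<And>a. a < n \<Longrightarrow> x a = 0)"
  shows "\<exists>c>0. \<forall>x. c * (\<Sum>a<n. (x a)\<^sup>2) \<le> (\<Sum>a<n. \<Sum>b<n. x a * H a b * x b)"
proof -
  have "real_ring.diagonalizable_on {..<n} H"
    by (rule real_symmetric_diagonalizable_on) (use sym in auto)
  then obtain u where u: "orthogonal_on {..<n} u"
    and diag: "\<And>i j. i < n \<Longrightarrow> j < n \<Longrightarrow> i \<noteq> j \<Longrightarrow> congruence_on {..<n} u H i j = 0"
    by (auto simp: real_ring.diagonalizable_on_def)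
  define lam where "lam i = congruence_on {..<n} u H i i" for i
  have uu: "(\<Sum>k<n. u k i * u k j) = (if i = j then 1 else 0)" "(\<Sum>k<n. u i k * u j k) = (if i = j then 1 else 0)"
    if "i < n" "j < n" for i j using u that by (auto simp: orthogonal_on_def)
  have Hu: "(\<Sum>b<n. H a b * u b i) = lam i * u a i" if "a < n" "i < n" for a i
    unfolding lam_def by (rule congruence_on_diagonal_eigenvector) (use u diag that in auto)
  have lam_pos: "lam i > 0" if i: "i < n" for i
  proof -
    have "0 \<le> lam i" using psd[of "\<lambda>a. u a i"] by (simp add: lam_def congruence_on_def)
    moreover have "lam i \<noteq> 0"
    proof
      assume "lam i = 0"
      then have "u a i = 0" if "a < n" for a
        using nonsing[of "\<lambda>b. u b i" a] Hu[OF _ i] that by simp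
      then show False using uu(1)[OF i i] by simp
    qed
    ultimately show ?thesis by simp
  qed
  \<comment> \<open>Inserting 1 makes the minimum meaningful for n = 0.\<close>
  define c where "c = Min (insert 1 (lam ` {..<n}))"
  have c: "c > 0" unfolding c_def using lam_pos by (subst Min_gr_iff) auto
  have cl: "c \<le> lam i" if "i < n" for i unfolding c_def using that by (intro Min_le) auto
  have "c * (\<Sum>a<n. (x a)\<^sup>2) \<le> (\<Sum>a<n. \<Sum>b<n. x a * H a b * x b)" for x
  proof -
    define z where "z i = (\<Sum>a<n. u a i * x a)" for i
    have x: "x a = (\<Sum>i<n. u a i * z i)" if a: "a < n" for a
    proof -
      have "(\<Sum>i<n. u a i * z i) = (\<Sum>i<n. \<Sum>b<n. u a i * u b i * x b)"
        by (simp add: z_def sum_distrib_left mult.assoc)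
      also have "\<dots> = (\<Sum>b<n. (\<Sum>i<n. u a i * u b i) * x b)"
        unfolding sum_distrib_right by (rule sum.swap)
      also have "\<dots> = (\<Sum>b<n. (if a = b then 1 else 0) * x b)"
        using uu(2)[OF a] by (intro sum.cong refl) auto
      finally show ?thesis using a by (simp add: sum_delta_mult)
    qed
    have "(\<Sum>a<n. \<Sum>b<n. x a * H a b * x b) = (\<Sum>a<n. x a * (\<Sum>i<n. z i * (\<Sum>b<n. H a b * u b i)))"
    proof (intro sum.cong refl)
      fix a
      have "(\<Sum>b<n. x a * H a b * x b) = (\<Sum>b<n. \<Sum>i<n. x a * (z i * (H a b * u b i)))"
        by (intro sum.cong refl, subst x) (auto simp: sum_distrib_left mult_ac)
      also have "\<dots> = x a * (\<Sum>i<n. z i * (\<Sum>b<n. H a b * u b i))"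
        unfolding sum_distrib_left by (rule sum.swap)
      finally show "(\<Sum>b<n. x a * H a b * x b) = x a * (\<Sum>i<n. z i * (\<Sum>b<n. H a b * u b i))" .
    qed
    also have "\<dots> = (\<Sum>a<n. \<Sum>i<n. x a * (z i * (lam i * u a i)))"
      unfolding sum_distrib_left[symmetric] by (intro sum.cong refl arg_cong2[of _ _ _ _ "(*)"]) (auto simp: Hu)
    also have "\<dots> = (\<Sum>i<n. lam i * z i * (\<Sum>a<n. u a i * x a))"
      unfolding sum_distrib_left by (rule trans[OF sum.swap]) (simp add: mult_ac)
    also have "\<dots> = (\<Sum>i<n. lam i * (z i)\<^sup>2)"
      unfolding z_def[symmetric] by (simp add: power2_eq_square mult_ac)
    also have "\<dots> \<ge> (\<Sum>i<n. c * (z i)\<^sup>2)" by (intro sum_mono mult_right_mono cl) auto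
    also have "(\<Sum>i<n. c * (z i)\<^sup>2) = c * (\<Sum>a<n. (x a)\<^sup>2)"
    proof -
      have "(\<Sum>i<n. (z i)\<^sup>2) = (\<Sum>i<n. \<Sum>a<n. x a * (u a i * z i))"
        by (simp add: power2_eq_square z_def sum_distrib_right sum_distrib_left mult_ac)
      also have "\<dots> = (\<Sum>a<n. x a * (\<Sum>i<n. u a i * z i))"
        unfolding sum_distrib_left by (rule sum.swap)
      also have "\<dots> = (\<Sum>a<n. (x a)\<^sup>2)"
        by (intro sum.cong refl) (simp add: x[symmetric] power2_eq_square)
      finally show ?thesis by (simp add: sum_distrib_left[symmetric])
    qed
    finally show ?thesis .
  qed
  then show ?thesis using c by blast
qed

section \<open>Real functions with power series expansions and their leading terms\<close>

lemma has_fps_expansion_nth_0: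
  fixes f :: "real \<Rightarrow> real"
  assumes "f has_fps_expansion F"
  shows "f 0 = fps_nth F 0"
  using assms eventually_nhds_x_imp_x[of "\<lambda>x. eval_fps F x = f x" 0]
  by (auto simp: has_fps_expansion_def eval_fps_at_0)

lemma has_fps_expansion_tendsto:
  fixes f :: "real \<Rightarrow> real"
  assumes "f has_fps_expansion F"
  shows "(f \<longlongrightarrow> f 0) (at_right 0)"
proof -
  have "isCont f 0" using assms by (rule has_fps_expansion_imp_continuous)
  then have "(f \<longlongrightarrow> f 0) (at 0)" by (simp add: isCont_def)
  then show ?thesis by (rule filterlim_mono) (auto simp: at_le)
qed

lemma has_fps_expansion_eventually_eq:
  fixes f g :: "real \<Rightarrow> real"
  assumes "f has_fps_expansion F" "g has_fps_expansion F"
  shows "\<forall>\<^sub>F x in nhds 0. f x = g x"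
proof -
  have "\<forall>\<^sub>F x in nhds 0. eval_fps F x = f x" "\<forall>\<^sub>F x in nhds 0. eval_fps F x = g x"
    using assms by (auto simp: has_fps_expansion_def)
  then show ?thesis by eventually_elim simp
qed

text \<open>The quotient by the leading power, completed at 0 by the leading coefficient, is
  expanded by the shifted series and is therefore continuous at 0.\<close>

lemma analytic_factorization:
  fixes f :: "real \<Rightarrow> real"
  assumes "f has_fps_expansion F" "F \<noteq> 0"
  obtains g where "\<forall>\<^sub>F \<epsilon> in at_right 0. f \<epsilon> = \<epsilon> ^ subdegree F * g \<epsilon>"
    "(g \<longlongrightarrow> fps_nth F (subdegree F)) (at_right 0)"
proof -
  define g where "g \<epsilon> = (if \<epsilon> = 0 then fps_nth F (subdegree F) else f \<epsilon> / \<epsilon> ^ subdegree F)" for \<epsilon>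
  have "g has_fps_expansion fps_shift (subdegree F) F"
    unfolding g_def by (rule has_fps_expansion_shift[OF assms(1)]) auto
  from has_fps_expansion_tendsto[OF this] has_fps_expansion_nth_0[OF this]
  have "(g \<longlongrightarrow> fps_nth F (subdegree F)) (at_right 0)" by simp
  moreover have "\<forall>\<^sub>F \<epsilon> in at_right 0. f \<epsilon> = \<epsilon> ^ subdegree F * g \<epsilon>"
    using eventually_at_right_less by eventually_elim (simp add: g_def)
  ultimately show ?thesis using that by blast
qed

text \<open>A nonzero difference F - G would give the zero function f - f a nonzero leading
  coefficient.\<close>

lemma has_fps_expansion_unique_real:
  fixes f :: "real \<Rightarrow> real"
  assumes "f has_fps_expansion F" "f has_fps_expansion G"
  shows "F = G"
proof (rule ccontr)
  assume "F \<noteq> G"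
  then have "F - G \<noteq> 0" by simp
  have "(\<lambda>x. f x - f x) has_fps_expansion F - G" by (rule has_fps_expansion_diff[OF assms])
  then obtain g where g: "\<forall>\<^sub>F \<epsilon> in at_right 0. f \<epsilon> - f \<epsilon> = \<epsilon> ^ subdegree (F - G) * g \<epsilon>"
    "(g \<longlongrightarrow> fps_nth (F - G) (subdegree (F - G))) (at_right 0)"
    using analytic_factorization[OF _ \<open>F - G \<noteq> 0\<close>] by blast
  have "\<forall>\<^sub>F \<epsilon> in at_right 0. g \<epsilon> = 0"
    using g(1) eventually_at_right_less by eventually_elim simp
  then have "(g \<longlongrightarrow> 0) (at_right 0)" by (rule tendsto_eventually)
  then have "fps_nth (F - G) (subdegree (F - G)) = 0"
    using g(2) by (intro tendsto_unique[OF trivial_limit_at_right_real])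
  then show False using \<open>F - G \<noteq> 0\<close> by (simp only: nth_subdegree_zero_iff)
qed

lemma taylor_fps_eq: "f has_fps_expansion F \<Longrightarrow> taylor_fps f = F"
  unfolding taylor_fps_def by (rule the_equality) (auto intro: has_fps_expansion_unique_real)

text \<open>For fixed \<epsilon> the right-hand side is the entry of a matrix T, and every
  \<open>u0 k\<close> is an eigenvector of T whose eigenvalue is the leading term. Completeness of
  the orthonormal system \<open>u0\<close> then gives the entries. Schur complements enter only
  through elimination coefficients, so no matrix inverse occurs here.\<close>

theorem sum_leading_terms_eq:
  fixes q H S u0 :: "nat \<Rightarrow> nat \<Rightarrow> real" and K :: "real \<Rightarrow> nat \<Rightarrow> nat \<Rightarrow> real" and d :: "nat \<Rightarrow> nat"
  assumes q: "orthogonal_on {..<n} q"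
    and lim: "\<And>A B. A < n \<Longrightarrow> B < n \<Longrightarrow>
      ((\<lambda>\<epsilon>. (\<Sum>a<n. \<Sum>b<n. q a A * q b B * K \<epsilon> a b) / \<epsilon> ^ (d A + d B)) \<longlongrightarrow> H A B) (at_right 0)"
    and c: "c > 0" and coercive: "\<And>x. c * (\<Sum>a<n. (x a)\<^sup>2) \<le> (\<Sum>a<n. \<Sum>b<n. x a * H a b * x b)"
    and schur: "\<And>A. A < n \<Longrightarrow> \<exists>p. (\<forall>B<n. d B < d A \<longrightarrow> H A B + (\<Sum>r\<in>{r. r < n \<and> d r < d A}. p r * H r B) = 0) \<and>
      (\<forall>B<n. d B = d A \<longrightarrow> S A B = H A B + (\<Sum>r\<in>{r. r < n \<and> d r < d A}. p r * H r B))"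
    and ev: "\<And>k. k < n \<Longrightarrow> ev k has_fps_expansion E k"
    and u: "\<And>k a. k < n \<Longrightarrow> a < n \<Longrightarrow> ((\<lambda>\<epsilon>. u k \<epsilon> a) \<longlongrightarrow> u0 k a) (at_right 0)"
    and orth: "\<forall>\<^sub>F \<epsilon> in at_right 0. \<forall>k<n. \<forall>l<n. (\<Sum>a<n. u k \<epsilon> a * u l \<epsilon> a) = (if k = l then 1 else 0)"
    and eigen: "\<forall>\<^sub>F \<epsilon> in at_right 0. \<forall>k<n. \<forall>a<n. (\<Sum>b<n. K \<epsilon> a b * u k \<epsilon> b) = ev k \<epsilon> * u k \<epsilon> a"
    and ab: "a < n" "b < n"
  shows "(\<Sum>k<n. leading_term (ev k) \<epsilon> * (u0 k a * u0 k b)) =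
    (\<Sum>A<n. \<Sum>B\<in>{B. B < n \<and> d B = d A}. \<epsilon> ^ (2 * d A) * (q a A * S A B * q b B))"
proof -
  have qq: "(\<Sum>a<n. q a A * q a B) = (if A = B then 1 else 0)" "(\<Sum>a<n. q A a * q B a) = (if A = B then 1 else 0)"
    if "A < n" "B < n" for A B using q that by (auto simp: orthogonal_on_def)
  have orth0: "(\<Sum>a<n. u0 k a * u0 l a) = (if k = l then 1 else 0)" if "k < n" "l < n" for k l
  proof -
    have "((\<lambda>\<epsilon>. \<Sum>a<n. u k \<epsilon> a * u l \<epsilon> a) \<longlongrightarrow> (\<Sum>a<n. u0 k a * u0 l a)) (at_right 0)"
      using that by (intro tendsto_intros u) auto
    moreover have "((\<lambda>\<epsilon>. \<Sum>a<n. u k \<epsilon> a * u l \<epsilon> a) \<longlongrightarrow> (if k = l then 1 else 0)) (at_right 0)"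
      by (rule tendsto_eventually) (use orth that in \<open>auto elim: eventually_mono\<close>)
    ultimately show ?thesis by (intro tendsto_unique[OF trivial_limit_at_right_real])
  qed
  define v where "v k \<epsilon> A = (\<Sum>a<n. q a A * u k \<epsilon> a)" for k \<epsilon> A
  define w where "w k A = (\<Sum>a<n. q a A * u0 k a)" for k A
  have u_v: "u k \<epsilon> a = (\<Sum>A<n. q a A * v k \<epsilon> A)" if a: "a < n" for k \<epsilon> a
  proof -
    have "(\<Sum>A<n. q a A * v k \<epsilon> A) = (\<Sum>b<n. (\<Sum>A<n. q a A * q b A) * u k \<epsilon> b)"
      unfolding v_def sum_distrib_left sum_distrib_right by (rule trans[OF sum.swap]) (simp add: mult_ac)
    also have "\<dots> = (\<Sum>b<n. (if a = b then 1 else 0) * u k \<epsilon> b)"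
      using qq(2)[OF a] by (intro sum.cong refl) auto
    finally show ?thesis using a by (simp add: sum_delta_mult)
  qed
  have u0_w: "u0 k a = (\<Sum>A<n. q a A * w k A)" if a: "a < n" for k a
  proof -
    have "(\<Sum>A<n. q a A * w k A) = (\<Sum>b<n. (\<Sum>A<n. q a A * q b A) * u0 k b)"
      unfolding w_def sum_distrib_left sum_distrib_right by (rule trans[OF sum.swap]) (simp add: mult_ac)
    also have "\<dots> = (\<Sum>b<n. (if a = b then 1 else 0) * u0 k b)"
      using qq(2)[OF a] by (intro sum.cong refl) auto
    finally show ?thesis using a by (simp add: sum_delta_mult)
  qed
  define M where "M \<epsilon> A B = (\<Sum>a<n. \<Sum>b<n. q a A * q b B * K \<epsilon> a b) / \<epsilon> ^ (d A + d B)" for \<epsilon> A B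
  have key: "\<exists>i l. (\<forall>\<epsilon>. leading_term (ev k) \<epsilon> = l * \<epsilon> ^ (2 * i)) \<and> (\<forall>A<n. w k A \<noteq> 0 \<longrightarrow> d A = i) \<and>
      (\<forall>A<n. d A = i \<longrightarrow> (\<Sum>B\<in>{B. B < n \<and> d B = i}. S A B * w k B) = l * w k A)" if k: "k < n" for k
  proof -
    interpret scaled_eigenvector n d M H c "v k" "w k" "ev k"
    proof
      show "((\<lambda>\<epsilon>. M \<epsilon> A B) \<longlongrightarrow> H A B) (at_right 0)" if "A < n" "B < n" for A B
        unfolding M_def using lim[OF that] .
      show "((\<lambda>\<epsilon>. v k \<epsilon> A) \<longlongrightarrow> w k A) (at_right 0)" if "A < n" for A
        unfolding v_def w_def using k by (intro tendsto_intros u) auto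
      show "\<forall>\<^sub>F \<epsilon> in at_right 0. (\<Sum>A<n. (v k \<epsilon> A)\<^sup>2) = 1"
        using orth
      proof eventually_elim
        case (elim \<epsilon>)
        have "(\<Sum>A<n. (v k \<epsilon> A)\<^sup>2) = (\<Sum>A<n. \<Sum>a<n. u k \<epsilon> a * (q a A * v k \<epsilon> A))"
          by (simp add: power2_eq_square v_def[of k \<epsilon>] sum_distrib_right sum_distrib_left mult_ac)
        also have "\<dots> = (\<Sum>a<n. u k \<epsilon> a * (\<Sum>A<n. q a A * v k \<epsilon> A))"
          unfolding sum_distrib_left by (rule sum.swap)
        also have "\<dots> = (\<Sum>a<n. u k \<epsilon> a * u k \<epsilon> a)" by (intro sum.cong refl) (simp add: u_v[symmetric])
        also have "\<dots> = 1" using elim k by simp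
        finally show ?case .
      qed
      show "\<forall>\<^sub>F \<epsilon> in at_right 0. \<forall>A<n. (\<Sum>B<n. \<epsilon> ^ (d A + d B) * M \<epsilon> A B * v k \<epsilon> B) = ev k \<epsilon> * v k \<epsilon> A"
        using eigen eventually_at_right_less
      proof eventually_elim
        case (elim \<epsilon>)
        show ?case
        proof (intro allI impI)
          fix A assume A: "A < n"
          have "\<epsilon> ^ (d A + d B) * M \<epsilon> A B = (\<Sum>a<n. \<Sum>b<n. q a A * q b B * K \<epsilon> a b)" for B
            using elim by (simp add: M_def)
          then have "(\<Sum>B<n. \<epsilon> ^ (d A + d B) * M \<epsilon> A B * v k \<epsilon> B) = (\<Sum>B<n. \<Sum>a<n. \<Sum>b<n. q a A * (K \<epsilon> a b * (q b B * v k \<epsilon> B)))"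
            by (simp only: sum_distrib_right) (simp only: mult_ac)
          also have "\<dots> = (\<Sum>a<n. \<Sum>B<n. \<Sum>b<n. q a A * (K \<epsilon> a b * (q b B * v k \<epsilon> B)))" by (rule sum.swap)
          also have "\<dots> = (\<Sum>a<n. \<Sum>b<n. \<Sum>B<n. q a A * (K \<epsilon> a b * (q b B * v k \<epsilon> B)))"
            by (rule sum.cong[OF refl], rule sum.swap)
          also have "\<dots> = (\<Sum>a<n. q a A * (\<Sum>b<n. K \<epsilon> a b * (\<Sum>B<n. q b B * v k \<epsilon> B)))"
            by (simp only: sum_distrib_left)
          also have "\<dots> = (\<Sum>a<n. q a A * (\<Sum>b<n. K \<epsilon> a b * u k \<epsilon> b))"
            by (intro sum.cong refl arg_cong2[of _ _ _ _ "(*)"]) (auto simp: u_v[symmetric])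
          also have "\<dots> = (\<Sum>a<n. q a A * (ev k \<epsilon> * u k \<epsilon> a))" using elim k by simp
          also have "\<dots> = ev k \<epsilon> * v k \<epsilon> A" by (simp add: v_def sum_distrib_left mult_ac)
          finally show "(\<Sum>B<n. \<epsilon> ^ (d A + d B) * M \<epsilon> A B * v k \<epsilon> B) = ev k \<epsilon> * v k \<epsilon> A" .
        qed
      qed
    qed (rule c, rule coercive)
    \<comment> \<open>The limit \<open>u0 k\<close> is a unit vector and \<open>w k\<close> its
      coordinate vector in the basis q.\<close>
    have "\<exists>A<n. w k A \<noteq> 0"
    proof (rule ccontr)
      assume "\<not> (\<exists>A<n. w k A \<noteq> 0)"
      then have "u0 k a = 0" if "a < n" for a using that by (simp add: u0_w)
      then show False using orth0[OF k k] by simp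
    qed
    then obtain A0 where A0: "A0 < n" "w k A0 \<noteq> 0" by blast
    define i where "i = d A0"
    have supp: "d A = i" if "A < n" "w k A \<noteq> 0" for A
      unfolding i_def by (rule same_block[OF that A0])
    have E0: "E k \<noteq> 0"
    proof
      assume "E k = 0"
      have "\<forall>\<^sub>F \<epsilon> in nhds 0. eval_fps (E k) \<epsilon> = ev k \<epsilon>"
        using ev[OF k] by (simp add: has_fps_expansion_def)
      then have "\<forall>\<^sub>F \<epsilon> in nhds 0. ev k \<epsilon> = 0" by eventually_elim (simp add: \<open>E k = 0\<close>)
      then have "\<forall>\<^sub>F \<epsilon> in at_right 0. ev k \<epsilon> = 0" by (simp add: eventually_at_filter eventually_mono)
      with eigenvalue_nonzero[OF A0] have "\<forall>\<^sub>F \<epsilon> :: real in at_right 0. False" by eventually_elim simp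
      then show False by (simp add: trivial_limit_at_right_real eventually_False)
    qed
    define m l where "m = subdegree (E k)" and "l = fps_nth (E k) m"
    obtain g where g: "\<forall>\<^sub>F \<epsilon> in at_right 0. ev k \<epsilon> = \<epsilon> ^ m * g \<epsilon>" "(g \<longlongrightarrow> l) (at_right 0)"
      using analytic_factorization[OF ev[OF k] E0] unfolding l_def m_def by blast
    have "l \<noteq> 0" using E0 by (simp add: l_def m_def)
    then have m: "m = 2 * i" unfolding i_def by (rule eigenvalue_order[OF A0 g])
    have "leading_term (ev k) \<epsilon> = l * \<epsilon> ^ (2 * i)" for \<epsilon>
      using E0 by (simp add: leading_term_def Let_def taylor_fps_eq[OF ev[OF k]] l_def m[symmetric] m_def)
    moreover have "(\<Sum>B\<in>{B. B < n \<and> d B = i}. S A B * w k B) = l * w k A" if A: "A < n" "d A = i" for A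
    proof -
      obtain p where p: "\<And>B. B < n \<Longrightarrow> d B < i \<Longrightarrow> H A B + (\<Sum>r\<in>{r. r < n \<and> d r < i}. p r * H r B) = 0"
        "\<And>B. B < n \<Longrightarrow> d B = i \<Longrightarrow> S A B = H A B + (\<Sum>r\<in>{r. r < n \<and> d r < i}. p r * H r B)"
        using schur[OF A(1), unfolded A(2)] by blast
      have "(\<Sum>B\<in>{B. B < n \<and> d B = i}. S A B * w k B) =
          (\<Sum>B\<in>{B. B < n \<and> d B = i}. (H A B + (\<Sum>r\<in>{r. r < n \<and> d r < i}. p r * H r B)) * w k B)"
        by (intro sum.cong refl) (simp add: p(2))
      also have "\<dots> = l * w k A"
        by (rule schur_eigenvector[OF g[unfolded m] supp _ A p(1)]) (use A0 in auto)
      finally show ?thesis .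
    qed
    ultimately show ?thesis using supp by blast
  qed
  define T where "T a b = (\<Sum>A<n. \<Sum>B\<in>{B. B < n \<and> d B = d A}. \<epsilon> ^ (2 * d A) * (q a A * S A B * q b B))" for a b
  have T_u: "(\<Sum>b<n. T a b * u0 k b) = leading_term (ev k) \<epsilon> * u0 k a" if a: "a < n" and k: "k < n" for a k
  proof -
    obtain i l where il: "leading_term (ev k) \<epsilon> = l * \<epsilon> ^ (2 * i)" "\<And>A. A < n \<Longrightarrow> w k A \<noteq> 0 \<Longrightarrow> d A = i"
      "\<And>A. A < n \<Longrightarrow> d A = i \<Longrightarrow> (\<Sum>B\<in>{B. B < n \<and> d B = i}. S A B * w k B) = l * w k A"
      using key[OF k] by blast
    have "(\<Sum>b<n. T a b * u0 k b) = (\<Sum>b<n. \<Sum>A<n. \<Sum>B\<in>{B. B < n \<and> d B = d A}. \<epsilon> ^ (2 * d A) * q a A * (S A B * (q b B * u0 k b)))"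
      by (simp only: T_def sum_distrib_right) (simp only: mult_ac)
    also have "\<dots> = (\<Sum>A<n. \<Sum>b<n. \<Sum>B\<in>{B. B < n \<and> d B = d A}. \<epsilon> ^ (2 * d A) * q a A * (S A B * (q b B * u0 k b)))"
      by (rule sum.swap)
    also have "\<dots> = (\<Sum>A<n. \<Sum>B\<in>{B. B < n \<and> d B = d A}. \<Sum>b<n. \<epsilon> ^ (2 * d A) * q a A * (S A B * (q b B * u0 k b)))"
      by (rule sum.cong[OF refl], rule sum.swap)
    also have "\<dots> = (\<Sum>A<n. \<epsilon> ^ (2 * d A) * q a A * (\<Sum>B\<in>{B. B < n \<and> d B = d A}. S A B * w k B))"
      by (simp only: sum_distrib_left[symmetric] w_def)
    \<comment> \<open>Outside block i the vector \<open>w k\<close> vanishes, and with it every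
      block sum there. Hence all powers of \<epsilon> may be replaced by the one that belongs to
      block i.\<close>
    also have "\<dots> = (\<Sum>A<n. \<epsilon> ^ (2 * i) * q a A * (l * w k A))"
    proof (intro sum.cong refl)
      fix A assume A: "A \<in> {..<n}"
      show "\<epsilon> ^ (2 * d A) * q a A * (\<Sum>B\<in>{B. B < n \<and> d B = d A}. S A B * w k B) = \<epsilon> ^ (2 * i) * q a A * (l * w k A)"
      proof (cases "d A = i")
        case True then show ?thesis using il(3)[of A] A by simp
      next
        case False
        then have "w k A = 0" using il(2)[of A] A by auto
        moreover have "(\<Sum>B\<in>{B. B < n \<and> d B = d A}. S A B * w k B) = 0"
        proof (intro sum.neutral ballI)
          fix B assume "B \<in> {B. B < n \<and> d B = d A}"
          then have "w k B = 0" using il(2)[of B] False by auto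
          then show "S A B * w k B = 0" by simp
        qed
        ultimately show ?thesis by simp
      qed
    qed
    also have "\<dots> = leading_term (ev k) \<epsilon> * u0 k a"
      by (simp add: il(1) u0_w[OF a] sum_distrib_left mult_ac)
    finally show ?thesis .
  qed
  \<comment> \<open>Orthonormality of the limit vectors gives the completeness relation, which
    resolves the identity in the sums below.\<close>
  have "orthogonal_on {..<n} (\<lambda>a k. u0 k a)"
    by (rule orthogonal_onI) (use orth0 in auto)
  then have compl: "(\<Sum>k<n. u0 k a * u0 k b) = (if a = b then 1 else 0)" if "a < n" "b < n" for a b
    using that by (auto simp: orthogonal_on_def)
  have "(\<Sum>k<n. leading_term (ev k) \<epsilon> * (u0 k a * u0 k b)) = (\<Sum>k<n. \<Sum>b'<n. T a b' * (u0 k b' * u0 k b))"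
    using T_u[OF ab(1)] by (intro sum.cong refl) (simp add: sum_distrib_right[symmetric] mult.assoc[symmetric])
  also have "\<dots> = (\<Sum>b'<n. T a b' * (\<Sum>k<n. u0 k b' * u0 k b))"
    unfolding sum_distrib_left by (rule sum.swap)
  also have "\<dots> = (\<Sum>b'<n. T a b' * (if b' = b then 1 else 0))"
    using compl ab by (intro sum.cong refl) auto
  also have "\<dots> = T a b" using ab by (simp add: sum_delta_mult)
  finally show ?thesis by (simp add: T_def)
qed

subsection \<open>Block decompositions\<close>

abbreviation offset :: "(nat \<Rightarrow> nat) \<Rightarrow> nat \<Rightarrow> nat" where
  "offset b i \<equiv> \<Sum>k<i. b k"

text \<open>The least index skips empty blocks, for which two successive offsets coincide.\<close>

definition block_of :: "(nat \<Rightarrow> nat) \<Rightarrow> nat \<Rightarrow> nat" where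
  "block_of b a = (LEAST i. a < offset b (Suc i))"

lemma offset_mono: "i \<le> j \<Longrightarrow> offset b i \<le> offset b j"
  by (rule sum_mono2) auto

lemma offset_less: "i < m \<Longrightarrow> c < b i \<Longrightarrow> offset b i + c < offset b m"
  using offset_mono[of "Suc i" m b] by simp

lemma block_of_offset:
  assumes "c < b i"
  shows "block_of b (offset b i + c) = i"
  unfolding block_of_def
proof (rule Least_equality)
  show "offset b i + c < offset b (Suc i)" using assms by simp
  fix j assume j: "offset b i + c < offset b (Suc j)"
  show "i \<le> j"
  proof (rule ccontr)
    assume "\<not> i \<le> j"
    then have "offset b (Suc j) \<le> offset b i" by (intro offset_mono) simp
    then show False using j by linarith
  qed
qed

lemma offset_cases:
  assumes "a < offset b m"
  obtains i c where "i < m" "c < b i" "a = offset b i + c"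
proof -
  have "\<exists>i<m. \<exists>c<b i. a = offset b i + c"
    using assms
  proof (induction m)
    case (Suc m)
    show ?case
    proof (cases "a < offset b m")
      case True then show ?thesis using Suc.IH less_SucI by blast
    next
      case False
      then have "a - offset b m < b m" "a = offset b m + (a - offset b m)" using Suc.prems by auto
      then show ?thesis by blast
    qed
  qed simp
  then show ?thesis using that by blast
qed

lemma sum_lessThan_add:
  fixes f :: "nat \<Rightarrow> 'a::comm_monoid_add"
  shows "sum f {..<k + l} = sum f {..<k} + (\<Sum>c<l. f (k + c))"
  by (induction l) (auto simp: add.assoc)

lemma sum_offset:
  fixes f :: "nat \<Rightarrow> 'a::comm_monoid_add"
  shows "sum f {..<offset b m} = (\<Sum>i<m. \<Sum>c<b i. f (offset b i + c))"
  by (induction m) (auto simp: sum_lessThan_add)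

lemma concat_map_upt:
  assumes "\<And>i. i < m \<Longrightarrow> length (f i) = b i"
  shows "length (concat (map f [0..<m])) = offset b m"
    "i < m \<Longrightarrow> c < b i \<Longrightarrow> concat (map f [0..<m]) ! (offset b i + c) = f i ! c"
proof -
  have "length (concat (map f [0..<m])) = offset b m \<and>
    (\<forall>i<m. \<forall>c<b i. concat (map f [0..<m]) ! (offset b i + c) = f i ! c)"
    using assms
  proof (induction m)
    case (Suc m)
    then have IH: "length (concat (map f [0..<m])) = offset b m"
      "\<And>i c. i < m \<Longrightarrow> c < b i \<Longrightarrow> concat (map f [0..<m]) ! (offset b i + c) = f i ! c" by auto
    have "concat (map f [0..<Suc m]) ! (offset b i + c) = f i ! c" if "i < Suc m" "c < b i" for i c
    proof (cases "i = m")
      case True then show ?thesis by (simp add: nth_append IH(1))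
    next
      case False
      then have "i < m" using that by simp
      then show ?thesis using IH(2)[of i c] offset_less[of i m c b] that by (simp add: nth_append IH(1))
    qed
    then show ?case using Suc.prems IH(1) by simp
  qed simp
  then show "length (concat (map f [0..<m])) = offset b m"
    "i < m \<Longrightarrow> c < b i \<Longrightarrow> concat (map f [0..<m]) ! (offset b i + c) = f i ! c" by auto
qed

lemma hcat_carrier:
  assumes "\<And>i. i < m \<Longrightarrow> A i \<in> carrier_mat n (b i)"
  shows "hcat n (map A [0..<m]) \<in> carrier_mat n (offset b m)"
proof -
  have "length (cols (A i)) = b i" if "i < m" for i using assms[OF that] by simp
  then have len: "length (concat (map (\<lambda>i. cols (A i)) [0..<m])) = offset b m"
    by (rule concat_map_upt(1))
  show ?thesis
    using mat_of_cols_carrier(1)[of n "concat (map (\<lambda>i. cols (A i)) [0..<m])"]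
    unfolding len hcat_def map_map o_def .
qed

lemma hcat_index:
  assumes A: "\<And>i. i < m \<Longrightarrow> A i \<in> carrier_mat n (b i)" and "i < m" "c < b i" "r < n"
  shows "hcat n (map A [0..<m]) $$ (r, offset b i + c) = A i $$ (r, c)"
proof -
  have len: "length (cols (A i)) = b i" if "i < m" for i using A[OF that] by simp
  have dims: "dim_col (A i) = b i" "dim_row (A i) = n" using A[OF assms(2)] by auto
  show ?thesis
    using concat_map_upt(1)[of m "\<lambda>i. cols (A i)" b, OF len]
      concat_map_upt(2)[of m "\<lambda>i. cols (A i)" b i c, OF len assms(2,3)]
      offset_less[of i m c b] assms(2-4) dims
    by (simp add: hcat_def o_def mat_of_cols_index)
qed

lemma vcat_carrier:
  assumes "\<And>i. i < m \<Longrightarrow> A i \<in> carrier_mat (b i) n"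
  shows "vcat n (map A [0..<m]) \<in> carrier_mat (offset b m) n"
proof -
  have "length (rows (A i)) = b i" if "i < m" for i using assms[OF that] by simp
  then have len: "length (concat (map (\<lambda>i. rows (A i)) [0..<m])) = offset b m"
    by (rule concat_map_upt(1))
  show ?thesis
    using mat_of_rows_carrier(1)[of n "concat (map (\<lambda>i. rows (A i)) [0..<m])"]
    unfolding len vcat_def map_map o_def .
qed

lemma vcat_index:
  assumes A: "\<And>i. i < m \<Longrightarrow> A i \<in> carrier_mat (b i) n" and "i < m" "c < b i" "r < n"
  shows "vcat n (map A [0..<m]) $$ (offset b i + c, r) = A i $$ (c, r)"
proof -
  have len: "length (rows (A i)) = b i" if "i < m" for i using A[OF that] by simp
  have dims: "dim_row (A i) = b i" "dim_col (A i) = n" using A[OF assms(2)] by auto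
  show ?thesis
    using concat_map_upt(1)[of m "\<lambda>i. rows (A i)" b, OF len]
      concat_map_upt(2)[of m "\<lambda>i. rows (A i)" b i c, OF len assms(2,3)]
      offset_less[of i m c b] assms(2-4) dims
    by (simp add: vcat_def o_def mat_of_rows_index)
qed

lemma block_matrix_carrier:
  assumes "\<And>i j. i < m \<Longrightarrow> j < m \<Longrightarrow> B i j \<in> carrier_mat (nr i) (nc j)"
  shows "block_matrix m nr nc B \<in> carrier_mat (offset nr m) (offset nc m)"
  unfolding block_matrix_def using assms by (intro vcat_carrier hcat_carrier) auto

lemma block_matrix_index:
  assumes B: "\<And>i j. i < m \<Longrightarrow> j < m \<Longrightarrow> B i j \<in> carrier_mat (nr i) (nc j)"
    and ij: "i < m" "a < nr i" "j < m" "c < nc j"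
  shows "block_matrix m nr nc B $$ (offset nr i + a, offset nc j + c) = B i j $$ (a, c)"
proof -
  have "hcat (nr i) (map (B i) [0..<m]) \<in> carrier_mat (nr i) (offset nc m)" if "i < m" for i
    using B that by (intro hcat_carrier) auto
  from vcat_index[of m "\<lambda>i. hcat (nr i) (map (B i) [0..<m])" nr "offset nc m" i a "offset nc j + c", OF this]
  have "block_matrix m nr nc B $$ (offset nr i + a, offset nc j + c) = hcat (nr i) (map (B i) [0..<m]) $$ (a, offset nc j + c)"
    using ij offset_less[of j m c nc] by (simp add: block_matrix_def)
  also have "\<dots> = B i j $$ (a, c)" using B ij by (intro hcat_index) auto
  finally show ?thesis .
qed

lemma diag_block_mat_carrier_index:
  fixes D :: "nat \<Rightarrow> 'a::zero mat"
  assumes "\<And>i. i < m \<Longrightarrow> D i \<in> carrier_mat (r i) (c i)"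
  shows "diag_block_mat (map D [0..<m]) \<in> carrier_mat (offset r m) (offset c m)"
    "i < m \<Longrightarrow> a < r i \<Longrightarrow> j < m \<Longrightarrow> e < c j \<Longrightarrow>
      diag_block_mat (map D [0..<m]) $$ (offset r i + a, offset c j + e) = (if i = j then D i $$ (a, e) else 0)"
proof -
  have "diag_block_mat (map D [0..<m]) \<in> carrier_mat (offset r m) (offset c m) \<and>
    (\<forall>i a j e. i < m \<longrightarrow> a < r i \<longrightarrow> j < m \<longrightarrow> e < c j \<longrightarrow>
      diag_block_mat (map D [0..<m]) $$ (offset r i + a, offset c j + e) = (if i = j then D i $$ (a, e) else 0))"
    using assms
  proof (induction m arbitrary: D r c)
    case 0 then show ?case by simp
  next
    case (Suc m)
    \<comment> \<open>The recursion of \<open>diag_block_mat\<close> splits off the first block, so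
      the induction runs on the sequences shifted by one, and all offsets move by \<open>r 0\<close>
      and \<open>c 0\<close>.\<close>
    define D' r' c' where "D' i = D (Suc i)" and "r' i = r (Suc i)" and "c' i = c (Suc i)" for i
    define B where "B = diag_block_mat (map D' [0..<m])"
    have IH: "B \<in> carrier_mat (offset r' m) (offset c' m)"
      "\<And>i a j e. i < m \<Longrightarrow> a < r' i \<Longrightarrow> j < m \<Longrightarrow> e < c' j \<Longrightarrow>
        B $$ (offset r' i + a, offset c' j + e) = (if i = j then D' i $$ (a, e) else 0)"
    proof -
      have "D' i \<in> carrier_mat (r' i) (c' i)" if "i < m" for i
        unfolding D'_def r'_def c'_def using Suc.prems that by simp
      note * = Suc.IH[of D' r' c', OF this, folded B_def]
      show "B \<in> carrier_mat (offset r' m) (offset c' m)" using * by blast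
      show "B $$ (offset r' i + a, offset c' j + e) = (if i = j then D' i $$ (a, e) else 0)"
        if "i < m" "a < r' i" "j < m" "e < c' j" for i a j e using * that by blast
    qed
    have D0: "D 0 \<in> carrier_mat (r 0) (c 0)" using Suc.prems by simp
    have "map D [0..<Suc m] = D 0 # map D' [0..<m]"
      unfolding D'_def by (simp add: upt_conv_Cons map_Suc_upt[symmetric] del: upt_Suc)
    then have eq: "diag_block_mat (map D [0..<Suc m]) =
        four_block_mat (D 0) (0\<^sub>m (r 0) (offset c' m)) (0\<^sub>m (offset r' m) (c 0)) B"
      using D0 IH(1) by (simp add: B_def Let_def)
    have off: "offset r (Suc i) = r 0 + offset r' i" "offset c (Suc i) = c 0 + offset c' i" for i
      unfolding r'_def c'_def by (rule sum.lessThan_Suc_shift)+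
    have "diag_block_mat (map D [0..<Suc m]) $$ (offset r i + a, offset c j + e) = (if i = j then D i $$ (a, e) else 0)"
      if ij: "i < Suc m" "a < r i" "j < Suc m" "e < c j" for i a j e
    proof -
      have dims: "dim_row (D 0) = r 0" "dim_col (D 0) = c 0" "dim_row B = offset r' m" "dim_col B = offset c' m"
        using D0 IH(1) by auto
      have "offset r i + a < offset r (Suc m)" "offset c j + e < offset c (Suc m)"
        using ij by (auto intro!: offset_less simp del: sum.lessThan_Suc)
      then have lt: "offset r i + a < r 0 + offset r' m" "offset c j + e < c 0 + offset c' m"
        unfolding off .
      show ?thesis
      proof (cases i)
        case i: 0
        show ?thesis
        proof (cases j)
          case 0 then show ?thesis using i ij lt dims unfolding eq by simp
        next
          case (Suc j')
          then have "e < c' j'" "j' < m" using ij by (auto simp: c'_def)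
          then have "offset c' j' + e < offset c' m" by (intro offset_less)
          then show ?thesis using i Suc ij lt dims off(2)[of j'] unfolding eq by simp
        qed
      next
        case i: (Suc i')
        then have i': "a < r' i'" "i' < m" using ij by (auto simp: r'_def)
        then have li: "offset r' i' + a < offset r' m" by (intro offset_less)
        show ?thesis
        proof (cases j)
          case 0 then show ?thesis using i li ij lt dims off(1)[of i'] unfolding eq by simp
        next
          case (Suc j')
          then have j': "e < c' j'" "j' < m" using ij by (auto simp: c'_def)
          have "offset r i + a = r 0 + (offset r' i' + a)" "offset c j + e = c 0 + (offset c' j' + e)"
            using i Suc off by (simp_all del: sum.lessThan_Suc)
          then have "diag_block_mat (map D [0..<Suc m]) $$ (offset r i + a, offset c j + e) = B $$ (offset r' i' + a, offset c' j' + e)"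
            using lt dims unfolding eq by simp
          then show ?thesis using IH(2)[OF i'(2,1) j'(2,1)] i Suc by (simp add: D'_def)
        qed
      qed
    qed
    moreover have "diag_block_mat (map D [0..<Suc m]) \<in> carrier_mat (offset r (Suc m)) (offset c (Suc m))"
      unfolding eq off using D0 IH(1) by (intro four_block_carrier_mat) auto
    ultimately show ?case by blast
  qed
  then show "diag_block_mat (map D [0..<m]) \<in> carrier_mat (offset r m) (offset c m)"
    "i < m \<Longrightarrow> a < r i \<Longrightarrow> j < m \<Longrightarrow> e < c j \<Longrightarrow>
      diag_block_mat (map D [0..<m]) $$ (offset r i + a, offset c j + e) = (if i = j then D i $$ (a, e) else 0)"
    by blast+
qed

lemma mat_mult_index:
  assumes "A \<in> carrier_mat n m" "B \<in> carrier_mat m l" "i < n" "j < l"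
  shows "(A * B) $$ (i, j) = (\<Sum>k<m. A $$ (i, k) * B $$ (k, j))"
  using assms by (simp add: scalar_prod_def atLeast0LessThan)

lemma sum_delta_lessThan:
  fixes f :: "nat \<Rightarrow> 'a::semiring_1"
  shows "i < m \<Longrightarrow> (\<Sum>j<m. (if i = j then f j else 0)) = f i" "i < m \<Longrightarrow> (\<Sum>j<m. (if j = i then f j else 0)) = f i"
  by (auto simp: sum.delta sum.delta')

text \<open>The diagonal factors pick out a single block on either side, so block (i, j) of H is
  R_{i,i} W_{i,j} R_{j,j}^T.\<close>

lemma H_matrix_carrier_index:
  assumes R: "\<And>i. i \<le> p \<Longrightarrow> R i i \<in> carrier_mat (b i) (length (mons i))"
  shows "H_matrix mons k p R \<in> carrier_mat (offset b (Suc p)) (offset b (Suc p))"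
    "i \<le> p \<Longrightarrow> a < b i \<Longrightarrow> j \<le> p \<Longrightarrow> c < b j \<Longrightarrow>
      H_matrix mons k p R $$ (offset b i + a, offset b j + c) =
      (\<Sum>s<length (mons i). \<Sum>t<length (mons j). R i i $$ (a, s) * wronskian_block mons k i j $$ (s, t) * R j j $$ (c, t))"
proof -
  define h where "h i = length (mons i)" for i
  define D where "D = diag_block_mat (map (\<lambda>i. R i i) [0..<Suc p])"
  define D' where "D' = diag_block_mat (map (\<lambda>i. transpose_mat (R i i)) [0..<Suc p])"
  define W where "W = wronskian_le mons k p"
  have Rc: "R i i \<in> carrier_mat (b i) (h i)" "transpose_mat (R i i) \<in> carrier_mat (h i) (b i)" if "i < Suc p" for i
    using R[of i] that by (auto simp: h_def)
  note D = diag_block_mat_carrier_index[of "Suc p" "\<lambda>i. R i i" b h, OF Rc(1), folded D_def]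
  note D' = diag_block_mat_carrier_index[of "Suc p" "\<lambda>i. transpose_mat (R i i)" h b, OF Rc(2), folded D'_def]
  have Wc: "wronskian_block mons k i j \<in> carrier_mat (h i) (h j)" for i j by (simp add: wronskian_block_def h_def)
  have W: "W \<in> carrier_mat (offset h (Suc p)) (offset h (Suc p))"
    "\<And>i s j t. i < Suc p \<Longrightarrow> s < h i \<Longrightarrow> j < Suc p \<Longrightarrow> t < h j \<Longrightarrow> W $$ (offset h i + s, offset h j + t) = wronskian_block mons k i j $$ (s, t)"
    unfolding W_def wronskian_le_def h_def[symmetric] using Wc by (auto intro!: block_matrix_carrier block_matrix_index simp del: sum.lessThan_Suc)
  have H: "H_matrix mons k p R = D * W * D'" by (simp add: H_matrix_def D_def W_def D'_def)
  have DW: "D * W \<in> carrier_mat (offset b (Suc p)) (offset h (Suc p))" using D(1) W(1) by (rule mult_carrier_mat)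
  show "H_matrix mons k p R \<in> carrier_mat (offset b (Suc p)) (offset b (Suc p))"
    unfolding H using DW D'(1) by (rule mult_carrier_mat)
  assume i: "i \<le> p" "a < b i" and j: "j \<le> p" "c < b j"
  have ai: "offset b i + a < offset b (Suc p)" and cj: "offset b j + c < offset b (Suc p)"
    using i j by (auto intro!: offset_less simp del: sum.lessThan_Suc)
  have 1: "(D * W) $$ (offset b i + a, offset h j + t) = (\<Sum>s<h i. R i i $$ (a, s) * wronskian_block mons k i j $$ (s, t))"
    if j: "j < Suc p" "t < h j" for j t
  proof -
    have "offset h j + t < offset h (Suc p)" using that by (intro offset_less)
    then have "(D * W) $$ (offset b i + a, offset h j + t) =
        (\<Sum>l<offset h (Suc p). D $$ (offset b i + a, l) * W $$ (l, offset h j + t))"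
      by (intro mat_mult_index[OF D(1) W(1) ai])
    also have "\<dots> = (\<Sum>l<Suc p. \<Sum>s<h l. D $$ (offset b i + a, offset h l + s) * W $$ (offset h l + s, offset h j + t))"
      by (rule sum_offset)
    also have "\<dots> = (\<Sum>l<Suc p. if i = l then \<Sum>s<h l. R i i $$ (a, s) * wronskian_block mons k l j $$ (s, t) else 0)"
    proof (intro sum.cong refl)
      fix l assume "l \<in> {..<Suc p}"
      then show "(\<Sum>s<h l. D $$ (offset b i + a, offset h l + s) * W $$ (offset h l + s, offset h j + t)) =
        (if i = l then \<Sum>s<h l. R i i $$ (a, s) * wronskian_block mons k l j $$ (s, t) else 0)"
        using D(2)[of i a l] W(2)[of l _ j t] i that by auto
    qed
    also have "\<dots> = (\<Sum>s<h i. R i i $$ (a, s) * wronskian_block mons k i j $$ (s, t))"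
      by (rule sum_delta_lessThan) (use i in simp)
    finally show ?thesis .
  qed
  have "H_matrix mons k p R $$ (offset b i + a, offset b j + c) =
      (\<Sum>l<offset h (Suc p). (D * W) $$ (offset b i + a, l) * D' $$ (l, offset b j + c))"
    unfolding H by (rule mat_mult_index[OF DW D'(1) ai cj])
  also have "\<dots> = (\<Sum>l<Suc p. \<Sum>t<h l. (D * W) $$ (offset b i + a, offset h l + t) * D' $$ (offset h l + t, offset b j + c))"
    by (rule sum_offset)
  also have "\<dots> = (\<Sum>l<Suc p. if l = j then \<Sum>t<h l. \<Sum>s<h i. R i i $$ (a, s) * wronskian_block mons k i l $$ (s, t) * R j j $$ (c, t) else 0)"
  proof (intro sum.cong refl)
    fix l assume l: "l \<in> {..<Suc p}"
    show "(\<Sum>t<h l. (D * W) $$ (offset b i + a, offset h l + t) * D' $$ (offset h l + t, offset b j + c)) =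
      (if l = j then \<Sum>t<h l. \<Sum>s<h i. R i i $$ (a, s) * wronskian_block mons k i l $$ (s, t) * R j j $$ (c, t) else 0)"
      using D'(2)[of l _ j c] 1[of l] l j Rc[of j] by (auto simp: sum_distrib_right)
  qed
  also have "\<dots> = (\<Sum>t<h j. \<Sum>s<h i. R i i $$ (a, s) * wronskian_block mons k i j $$ (s, t) * R j j $$ (c, t))"
    by (rule sum_delta_lessThan) (use j in simp)
  also have "\<dots> = (\<Sum>s<h i. \<Sum>t<h j. R i i $$ (a, s) * wronskian_block mons k i j $$ (s, t) * R j j $$ (c, t))"
    by (rule sum.swap)
  finally show "H_matrix mons k p R $$ (offset b i + a, offset b j + c) =
      (\<Sum>s<length (mons i). \<Sum>t<length (mons j). R i i $$ (a, s) * wronskian_block mons k i j $$ (s, t) * R j j $$ (c, t))"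
    by (simp add: h_def)
qed

lemma sum_nth_set: "distinct xs \<Longrightarrow> (\<Sum>i<length xs. F (xs ! i)) = (\<Sum>s\<in>set xs. F s)"
  by (rule sum.reindex_bij_betw[OF bij_betw_nth]) auto

text \<open>Definiteness speaks of distinct points, whereas scaled nodes may coincide, for instance
  at \<epsilon> = 0. Coefficients of equal points are added up. They may cancel, so only
  nonnegativity survives.\<close>

lemma positive_definite_kernel_form_nonneg:
  fixes z :: "nat \<Rightarrow> 'v" and y :: "nat \<Rightarrow> real"
  assumes "positive_definite_kernel k"
  shows "0 \<le> (\<Sum>a<n. \<Sum>b<n. y a * y b * k (z a) (z b))"
proof -
  obtain ys where ys: "set ys = z ` {..<n}" "distinct ys"
    using finite_distinct_list[of "z ` {..<n}"] by auto
  define N where "N = length ys"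
  define C where "C s = (\<Sum>a\<in>{a \<in> {..<n}. z a = s}. y a)" for s
  have group: "(\<Sum>a<n. y a * g (z a)) = (\<Sum>i<N. C (ys ! i) * g (ys ! i))" for g
  proof -
    have "(\<Sum>a<n. y a * g (z a)) = (\<Sum>s\<in>z ` {..<n}. \<Sum>a\<in>{a \<in> {..<n}. z a = s}. y a * g (z a))"
      by (rule sum.image_gen) simp
    also have "\<dots> = (\<Sum>s\<in>set ys. C s * g s)"
      unfolding ys C_def sum_distrib_right by (intro sum.cong refl) auto
    finally show ?thesis unfolding N_def sum_nth_set[OF ys(2), of "\<lambda>s. C s * g s"] .
  qed
  define A where "A = mat N N (\<lambda>(i, j). k (ys ! i) (ys ! j))"
  define v where "v = vec N (\<lambda>i. C (ys ! i))"
  have "positive_definite_mat A"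
    using assms ys(2) by (auto simp: positive_definite_kernel_def A_def N_def)
  then have "v \<noteq> 0\<^sub>v N \<Longrightarrow> scalar_prod v (A *\<^sub>v v) > 0"
    by (auto simp: positive_definite_mat_def A_def v_def)
  moreover have "scalar_prod v (A *\<^sub>v v) = 0" if "v = 0\<^sub>v N"
    unfolding that by (simp add: A_def scalar_prod_def)
  ultimately have "0 \<le> scalar_prod v (A *\<^sub>v v)" by fastforce
  also have "scalar_prod v (A *\<^sub>v v) = (\<Sum>i<N. C (ys ! i) * (\<Sum>j<N. C (ys ! j) * k (ys ! i) (ys ! j)))"
    by (simp add: v_def A_def scalar_prod_def atLeast0LessThan mult.commute)
  also have "\<dots> = (\<Sum>i<N. C (ys ! i) * (\<Sum>b<n. y b * k (ys ! i) (z b)))"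
    by (simp only: group)
  also have "\<dots> = (\<Sum>a<n. y a * (\<Sum>b<n. y b * k (z a) (z b)))"
    by (rule group[symmetric])
  finally show ?thesis by (simp add: sum_distrib_left mult.assoc)
qed

lemma has_fps_expansion_scale:
  fixes f :: "real \<Rightarrow> real"
  assumes f: "f has_fps_expansion F"
  shows "(\<lambda>x. f (x * c)) has_fps_expansion Abs_fps (\<lambda>n. fps_nth F n * c ^ n)"
\<comment> \<open>The factor 0 occurs on the diagonal of a radial kernel matrix. It is separated
  because the radius of convergence is divided by |c|.\<close>
proof (cases "c = 0")
  case True
  then have "Abs_fps (\<lambda>n. fps_nth F n * c ^ n) = fps_const (f 0)"
    by (auto simp: fps_eq_iff has_fps_expansion_nth_0[OF f] power_0_left)
  then show ?thesis using True by simp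
next
  case False
  have "conv_radius (\<lambda>n. fps_nth F n * c ^ n) = conv_radius (fps_nth F) / ereal (norm c)"
    by (rule conv_radius_mult_power_right[OF False])
  moreover have "conv_radius (fps_nth F) > 0" using f by (simp add: has_fps_expansion_def fps_conv_radius_def)
  ultimately have "fps_conv_radius (Abs_fps (\<lambda>n. fps_nth F n * c ^ n)) > 0"
    using False by (simp add: fps_conv_radius_def ereal_zero_less_0_iff divide_ereal_def)
  moreover have "\<forall>\<^sub>F x in nhds 0. eval_fps (Abs_fps (\<lambda>n. fps_nth F n * c ^ n)) x = f (x * c)"
  proof -
    have "filterlim (\<lambda>x. x * c) (nhds (0 * c)) (nhds 0)" by (intro tendsto_intros filterlim_ident)
    then have "filterlim (\<lambda>x. x * c) (nhds 0) (nhds 0)" by simp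
    moreover have "\<forall>\<^sub>F x in nhds 0. eval_fps F x = f x" using f by (simp add: has_fps_expansion_def)
    ultimately have "\<forall>\<^sub>F x in nhds 0. eval_fps F (x * c) = f (x * c)"
      by (rule eventually_compose_filterlim[rotated])
    then show ?thesis
      by eventually_elim (simp add: eval_fps_def power_mult_distrib mult_ac)
  qed
  ultimately show ?thesis by (simp add: has_fps_expansion_def)
qed

text \<open>The matrix of Taylor series is diagonalised over convergent power series, and the series
  are then evaluated. An identity between series becomes an identity between functions near 0, which
  is all that an analytic eigensystem demands.\<close>

lemma analytic_eigensystem_exists:
  assumes carrier: "\<And>\<epsilon>. K \<epsilon> \<in> carrier_mat n n"
    and sym: "\<And>\<epsilon> a b. a < n \<Longrightarrow> b < n \<Longrightarrow> K \<epsilon> $$ (a, b) = K \<epsilon> $$ (b, a)"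
    and analytic: "analytic_matrix_at_0 n K"
  shows "\<exists>ev u. analytic_eigensystem n K ev u"
proof -
  have "\<exists>F. a < n \<longrightarrow> b < n \<longrightarrow> (\<lambda>\<epsilon>. K \<epsilon> $$ (a, b)) has_fps_expansion F" for a b
    using analytic by (auto simp: analytic_matrix_at_0_def analytic_at_0_def)
  then obtain F where F: "\<And>a b. a < n \<Longrightarrow> b < n \<Longrightarrow> (\<lambda>\<epsilon>. K \<epsilon> $$ (a, b)) has_fps_expansion F a b"
    by metis
  have Fsym: "F a b = F b a" if "a < n" "b < n" for a b
    by (rule has_fps_expansion_unique_real[OF F[OF that]]) (use F[OF that(2,1)] sym[OF that] in simp)
  have "conv_fps.diagonalizable_on {..<n} F"
  proof (rule rellich_on)
    show "F i j = F j i" if "i \<in> {..<n}" "j \<in> {..<n}" for i j using Fsym that by simp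
    show "fps_conv_radius (F i j) > 0" if "i \<in> {..<n}" "j \<in> {..<n}" for i j
      using F[of i j] that by (simp add: has_fps_expansion_def)
  qed simp
  then obtain U where U: "orthogonal_on {..<n} U" "\<And>i j. i < n \<Longrightarrow> j < n \<Longrightarrow> fps_conv_radius (U i j) > 0"
    "\<And>i j. i < n \<Longrightarrow> j < n \<Longrightarrow> i \<noteq> j \<Longrightarrow> congruence_on {..<n} U F i j = 0"
    by (auto simp: conv_fps.diagonalizable_on_def)
  define \<Lambda> where "\<Lambda> k = congruence_on {..<n} U F k k" for k
  have FU: "(\<Sum>b<n. F a b * U b k) = \<Lambda> k * U a k" if "a < n" "k < n" for a k
    unfolding \<Lambda>_def by (rule congruence_on_diagonal_eigenvector) (use U that in auto)
  have \<Lambda>conv: "fps_conv_radius (\<Lambda> k) > 0" if "k < n" for k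
    unfolding \<Lambda>_def using F U(2) that by (intro conv_fps.P_congruence_on) (auto simp: has_fps_expansion_def)
  define u where "u k \<epsilon> = vec n (\<lambda>a. eval_fps (U a k) \<epsilon>)" for k \<epsilon>
  define ev where "ev k = eval_fps (\<Lambda> k)" for k
  have u: "(\<lambda>\<epsilon>. u k \<epsilon> $ a) has_fps_expansion U a k" if "a < n" "k < n" for a k
    using eval_fps_has_fps_expansion[OF U(2)[OF that]] that by (simp add: u_def)
  have ev: "ev k has_fps_expansion \<Lambda> k" if "k < n" for k
    unfolding ev_def by (rule eval_fps_has_fps_expansion[OF \<Lambda>conv[OF that]])
  have eigen: "\<forall>\<^sub>F \<epsilon> in nhds 0. (\<Sum>b<n. K \<epsilon> $$ (a, b) * u k \<epsilon> $ b) = ev k \<epsilon> * u k \<epsilon> $ a" if "a < n" "k < n" for a k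
  proof (rule has_fps_expansion_eventually_eq)
    show "(\<lambda>\<epsilon>. \<Sum>b<n. K \<epsilon> $$ (a, b) * u k \<epsilon> $ b) has_fps_expansion (\<Sum>b<n. F a b * U b k)"
      using that F u by (intro has_fps_expansion_sum has_fps_expansion_mult) auto
    show "(\<lambda>\<epsilon>. ev k \<epsilon> * u k \<epsilon> $ a) has_fps_expansion (\<Sum>b<n. F a b * U b k)"
      unfolding FU[OF that] using that u ev by (intro has_fps_expansion_mult) auto
  qed
  have orth: "\<forall>\<^sub>F \<epsilon> in nhds 0. (\<Sum>a<n. u k \<epsilon> $ a * u l \<epsilon> $ a) = (if k = l then 1 else 0)" if "k < n" "l < n" for k l
  proof (rule has_fps_expansion_eventually_eq)
    show "(\<lambda>\<epsilon>. \<Sum>a<n. u k \<epsilon> $ a * u l \<epsilon> $ a) has_fps_expansion (\<Sum>a<n. U a k * U a l)"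
      using that u by (intro has_fps_expansion_sum has_fps_expansion_mult) auto
    have "(\<Sum>a<n. U a k * U a l) = (if k = l then 1 else 0)"
      using U(1) that by (auto simp: orthogonal_on_def)
    then show "(\<lambda>\<epsilon>. if k = l then 1 else 0) has_fps_expansion (\<Sum>a<n. U a k * U a l)" by simp
  qed
  have "\<forall>\<^sub>F \<epsilon> in nhds 0. \<forall>a\<in>{..<n}. \<forall>k\<in>{..<n}. (\<Sum>b<n. K \<epsilon> $$ (a, b) * u k \<epsilon> $ b) = ev k \<epsilon> * u k \<epsilon> $ a"
    using eigen by (intro eventually_ball_finite ballI) auto
  moreover have "\<forall>\<^sub>F \<epsilon> in nhds 0. \<forall>k\<in>{..<n}. \<forall>l\<in>{..<n}. (\<Sum>a<n. u k \<epsilon> $ a * u l \<epsilon> $ a) = (if k = l then 1 else 0)"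
    using orth by (intro eventually_ball_finite ballI) auto
  ultimately have "\<forall>\<^sub>F \<epsilon> in nhds 0. (\<forall>k<n. K \<epsilon> *\<^sub>v u k \<epsilon> = ev k \<epsilon> \<cdot>\<^sub>v u k \<epsilon>) \<and>
      (\<forall>k<n. \<forall>l<n. scalar_prod (u k \<epsilon>) (u l \<epsilon>) = (if k = l then 1 else 0))"
  proof eventually_elim
    case (elim \<epsilon>)
    have dims: "dim_row (K \<epsilon>) = n" "dim_col (K \<epsilon>) = n" "dim_vec (u k \<epsilon>) = n" for k
      using carrier[of \<epsilon>] by (auto simp: u_def)
    have "K \<epsilon> *\<^sub>v u k \<epsilon> = ev k \<epsilon> \<cdot>\<^sub>v u k \<epsilon>" if "k < n" for k
      using elim(1) that by (intro eq_vecI) (auto simp: dims scalar_prod_def atLeast0LessThan)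
    moreover have "scalar_prod (u k \<epsilon>) (u l \<epsilon>) = (if k = l then 1 else 0)" if "k < n" "l < n" for k l
      using elim(2) that by (simp add: dims scalar_prod_def atLeast0LessThan)
    ultimately show ?case by blast
  qed
  then have "analytic_eigensystem n K ev u"
    unfolding analytic_eigensystem_def analytic_at_0_def using u ev by (auto simp: u_def)
  then show ?thesis by blast
qed

text \<open>Q^T V = R in terms of entries: a column of Q paired with a monomial at the nodes gives
  an entry of R. Block triangularity of R thereby becomes the vanishing of low moments. The first
  fact compares two counts of the columns of Q.\<close>

lemma block_QR_facts:
  assumes QR: "block_QR mons n x p Q R"
  defines "b \<equiv> rank_jump mons n x" and "h \<equiv> \<lambda>j. length (mons j)" and "q \<equiv> \<lambda>a A. hcat n (map Q [0..<Suc p]) $$ (a, A)"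
  shows "n = offset b (Suc p)" "orthogonal_on {..<n} q"
    "\<And>i c a. i \<le> p \<Longrightarrow> c < b i \<Longrightarrow> a < n \<Longrightarrow> q a (offset b i + c) = Q i $$ (a, c)"
    "\<And>i c s t. i \<le> p \<Longrightarrow> c < b i \<Longrightarrow> s \<le> p \<Longrightarrow> t < h s \<Longrightarrow>
      (\<Sum>a<n. q a (offset b i + c) * monomial (mons s ! t) (x a)) = R i s $$ (c, t)"
proof -
  define Qf where "Qf = hcat n (map Q [0..<Suc p])"
  define Rf where "Rf = block_matrix (Suc p) b h R"
  define V where "V = vandermonde_le mons n x p"
  have Q: "\<And>i. i < Suc p \<Longrightarrow> Q i \<in> carrier_mat n (b i)" and Qf: "Qf \<in> carrier_mat n n" "transpose_mat Qf * Qf = 1\<^sub>m n"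
    and R: "\<And>i j. i < Suc p \<Longrightarrow> j < Suc p \<Longrightarrow> R i j \<in> carrier_mat (b i) (h j)" and V: "V = Qf * Rf"
    using QR unfolding block_QR_def Let_def b_def[symmetric] h_def[symmetric] Qf_def[symmetric] Rf_def[symmetric] V_def[symmetric]
    by auto
  have "Qf \<in> carrier_mat n (offset b (Suc p))" unfolding Qf_def by (rule hcat_carrier[OF Q])
  with Qf(1) show n: "n = offset b (Suc p)" unfolding carrier_mat_def by (simp del: sum.lessThan_Suc)
  have qq: "(\<Sum>a<n. q a A * q a B) = (if A = B then 1 else 0)" if "A < n" "B < n" for A B
  proof -
    have "(\<Sum>a<n. q a A * q a B) = (transpose_mat Qf * Qf) $$ (A, B)"
      using Qf(1) that by (simp add: scalar_prod_def atLeast0LessThan q_def Qf_def)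
    then show ?thesis using that by (simp add: Qf(2))
  qed
  then show orth: "orthogonal_on {..<n} q" by (intro orthogonal_onI) auto
  show "q a (offset b i + c) = Q i $$ (a, c)" if "i \<le> p" "c < b i" "a < n" for i c a
    unfolding q_def using Q that by (intro hcat_index) auto
  fix i c s t assume i: "i \<le> p" "c < b i" and s: "s \<le> p" "t < h s"
  have ic: "offset b i + c < n" unfolding n using i by (intro offset_less) auto
  have st: "offset h s + t < offset h (Suc p)" using s by (intro offset_less) auto
  have Rf: "Rf \<in> carrier_mat n (offset h (Suc p))"
    unfolding Rf_def using block_matrix_carrier[of "Suc p" R b h, OF R] unfolding n .
  have vand: "vandermonde mons n x i \<in> carrier_mat n (h i)" for i by (simp add: vandermonde_def h_def)
  have Vx: "V $$ (a, offset h s + t) = monomial (mons s ! t) (x a)" if "a < n" for a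
  proof -
    have "V $$ (a, offset h s + t) = vandermonde mons n x s $$ (a, t)"
      unfolding V_def vandermonde_lt_def using vand s that by (intro hcat_index) auto
    then show ?thesis using that s by (simp add: vandermonde_def h_def)
  qed
  have "(\<Sum>a<n. q a (offset b i + c) * monomial (mons s ! t) (x a)) =
      (\<Sum>a<n. q a (offset b i + c) * (\<Sum>C<n. q a C * Rf $$ (C, offset h s + t)))"
  proof (intro sum.cong refl)
    fix a assume "a \<in> {..<n}"
    then have "V $$ (a, offset h s + t) = (\<Sum>C<n. q a C * Rf $$ (C, offset h s + t))"
      unfolding V q_def Qf_def[symmetric] by (intro mat_mult_index[OF Qf(1) Rf _ st]) simp
    then show "q a (offset b i + c) * monomial (mons s ! t) (x a) =
        q a (offset b i + c) * (\<Sum>C<n. q a C * Rf $$ (C, offset h s + t))"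
      using Vx[of a] \<open>a \<in> {..<n}\<close> by simp
  qed
  also have "\<dots> = (\<Sum>C<n. (\<Sum>a<n. q a (offset b i + c) * q a C) * Rf $$ (C, offset h s + t))"
    unfolding sum_distrib_left sum_distrib_right mult.assoc by (rule sum.swap)
  also have "\<dots> = (\<Sum>C<n. (if offset b i + c = C then 1 else 0) * Rf $$ (C, offset h s + t))"
    using qq[OF ic] by (intro sum.cong refl) auto
  also have "\<dots> = Rf $$ (offset b i + c, offset h s + t)"
    by (rule sum_delta_mult(1)) (use ic in auto)
  also have "\<dots> = R i s $$ (c, t)"
    unfolding Rf_def using R i s by (intro block_matrix_index) auto
  finally show "(\<Sum>a<n. q a (offset b i + c) * monomial (mons s ! t) (x a)) = R i s $$ (c, t)" .
qed

lemma block_of_less_iff: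
  assumes "a < offset b m"
  shows "block_of b a < i \<longleftrightarrow> a < offset b i"
proof -
  obtain j c where j: "j < m" "c < b j" "a = offset b j + c" using offset_cases[OF assms] by blast
  have "block_of b a = j" using block_of_offset[of c b j] j by simp
  moreover have "a < offset b i" if "j < i"
    unfolding j(3) using that j(2) by (rule offset_less)
  moreover have "\<not> a < offset b i" if "\<not> j < i"
    using offset_mono[of i j b] that j(3) by simp
  ultimately show ?thesis by auto
qed

lemma H_matrix_limit:
  fixes x :: "nat \<Rightarrow> real ^ 'd::finite"
  assumes QR: "block_QR mons n x p Q R" and mons: "monomial_ordering mons" and k: "C_class p k"
  defines "b \<equiv> rank_jump mons n x" and "q \<equiv> \<lambda>a A. hcat n (map Q [0..<Suc p]) $$ (a, A)"
  assumes AB: "A < n" "B < n"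
  shows "((\<lambda>\<epsilon>. (\<Sum>a<n. \<Sum>a'<n. q a A * q a' B * k (\<epsilon> *\<^sub>R x a) (\<epsilon> *\<^sub>R x a')) / \<epsilon> ^ (block_of b A + block_of b B))
    \<longlongrightarrow> H_matrix mons k p R $$ (A, B)) (at_right 0)"
proof -
  have q: "hcat n (map Q [0..<Suc p]) $$ (a, A) = q a A" for a A by (simp only: q_def)
  note facts = block_QR_facts[OF QR, folded b_def, unfolded q]
  have Rc: "\<And>i j. i \<le> p \<Longrightarrow> j \<le> p \<Longrightarrow> R i j \<in> carrier_mat (b i) (length (mons j))"
    and R0: "\<And>i j. i \<le> p \<Longrightarrow> j < i \<Longrightarrow> R i j = 0\<^sub>m (b i) (length (mons j))"
    using QR unfolding block_QR_def Let_def b_def[symmetric] by auto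
  have setm: "set (mons s) = {\<mu>. mi_degree \<mu> = s}" "distinct (mons s)" for s
    using mons by (auto simp: monomial_ordering_def)
  obtain i \<alpha> where A: "i < Suc p" "\<alpha> < b i" "A = offset b i + \<alpha>"
    using AB(1) unfolding facts(1) by (rule offset_cases)
  obtain j \<beta> where B: "j < Suc p" "\<beta> < b j" "B = offset b j + \<beta>"
    using AB(2) unfolding facts(1) by (rule offset_cases)
  have blocks: "block_of b A = i" "block_of b B = j"
    using A B block_of_offset[of \<alpha> b i] block_of_offset[of \<beta> b j] by auto
  \<comment> \<open>This is R_{i,s} = 0 for s < i: the columns of Q_i annihilate all monomials of
    degree s.\<close>
  have kill: "(\<Sum>a<n. q a (offset b i + c) * monomial \<mu> (x a)) = 0"
    if "i < Suc p" "c < b i" "mi_degree \<mu> < i" for i c \<mu>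
  proof -
    define s where "s = mi_degree \<mu>"
    have "\<mu> \<in> set (mons s)" by (simp add: setm s_def)
    then obtain t where t: "t < length (mons s)" "\<mu> = mons s ! t" by (auto simp: in_set_conv_nth)
    have "(\<Sum>a<n. q a (offset b i + c) * monomial \<mu> (x a)) = R i s $$ (c, t)"
      unfolding t(2) using that t(1) by (intro facts(4)) (auto simp: s_def)
    then show ?thesis using R0[of i s] that t(1) by (simp add: s_def)
  qed
  have "((\<lambda>\<epsilon>. (\<Sum>a<n. \<Sum>a'<n. q a A * q a' B * k (\<epsilon> *\<^sub>R x a) (\<epsilon> *\<^sub>R x a')) / \<epsilon> ^ (i + j)) \<longlongrightarrow>
     (\<Sum>\<mu> | mi_degree \<mu> = i. \<Sum>\<nu> | mi_degree \<nu> = j. (\<Sum>a<n. q a A * monomial \<mu> (x a)) *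
        (mixed_partial \<mu> \<nu> k 0 0 / (mi_fact \<mu> * mi_fact \<nu>)) * (\<Sum>a<n. q a B * monomial \<nu> (x a)))) (at_right 0)"
    using A B kill by (intro kernel_form_limit_mi[OF k]) auto
  also have "(\<Sum>\<mu> | mi_degree \<mu> = i. \<Sum>\<nu> | mi_degree \<nu> = j. (\<Sum>a<n. q a A * monomial \<mu> (x a)) *
        (mixed_partial \<mu> \<nu> k 0 0 / (mi_fact \<mu> * mi_fact \<nu>)) * (\<Sum>a<n. q a B * monomial \<nu> (x a))) =
      (\<Sum>s<length (mons i). \<Sum>t<length (mons j). R i i $$ (\<alpha>, s) * wronskian_block mons k i j $$ (s, t) * R j j $$ (\<beta>, t))"
    unfolding setm(1)[symmetric] sum_nth_set[OF setm(2), symmetric]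
  proof (intro sum.cong refl)
    fix s t assume s: "s \<in> {..<length (mons i)}" and t: "t \<in> {..<length (mons j)}"
    have "(\<Sum>a<n. q a A * monomial (mons i ! s) (x a)) = R i i $$ (\<alpha>, s)"
      unfolding A(3) using A s by (intro facts(4)) auto
    moreover have "(\<Sum>a<n. q a B * monomial (mons j ! t) (x a)) = R j j $$ (\<beta>, t)"
      unfolding B(3) using B t by (intro facts(4)) auto
    ultimately show "(\<Sum>a<n. q a A * monomial (mons i ! s) (x a)) *
        (mixed_partial (mons i ! s) (mons j ! t) k 0 0 / (mi_fact (mons i ! s) * mi_fact (mons j ! t))) *
        (\<Sum>a<n. q a B * monomial (mons j ! t) (x a)) =
        R i i $$ (\<alpha>, s) * wronskian_block mons k i j $$ (s, t) * R j j $$ (\<beta>, t)"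
      using s t by (simp add: wronskian_block_def)
  qed
  also have "\<dots> = H_matrix mons k p R $$ (A, B)"
    unfolding A(3) B(3) using A B Rc by (intro H_matrix_carrier_index(2)[symmetric]) auto
  finally show ?thesis unfolding blocks .
qed

section \<open>Schur complements by row elimination\<close>

lemma schur_complement_carrier: "schur_complement b H i \<in> carrier_mat (b i) (b i)"
proof (cases "i = 0")
  case True
  then show ?thesis by (simp add: schur_complement_def submatrix_at_def)
next
  case False
  show ?thesis
    unfolding schur_complement_def if_not_P[OF False] Let_def
    by (rule carrier_matI) (simp_all only: index_minus_mat index_mult_mat index_transpose_mat submatrix_at_def dim_row_mat dim_col_mat)
qed

text \<open>The coefficients p form a row of - H_{i,<i} (H_{<i,<i})^{-1}. Adding the corresponding
  combination of the earlier rows clears the earlier columns and leaves a row of S_i in block i. The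
  leading block is invertible because coercivity passes to vectors supported on the first
  indices.\<close>

lemma schur_complement_row:
  assumes H: "H \<in> carrier_mat n n" and n: "n = offset b m"
    and sym: "\<And>a c. a < n \<Longrightarrow> c < n \<Longrightarrow> H $$ (a, c) = H $$ (c, a)"
    and c: "c > 0" and coercive: "\<And>x. c * (\<Sum>a<n. (x a)\<^sup>2) \<le> (\<Sum>a<n. \<Sum>b<n. x a * H $$ (a, b) * x b)"
    and i: "i < m" "\<alpha> < b i"
  shows "\<exists>p. (\<forall>B<offset b i. H $$ (offset b i + \<alpha>, B) + (\<Sum>r<offset b i. p r * H $$ (r, B)) = 0) \<and>
    (\<forall>\<beta><b i. schur_complement b H i $$ (\<alpha>, \<beta>) =
       H $$ (offset b i + \<alpha>, offset b i + \<beta>) + (\<Sum>r<offset b i. p r * H $$ (r, offset b i + \<beta>)))"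
proof (cases "i = 0")
  case True
  \<comment> \<open>No rows precede the first block, and its Schur complement is the block
    itself.\<close>
  then show ?thesis using i by (intro exI[of _ "\<lambda>_. 0"]) (simp add: schur_complement_def submatrix_at_def)
next
  case False
  define l where "l = offset b i"
  define L where "L = submatrix_at H 0 l 0 l"
  have ln: "l + b i \<le> n" unfolding l_def n using offset_mono[of "Suc i" m b] i by simp
  have L: "L \<in> carrier_mat l l" by (simp add: L_def submatrix_at_def)
  have Lx: "L $$ (r, e) = H $$ (r, e)" if "r < l" "e < l" for r e using that by (simp add: L_def submatrix_at_def)
  have "det L \<noteq> 0"
  proof
    assume "det L = 0"
    then obtain v where v: "v \<in> carrier_vec l" "v \<noteq> 0\<^sub>v l" "L *\<^sub>v v = 0\<^sub>v l"
      using det_0_iff_vec_prod_zero_field[OF L] by blast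
    \<comment> \<open>A kernel vector of the leading block, extended by zero, would make the
      coercive form of H vanish.\<close>
    define x where "x a = (if a < l then v $ a else 0)" for a
    have row: "(\<Sum>e<l. H $$ (r, e) * v $ e) = 0" if "r < l" for r
    proof -
      have "(L *\<^sub>v v) $ r = (\<Sum>e<l. L $$ (r, e) * v $ e)"
        using that L v(1) by (simp add: scalar_prod_def atLeast0LessThan)
      then show ?thesis using that by (simp add: v(3) Lx)
    qed
    have restrict: "(\<Sum>a<n. (if a < l then f a else 0)) = (\<Sum>a<l. f a)" for f :: "nat \<Rightarrow> real"
    proof -
      have "{..<n} \<inter> {a. a < l} = {..<l}" using ln by auto
      then show ?thesis by (simp add: sum.If_cases)
    qed
    have "(\<Sum>a<n. \<Sum>e<n. x a * H $$ (a, e) * x e) = (\<Sum>a<n. if a < l then v $ a * (\<Sum>e<l. H $$ (a, e) * v $ e) else 0)"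
    proof (intro sum.cong refl)
      fix a
      have "(\<Sum>e<n. x a * H $$ (a, e) * x e) = (\<Sum>e<n. if e < l then x a * H $$ (a, e) * v $ e else 0)"
        by (intro sum.cong refl) (simp add: x_def)
      also have "\<dots> = (\<Sum>e<l. x a * H $$ (a, e) * v $ e)" by (rule restrict)
      finally show "(\<Sum>e<n. x a * H $$ (a, e) * x e) = (if a < l then v $ a * (\<Sum>e<l. H $$ (a, e) * v $ e) else 0)"
        by (simp add: x_def sum_distrib_left mult.assoc)
    qed
    also have "\<dots> = 0" unfolding restrict by (simp add: row)
    finally have "c * (\<Sum>a<n. (x a)\<^sup>2) \<le> 0" using coercive[of x] by simp
    then have "(\<Sum>a<n. (x a)\<^sup>2) \<le> 0" using c by (simp add: mult_le_0_iff)
    moreover have "(\<Sum>a<n. (x a)\<^sup>2) \<ge> 0" by (intro sum_nonneg) auto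
    ultimately have "(\<Sum>a<n. (x a)\<^sup>2) = 0" by simp
    then have "\<forall>a\<in>{..<n}. (x a)\<^sup>2 = 0" by (subst (asm) sum_nonneg_eq_0_iff) auto
    then have "x a = 0" if "a < n" for a using that by simp
    then have "v $ a = 0" if "a < l" for a using that ln by (metis add_leD1 less_le_trans x_def)
    then have "v = 0\<^sub>v l" using v(1) by (intro eq_vecI) auto
    then show False using v(2) by simp
  qed
  then obtain G where G: "mat_inverse L = Some G"
    using mat_inverse(1)[OF L, of "()"] det_non_zero_imp_unit[OF L, of "()"] by (cases "mat_inverse L") auto
  then have GL: "G * L = 1\<^sub>m l" and Gc: "G \<in> carrier_mat l l" using mat_inverse(2)[OF L G] by auto
  define A where "A = l + \<alpha>"
  have An: "A < n" using ln i by (simp add: A_def)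
  define p where "p r = - (\<Sum>e<l. H $$ (A, e) * G $$ (e, r))" for r
  have psum: "(\<Sum>r<l. p r * H $$ (r, B)) = - (\<Sum>r<l. (\<Sum>e<l. H $$ (A, e) * G $$ (e, r)) * H $$ (r, B))" for B
    by (simp add: p_def sum_negf)
  have "H $$ (A, B) + (\<Sum>r<l. p r * H $$ (r, B)) = 0" if B: "B < l" for B
  proof -
    have "(\<Sum>r<l. (\<Sum>e<l. H $$ (A, e) * G $$ (e, r)) * H $$ (r, B)) = (\<Sum>e<l. H $$ (A, e) * (\<Sum>r<l. G $$ (e, r) * L $$ (r, B)))"
      unfolding sum_distrib_left sum_distrib_right by (rule trans[OF sum.swap]) (simp add: Lx B mult.assoc)
    also have "\<dots> = (\<Sum>e<l. H $$ (A, e) * (if e = B then 1 else 0))"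
    proof (intro sum.cong refl)
      fix e assume "e \<in> {..<l}"
      then have "(\<Sum>r<l. G $$ (e, r) * L $$ (r, B)) = (G * L) $$ (e, B)"
        using B by (intro mat_mult_index[OF Gc L, symmetric]) auto
      then show "H $$ (A, e) * (\<Sum>r<l. G $$ (e, r) * L $$ (r, B)) = H $$ (A, e) * (if e = B then 1 else 0)"
        using GL B \<open>e \<in> {..<l}\<close> by simp
    qed
    also have "\<dots> = H $$ (A, B)" by (rule sum_delta_mult(4)) (use B in auto)
    finally show ?thesis unfolding psum by simp
  qed
  moreover have "schur_complement b H i $$ (\<alpha>, \<beta>) = H $$ (A, l + \<beta>) + (\<Sum>r<l. p r * H $$ (r, l + \<beta>))" if \<beta>: "\<beta> < b i" for \<beta>
  proof -
    define C where "C = submatrix_at H l (b i) 0 l"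
    have C: "C \<in> carrier_mat (b i) l" "\<And>r e. r < b i \<Longrightarrow> e < l \<Longrightarrow> C $$ (r, e) = H $$ (l + r, e)"
      by (auto simp: C_def submatrix_at_def)
    have "schur_complement b H i = submatrix_at H l (b i) l (b i) - C * G * transpose_mat C"
      using False G by (simp add: schur_complement_def Let_def l_def[symmetric] L_def[symmetric] C_def[symmetric])
    moreover have "submatrix_at H l (b i) l (b i) $$ (\<alpha>, \<beta>) = H $$ (A, l + \<beta>)"
      using i \<beta> by (simp add: submatrix_at_def A_def)
    moreover have "dim_row (C * G * transpose_mat C) = b i" "dim_col (C * G * transpose_mat C) = b i" using C(1) by auto
    ultimately have "schur_complement b H i $$ (\<alpha>, \<beta>) = H $$ (A, l + \<beta>) - (C * G * transpose_mat C) $$ (\<alpha>, \<beta>)"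
      using i \<beta> by (simp add: index_minus_mat(1) del: index_mult_mat)
    also have "(C * G * transpose_mat C) $$ (\<alpha>, \<beta>) = (\<Sum>r<l. (C * G) $$ (\<alpha>, r) * transpose_mat C $$ (r, \<beta>))"
      using C(1) Gc i \<beta> by (intro mat_mult_index) auto
    also have "\<dots> = (\<Sum>r<l. (\<Sum>e<l. H $$ (A, e) * G $$ (e, r)) * H $$ (r, l + \<beta>))"
    proof (intro sum.cong refl)
      fix r assume r: "r \<in> {..<l}"
      have "(C * G) $$ (\<alpha>, r) = (\<Sum>e<l. C $$ (\<alpha>, e) * G $$ (e, r))"
        using r i by (intro mat_mult_index[OF C(1) Gc]) auto
      moreover have "transpose_mat C $$ (r, \<beta>) = H $$ (l + \<beta>, r)" using C r \<beta> by auto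
      \<comment> \<open>The Schur complement is formed with the transpose of H_{i,<i}; symmetry
        identifies it with H_{<i,i}.\<close>
      moreover have "H $$ (l + \<beta>, r) = H $$ (r, l + \<beta>)" using r \<beta> ln by (intro sym) auto
      ultimately show "(C * G) $$ (\<alpha>, r) * transpose_mat C $$ (r, \<beta>) = (\<Sum>e<l. H $$ (A, e) * G $$ (e, r)) * H $$ (r, l + \<beta>)"
        using C(2) i by (simp add: A_def)
    qed
    finally show ?thesis unfolding psum by simp
  qed
  ultimately show ?thesis unfolding A_def l_def by blast
qed

theorem theorem6p12:
  fixes mons :: "nat \<Rightarrow> ('d::finite \<Rightarrow> nat) list"
    and n p :: nat
    and x :: "nat \<Rightarrow> real ^ 'd"
    and k :: "real ^ 'd \<Rightarrow> real ^ 'd \<Rightarrow> real"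
    and K :: "real \<Rightarrow> real mat"
    and Q :: "nat \<Rightarrow> real mat"
    and R :: "nat \<Rightarrow> nat \<Rightarrow> real mat"
  assumes "n \<ge> 1"
    and "monomial_ordering mons"
    and "vec_space.rank n (vandermonde_le mons n x p) = n"
    and "\<forall>q<p. vec_space.rank n (vandermonde_le mons n x q) \<noteq> n"
    and "positive_definite_kernel k"
    and "(\<exists>\<psi> \<Psi>. (\<forall>y z. k y z = \<psi> (norm (y - z))) \<and> \<psi> has_fps_expansion \<Psi> \<and>
                 regularity_index \<Psi> \<ge> enat (p + 1) \<and> K = radial_kernel_matrix n x \<psi>)
         \<or> (C_class (p + 1) k \<and> K = kernel_matrix n x k \<and> analytic_matrix_at_0 n K)"
    and "block_QR mons n x p Q R"
    and "invertible_mat (H_matrix mons k p R)"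
  shows "is_ASE n K
           (\<lambda>\<epsilon>. matrix_sum n n
                  (\<lambda>i. \<epsilon> ^ (2 * i) \<cdot>\<^sub>m
                       (Q i * schur_complement (rank_jump mons n x) (H_matrix mons k p R) i
                          * transpose_mat (Q i)))
                  {..p})"
proof -
  have ksym: "k y z = k z y" for y z using assms(5) by (simp add: positive_definite_kernel_def)
  \<comment> \<open>From here on both alternatives are treated alike. Agreement with kernel values
    is claimed for \<epsilon> > 0 only, since the radial matrix continues analytically to negative
    \<epsilon> while kernel values depend on |\<epsilon>|.\<close>
  have K: "C_class p k \<and> (\<forall>\<epsilon>. K \<epsilon> \<in> carrier_mat n n) \<and> (\<forall>\<epsilon>. \<forall>a<n. \<forall>b<n. K \<epsilon> $$ (a, b) = K \<epsilon> $$ (b, a)) \<and>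
      analytic_matrix_at_0 n K \<and> (\<forall>\<epsilon>>0. \<forall>a<n. \<forall>b<n. K \<epsilon> $$ (a, b) = k (\<epsilon> *\<^sub>R x a) (\<epsilon> *\<^sub>R x b))"
    using assms(6)
  proof (elim disjE exE conjE)
    fix \<psi> \<Psi> assume r: "\<forall>y z. k y z = \<psi> (norm (y - z))" "\<psi> has_fps_expansion \<Psi>"
      "regularity_index \<Psi> \<ge> enat (p + 1)" "K = radial_kernel_matrix n x \<psi>"
    have "C_class p k"
      using r(1) by (intro radial_C_class[OF _ r(2)] regularity_index_odd_nth[OF r(3)]) auto
    moreover have "analytic_matrix_at_0 n K"
      unfolding analytic_matrix_at_0_def analytic_at_0_def r(4)
      using has_fps_expansion_scale[OF r(2)] by (auto simp: radial_kernel_matrix_def)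
    moreover have "K \<epsilon> $$ (a, b) = k (\<epsilon> *\<^sub>R x a) (\<epsilon> *\<^sub>R x b)" if "\<epsilon> > 0" "a < n" "b < n" for \<epsilon> a b
    proof -
      have "norm (\<epsilon> *\<^sub>R x a - \<epsilon> *\<^sub>R x b) = \<epsilon> * norm (x a - x b)"
        unfolding scaleR_diff_right[symmetric] using that by simp
      then show ?thesis using that r by (simp add: radial_kernel_matrix_def)
    qed
    ultimately show ?thesis by (auto simp: r(4) radial_kernel_matrix_def norm_minus_commute)
  next
    assume c: "C_class (p + 1) k" "K = kernel_matrix n x k" "analytic_matrix_at_0 n K"
    then show ?thesis using C_class_mono[OF c(1), of p] ksym by (auto simp: kernel_matrix_def)
  qed
  then have C: "C_class p k" and Kc: "\<And>\<epsilon>. K \<epsilon> \<in> carrier_mat n n"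
    and Ksym: "\<And>\<epsilon> a b. a < n \<Longrightarrow> b < n \<Longrightarrow> K \<epsilon> $$ (a, b) = K \<epsilon> $$ (b, a)"
    and Kan: "analytic_matrix_at_0 n K"
    and Kk: "\<And>\<epsilon> a b. \<epsilon> > 0 \<Longrightarrow> a < n \<Longrightarrow> b < n \<Longrightarrow> K \<epsilon> $$ (a, b) = k (\<epsilon> *\<^sub>R x a) (\<epsilon> *\<^sub>R x b)"
    by blast+
  define b where "b = rank_jump mons n x"
  define H where "H = H_matrix mons k p R"
  define q where "q a A = hcat n (map Q [0..<Suc p]) $$ (a, A)" for a A
  define d where "d = block_of b"
  note facts = block_QR_facts[OF assms(7), folded b_def q_def]
  have n: "n = offset b (Suc p)" by (rule facts(1))
  have Hc: "H \<in> carrier_mat n n"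
    unfolding n H_def
    using assms(7) by (intro H_matrix_carrier_index(1)) (auto simp: block_QR_def Let_def b_def)
  have lim: "((\<lambda>\<epsilon>. (\<Sum>a<n. \<Sum>a'<n. q a A * q a' B * k (\<epsilon> *\<^sub>R x a) (\<epsilon> *\<^sub>R x a')) / \<epsilon> ^ (d A + d B)) \<longlongrightarrow> H $$ (A, B)) (at_right 0)"
    if "A < n" "B < n" for A B
    using H_matrix_limit[OF assms(7,2) C that] unfolding H_def d_def b_def q_def .
  have Hsym: "H $$ (A, B) = H $$ (B, A)" if "A < n" "B < n" for A B
  proof -
    have "(\<Sum>a<n. \<Sum>a'<n. q a A * q a' B * k (\<epsilon> *\<^sub>R x a) (\<epsilon> *\<^sub>R x a')) = (\<Sum>a<n. \<Sum>a'<n. q a B * q a' A * k (\<epsilon> *\<^sub>R x a) (\<epsilon> *\<^sub>R x a'))" for \<epsilon>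
      by (subst sum.swap, intro sum.cong refl) (subst ksym, simp)
    then show ?thesis
      using lim[OF that] lim[OF that(2,1)] by (intro tendsto_unique[OF trivial_limit_at_right_real]) (simp_all add: add.commute)
  qed
  have psd: "0 \<le> (\<Sum>A<n. \<Sum>B<n. y A * H $$ (A, B) * y B)" for y
  proof (rule tendsto_lowerbound)
    show "((\<lambda>\<epsilon>. \<Sum>A<n. \<Sum>B<n. y A * ((\<Sum>a<n. \<Sum>a'<n. q a A * q a' B * k (\<epsilon> *\<^sub>R x a) (\<epsilon> *\<^sub>R x a')) / \<epsilon> ^ (d A + d B)) * y B) \<longlongrightarrow>
        (\<Sum>A<n. \<Sum>B<n. y A * H $$ (A, B) * y B)) (at_right 0)"
      by (intro tendsto_sum tendsto_mult tendsto_const lim) auto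
    show "\<forall>\<^sub>F \<epsilon> in at_right 0. 0 \<le> (\<Sum>A<n. \<Sum>B<n. y A * ((\<Sum>a<n. \<Sum>a'<n. q a A * q a' B * k (\<epsilon> *\<^sub>R x a) (\<epsilon> *\<^sub>R x a')) / \<epsilon> ^ (d A + d B)) * y B)"
    proof (rule always_eventually, rule allI)
      fix \<epsilon>
      \<comment> \<open>Summed over A, this is the coefficient at node a of the vector Q D^-1 y. The
        form below is thus a kernel form on the scaled nodes.\<close>
      define Y where "Y a A = y A * q a A / \<epsilon> ^ d A" for a A
      define \<kappa> where "\<kappa> a a' = k (\<epsilon> *\<^sub>R x a) (\<epsilon> *\<^sub>R x a')" for a a'
      have "(\<Sum>A<n. \<Sum>B<n. y A * ((\<Sum>a<n. \<Sum>a'<n. q a A * q a' B * \<kappa> a a') / \<epsilon> ^ (d A + d B)) * y B) =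
          (\<Sum>A<n. \<Sum>B<n. \<Sum>a<n. \<Sum>a'<n. Y a A * Y a' B * \<kappa> a a')"
        by (intro sum.cong refl) (simp add: Y_def sum_distrib_left sum_distrib_right sum_divide_distrib power_add mult_ac)
      also have "\<dots> = (\<Sum>A<n. \<Sum>a<n. \<Sum>B<n. \<Sum>a'<n. Y a A * Y a' B * \<kappa> a a')"
        by (rule sum.cong[OF refl], rule sum.swap)
      also have "\<dots> = (\<Sum>a<n. \<Sum>A<n. \<Sum>a'<n. \<Sum>B<n. Y a A * Y a' B * \<kappa> a a')"
        by (rule trans[OF sum.swap], rule sum.cong[OF refl], rule sum.cong[OF refl], rule sum.swap)
      also have "\<dots> = (\<Sum>a<n. \<Sum>a'<n. \<Sum>A<n. \<Sum>B<n. Y a A * Y a' B * \<kappa> a a')"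
        by (rule sum.cong[OF refl], rule sum.swap)
      also have "\<dots> = (\<Sum>a<n. \<Sum>a'<n. (\<Sum>A<n. Y a A) * (\<Sum>B<n. Y a' B) * \<kappa> a a')"
        by (rule sum.cong[OF refl], rule sum.cong[OF refl], subst sum_product) (simp only: sum_distrib_right)
      also have "\<dots> \<ge> 0"
        unfolding \<kappa>_def by (rule positive_definite_kernel_form_nonneg[OF assms(5)])
      finally show "0 \<le> (\<Sum>A<n. \<Sum>B<n. y A * ((\<Sum>a<n. \<Sum>a'<n. q a A * q a' B * k (\<epsilon> *\<^sub>R x a) (\<epsilon> *\<^sub>R x a')) / \<epsilon> ^ (d A + d B)) * y B)"
        unfolding \<kappa>_def .
    qed
  qed (rule trivial_limit_at_right_real)
  \<comment> \<open>The inverse provided by \<open>invertible_mat\<close> comes without dimensions.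
    They are read off from the two products before G is applied to H y = 0.\<close>
  have nonsing: "y C = 0" if y: "\<And>A. A < n \<Longrightarrow> (\<Sum>B<n. H $$ (A, B) * y B) = 0" and C: "C < n" for y C
  proof -
    obtain G where G: "H * G = 1\<^sub>m n" "G * H = 1\<^sub>m (dim_row G)"
      using assms(8) Hc unfolding invertible_mat_def inverts_mat_def H_def[symmetric] by auto
    have "dim_col G = n" using arg_cong[OF G(1), of dim_col] by simp
    moreover have "dim_row G = n" using arg_cong[OF G(2), of dim_col] Hc by simp
    ultimately have Gc: "G \<in> carrier_mat n n" by auto
    have "y C = (\<Sum>B<n. (if C = B then 1 else 0) * y B)" by (rule sum_delta_mult(1)[symmetric]) (use C in auto)
    also have "\<dots> = (\<Sum>B<n. (\<Sum>A<n. G $$ (C, A) * H $$ (A, B)) * y B)"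
    proof (intro sum.cong refl)
      fix B assume "B \<in> {..<n}"
      then have "(\<Sum>A<n. G $$ (C, A) * H $$ (A, B)) = (G * H) $$ (C, B)"
        using C by (intro mat_mult_index[OF Gc Hc, symmetric]) auto
      then show "(if C = B then 1 else 0) * y B = (\<Sum>A<n. G $$ (C, A) * H $$ (A, B)) * y B"
        using G(2) Gc C \<open>B \<in> {..<n}\<close> by simp
    qed
    also have "\<dots> = (\<Sum>A<n. G $$ (C, A) * (\<Sum>B<n. H $$ (A, B) * y B))"
      unfolding sum_distrib_left sum_distrib_right mult.assoc by (rule sum.swap)
    also have "\<dots> = 0" using y by simp
    finally show ?thesis .
  qed
  obtain c where c: "c > 0" and coercive: "\<And>y. c * (\<Sum>a<n. (y a)\<^sup>2) \<le> (\<Sum>a<n. \<Sum>b<n. y a * H $$ (a, b) * y b)"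
  proof -
    have "\<exists>c>0. \<forall>y. c * (\<Sum>a<n. (y a)\<^sup>2) \<le> (\<Sum>a<n. \<Sum>b<n. y a * H $$ (a, b) * y b)"
    proof (rule psd_nonsingular_imp_coercive[of n "\<lambda>A B. H $$ (A, B)"])
      show "H $$ (A, B) = H $$ (B, A)" if "A < n" "B < n" for A B using that by (rule Hsym)
      show "0 \<le> (\<Sum>A<n. \<Sum>B<n. y A * H $$ (A, B) * y B)" for y by (rule psd)
      show "y C = 0" if "\<And>A. A < n \<Longrightarrow> (\<Sum>B<n. H $$ (A, B) * y B) = 0" "C < n" for y C
        using that by (rule nonsing)
    qed
    then show ?thesis using that by blast
  qed
  \<comment> \<open>The Schur complements are put into global indices. An entry is meaningful only
    when A and B lie in the same block, and only such pairs are summed.\<close>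
  define S where "S A B = schur_complement b H (d A) $$ (A - offset b (d A), B - offset b (d A))" for A B
  have d_off: "d (offset b i + \<alpha>) = i" if "\<alpha> < b i" for i \<alpha>
    using block_of_offset[of \<alpha> b i] that by (simp add: d_def)
  have block: "{B. B < n \<and> d B = i} = (\<lambda>\<beta>. offset b i + \<beta>) ` {..<b i}" if "i \<le> p" for i
  proof (intro equalityI subsetI)
    fix B assume B: "B \<in> {B. B < n \<and> d B = i}"
    then have "B < offset b (Suc p)" using n by simp
    then obtain j \<beta> where "j < Suc p" "\<beta> < b j" "B = offset b j + \<beta>" by (rule offset_cases)
    then show "B \<in> (\<lambda>\<beta>. offset b i + \<beta>) ` {..<b i}" using B d_off[of \<beta> j] by auto
  next
    fix B assume "B \<in> (\<lambda>\<beta>. offset b i + \<beta>) ` {..<b i}"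
    then obtain \<beta> where \<beta>: "\<beta> < b i" "B = offset b i + \<beta>" by auto
    have "B < n" unfolding n \<beta>(2) using \<beta>(1) that by (intro offset_less) auto
    then show "B \<in> {B. B < n \<and> d B = i}" using \<beta> d_off by simp
  qed
  have below: "{r. r < n \<and> d r < i} = {..<offset b i}" if "i \<le> p" for i
  proof -
    have "offset b i \<le> n" unfolding n using that by (intro offset_mono) simp
    then show ?thesis
      using block_of_less_iff[of _ b "Suc p" i] unfolding n[symmetric] d_def by auto
  qed
  have schur: "\<exists>t. (\<forall>B<n. d B < d A \<longrightarrow> H $$ (A, B) + (\<Sum>r\<in>{r. r < n \<and> d r < d A}. t r * H $$ (r, B)) = 0) \<and>
      (\<forall>B<n. d B = d A \<longrightarrow> S A B = H $$ (A, B) + (\<Sum>r\<in>{r. r < n \<and> d r < d A}. t r * H $$ (r, B)))"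
    if A: "A < n" for A
  proof -
    obtain i \<alpha> where i: "i < Suc p" "\<alpha> < b i" "A = offset b i + \<alpha>"
      using A unfolding n by (rule offset_cases)
    have dA: "d A = i" using i d_off by simp
    obtain t where t: "\<And>B. B < offset b i \<Longrightarrow> H $$ (offset b i + \<alpha>, B) + (\<Sum>r<offset b i. t r * H $$ (r, B)) = 0"
      "\<And>\<beta>. \<beta> < b i \<Longrightarrow> schur_complement b H i $$ (\<alpha>, \<beta>) =
         H $$ (offset b i + \<alpha>, offset b i + \<beta>) + (\<Sum>r<offset b i. t r * H $$ (r, offset b i + \<beta>))"
      using schur_complement_row[OF Hc n Hsym c coercive i(1,2)] by blast
    show ?thesis
      unfolding dA below[OF less_Suc_eq_le[THEN iffD1, OF i(1)]]
    proof (intro exI[of _ t] conjI allI impI)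
      fix B assume "B < n" "d B < i"
      then have "B \<in> {r. r < n \<and> d r < i}" by simp
      then have "B < offset b i" using below[of i] i(1) by auto
      then show "H $$ (A, B) + (\<Sum>r<offset b i. t r * H $$ (r, B)) = 0" unfolding i(3) by (rule t(1))
    next
      fix B assume "B < n" "d B = i"
      then have "B \<in> {B. B < n \<and> d B = i}" by simp
      then obtain \<beta> where \<beta>: "\<beta> < b i" "B = offset b i + \<beta>" using block[of i] i(1) by auto
      show "S A B = H $$ (A, B) + (\<Sum>r<offset b i. t r * H $$ (r, B))"
        unfolding S_def dA using t(2)[OF \<beta>(1)] by (simp add: i(3) \<beta>(2))
    qed
  qed
  have Sc: "schur_complement b H i \<in> carrier_mat (b i) (b i)" for i
    by (rule schur_complement_carrier)
  have Qc: "Q i \<in> carrier_mat n (b i)" if "i \<le> p" for i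
    using assms(7) that unfolding block_QR_def Let_def b_def[symmetric] by blast
  have rhs: "(\<Sum>A<n. \<Sum>B\<in>{B. B < n \<and> d B = d A}. \<epsilon> ^ (2 * d A) * (q r A * S A B * q s B)) =
      (\<Sum>i\<le>p. (\<epsilon> ^ (2 * i) \<cdot>\<^sub>m (Q i * schur_complement b H i * transpose_mat (Q i))) $$ (r, s))"
    if rs: "r < n" "s < n" for \<epsilon> r s
  proof -
    have "(\<Sum>A<n. \<Sum>B\<in>{B. B < n \<and> d B = d A}. \<epsilon> ^ (2 * d A) * (q r A * S A B * q s B)) =
        (\<Sum>i<Suc p. \<Sum>\<alpha><b i. \<Sum>B\<in>{B. B < n \<and> d B = d (offset b i + \<alpha>)}.
          \<epsilon> ^ (2 * d (offset b i + \<alpha>)) * (q r (offset b i + \<alpha>) * S (offset b i + \<alpha>) B * q s B))"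
      using sum_offset[of "\<lambda>A. \<Sum>B\<in>{B. B < n \<and> d B = d A}. \<epsilon> ^ (2 * d A) * (q r A * S A B * q s B)" b "Suc p"]
      unfolding n[symmetric] .
    also have "\<dots> = (\<Sum>i<Suc p. \<Sum>\<alpha><b i. \<Sum>\<beta><b i. \<epsilon> ^ (2 * i) * (Q i $$ (r, \<alpha>) * schur_complement b H i $$ (\<alpha>, \<beta>) * Q i $$ (s, \<beta>)))"
    proof (intro sum.cong[OF refl])
      fix i \<alpha> assume i: "i \<in> {..<Suc p}" and \<alpha>: "\<alpha> \<in> {..<b i}"
      have di: "d (offset b i + \<alpha>) = i" using \<alpha> d_off by simp
      have "(\<Sum>B\<in>{B. B < n \<and> d B = i}. \<epsilon> ^ (2 * i) * (q r (offset b i + \<alpha>) * S (offset b i + \<alpha>) B * q s B)) =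
          (\<Sum>\<beta><b i. \<epsilon> ^ (2 * i) * (q r (offset b i + \<alpha>) * S (offset b i + \<alpha>) (offset b i + \<beta>) * q s (offset b i + \<beta>)))"
        using i by (subst block) (auto simp: sum.reindex inj_on_def)
      also have "\<dots> = (\<Sum>\<beta><b i. \<epsilon> ^ (2 * i) * (Q i $$ (r, \<alpha>) * schur_complement b H i $$ (\<alpha>, \<beta>) * Q i $$ (s, \<beta>)))"
        using facts(3) i \<alpha> rs di by (intro sum.cong refl) (simp add: S_def)
      finally show "(\<Sum>B\<in>{B. B < n \<and> d B = d (offset b i + \<alpha>)}.
          \<epsilon> ^ (2 * d (offset b i + \<alpha>)) * (q r (offset b i + \<alpha>) * S (offset b i + \<alpha>) B * q s B)) =
          (\<Sum>\<beta><b i. \<epsilon> ^ (2 * i) * (Q i $$ (r, \<alpha>) * schur_complement b H i $$ (\<alpha>, \<beta>) * Q i $$ (s, \<beta>)))"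
        unfolding di .
    qed
    also have "\<dots> = (\<Sum>i<Suc p. (\<epsilon> ^ (2 * i) \<cdot>\<^sub>m (Q i * schur_complement b H i * transpose_mat (Q i))) $$ (r, s))"
    proof (rule sum.cong[OF refl])
      fix i assume "i \<in> {..<Suc p}"
      then have Qi: "Q i \<in> carrier_mat n (b i)" by (intro Qc) simp
      have QS: "Q i * schur_complement b H i \<in> carrier_mat n (b i)" using Qi Sc by (rule mult_carrier_mat)
      have Qt: "transpose_mat (Q i) \<in> carrier_mat (b i) n" using Qi by simp
      have "(Q i * schur_complement b H i * transpose_mat (Q i)) $$ (r, s) =
          (\<Sum>\<beta><b i. (Q i * schur_complement b H i) $$ (r, \<beta>) * transpose_mat (Q i) $$ (\<beta>, s))"
        by (rule mat_mult_index[OF QS Qt rs])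
      also have "\<dots> = (\<Sum>\<beta><b i. (\<Sum>\<alpha><b i. Q i $$ (r, \<alpha>) * schur_complement b H i $$ (\<alpha>, \<beta>)) * Q i $$ (s, \<beta>))"
        using Qi rs by (intro sum.cong refl) (simp add: mat_mult_index[OF Qi Sc rs(1)])
      also have "\<dots> = (\<Sum>\<alpha><b i. \<Sum>\<beta><b i. Q i $$ (r, \<alpha>) * schur_complement b H i $$ (\<alpha>, \<beta>) * Q i $$ (s, \<beta>))"
        unfolding sum_distrib_right by (rule sum.swap)
      finally have "(Q i * schur_complement b H i * transpose_mat (Q i)) $$ (r, s) =
        (\<Sum>\<alpha><b i. \<Sum>\<beta><b i. Q i $$ (r, \<alpha>) * schur_complement b H i $$ (\<alpha>, \<beta>) * Q i $$ (s, \<beta>))" .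
      moreover have "(\<epsilon> ^ (2 * i) \<cdot>\<^sub>m (Q i * schur_complement b H i * transpose_mat (Q i))) $$ (r, s) =
          \<epsilon> ^ (2 * i) * (Q i * schur_complement b H i * transpose_mat (Q i)) $$ (r, s)"
        using mult_carrier_mat[OF QS Qt] rs by (intro index_smult_mat(1)) auto
      ultimately show "(\<Sum>\<alpha><b i. \<Sum>\<beta><b i. \<epsilon> ^ (2 * i) * (Q i $$ (r, \<alpha>) * schur_complement b H i $$ (\<alpha>, \<beta>) * Q i $$ (s, \<beta>))) =
          (\<epsilon> ^ (2 * i) \<cdot>\<^sub>m (Q i * schur_complement b H i * transpose_mat (Q i))) $$ (r, s)"
        by (simp only: sum_distrib_left)
    qed
    finally show ?thesis by (simp only: lessThan_Suc_atMost)
  qed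
  have "(\<lambda>\<epsilon>. matrix_sum n n (\<lambda>i. \<epsilon> ^ (2 * i) \<cdot>\<^sub>m (Q i * schur_complement b H i * transpose_mat (Q i))) {..p}) =
      (\<lambda>\<epsilon>. matrix_sum n n (\<lambda>k. leading_term (ev k) \<epsilon> \<cdot>\<^sub>m outer_prod (u k 0) (u k 0)) {..<n})"
    if sys: "analytic_eigensystem n K ev u" for ev u
  proof (rule ext, rule eq_matI)
    fix \<epsilon> r s
    assume "r < dim_row (matrix_sum n n (\<lambda>k. leading_term (ev k) \<epsilon> \<cdot>\<^sub>m outer_prod (u k 0) (u k 0)) {..<n})"
      "s < dim_col (matrix_sum n n (\<lambda>k. leading_term (ev k) \<epsilon> \<cdot>\<^sub>m outer_prod (u k 0) (u k 0)) {..<n})"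
    then have rs: "r < n" "s < n" by (simp_all add: matrix_sum_def)
    have uc: "dim_vec (u k \<epsilon>) = n" if "k < n" for k \<epsilon>
      using sys that unfolding analytic_eigensystem_def by auto
    define E where "E k = taylor_fps (ev k)" for k
    have ev: "ev k has_fps_expansion E k" if k: "k < n" for k
    proof -
      have "\<exists>F. ev k has_fps_expansion F"
        using sys k by (simp add: analytic_eigensystem_def analytic_at_0_def)
      then obtain F where F: "ev k has_fps_expansion F" by blast
      then show ?thesis by (simp add: E_def taylor_fps_eq[OF F])
    qed
    have u: "((\<lambda>\<epsilon>. u k \<epsilon> $ a) \<longlongrightarrow> u k 0 $ a) (at_right 0)" if "k < n" "a < n" for k a
    proof -
      have "\<exists>F. (\<lambda>\<epsilon>. u k \<epsilon> $ a) has_fps_expansion F"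
        using sys that by (simp add: analytic_eigensystem_def analytic_at_0_def)
      then obtain F where "(\<lambda>\<epsilon>. u k \<epsilon> $ a) has_fps_expansion F" by blast
      then show ?thesis by (rule has_fps_expansion_tendsto)
    qed
    have near: "\<forall>\<^sub>F \<epsilon> in at_right 0. (\<forall>k<n. K \<epsilon> *\<^sub>v u k \<epsilon> = ev k \<epsilon> \<cdot>\<^sub>v u k \<epsilon>) \<and>
        (\<forall>k<n. \<forall>l<n. scalar_prod (u k \<epsilon>) (u l \<epsilon>) = (if k = l then 1 else 0))"
      by (rule filter_leD[OF at_within_le_nhds]) (use sys in \<open>simp add: analytic_eigensystem_def\<close>)
    have orth: "\<forall>\<^sub>F \<epsilon> in at_right 0. \<forall>k<n. \<forall>l<n. (\<Sum>a<n. u k \<epsilon> $ a * u l \<epsilon> $ a) = (if k = l then 1 else 0)"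
      using near
    proof eventually_elim
      case (elim \<epsilon>)
      show ?case
      proof (intro allI impI)
        fix k l assume kl: "k < n" "l < n"
        have "(\<Sum>a<n. u k \<epsilon> $ a * u l \<epsilon> $ a) = scalar_prod (u k \<epsilon>) (u l \<epsilon>)"
          using uc[OF kl(2)] by (simp add: scalar_prod_def atLeast0LessThan)
        then show "(\<Sum>a<n. u k \<epsilon> $ a * u l \<epsilon> $ a) = (if k = l then 1 else 0)" using elim kl by simp
      qed
    qed
    \<comment> \<open>For \<epsilon> > 0 the entries of K are kernel values, so the eigenvalue
      equation of the analytic matrix applies to the matrix whose scaled limit is H.\<close>
    have eigen: "\<forall>\<^sub>F \<epsilon> in at_right 0. \<forall>j<n. \<forall>a<n. (\<Sum>b<n. k (\<epsilon> *\<^sub>R x a) (\<epsilon> *\<^sub>R x b) * u j \<epsilon> $ b) = ev j \<epsilon> * u j \<epsilon> $ a"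
      using near eventually_at_right_less
    proof eventually_elim
      case (elim \<epsilon>)
      show ?case
      proof (intro allI impI)
        fix j a assume ja: "j < n" "a < n"
        have "(\<Sum>b<n. k (\<epsilon> *\<^sub>R x a) (\<epsilon> *\<^sub>R x b) * u j \<epsilon> $ b) = (\<Sum>b<n. K \<epsilon> $$ (a, b) * u j \<epsilon> $ b)"
          using Kk[of \<epsilon> a] elim ja by simp
        also have "\<dots> = (K \<epsilon> *\<^sub>v u j \<epsilon>) $ a"
          using Kc[of \<epsilon>] uc[OF ja(1)] ja by (simp add: scalar_prod_def atLeast0LessThan)
        also have "\<dots> = ev j \<epsilon> * u j \<epsilon> $ a" using elim ja uc[OF ja(1)] by simp
        finally show "(\<Sum>b<n. k (\<epsilon> *\<^sub>R x a) (\<epsilon> *\<^sub>R x b) * u j \<epsilon> $ b) = ev j \<epsilon> * u j \<epsilon> $ a" .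
      qed
    qed
    have "(\<Sum>k<n. leading_term (ev k) \<epsilon> * (u k 0 $ r * u k 0 $ s)) =
        (\<Sum>A<n. \<Sum>B\<in>{B. B < n \<and> d B = d A}. \<epsilon> ^ (2 * d A) * (q r A * S A B * q s B))"
      by (rule sum_leading_terms_eq[where H = "\<lambda>A B. H $$ (A, B)" and K = "\<lambda>\<epsilon> a b. k (\<epsilon> *\<^sub>R x a) (\<epsilon> *\<^sub>R x b)"
            and u = "\<lambda>k \<epsilon> a. u k \<epsilon> $ a" and ?u0.0 = "\<lambda>k a. u k 0 $ a" and E = E and c = c,
            OF facts(2) lim c coercive schur ev u orth eigen rs])
    then show "matrix_sum n n (\<lambda>i. \<epsilon> ^ (2 * i) \<cdot>\<^sub>m (Q i * schur_complement b H i * transpose_mat (Q i))) {..p} $$ (r, s) =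
        matrix_sum n n (\<lambda>k. leading_term (ev k) \<epsilon> \<cdot>\<^sub>m outer_prod (u k 0) (u k 0)) {..<n} $$ (r, s)"
      unfolding rhs[OF rs] using rs uc by (simp add: matrix_sum_def outer_prod_def)
  qed (simp_all add: matrix_sum_def)
  moreover have "\<exists>ev u. analytic_eigensystem n K ev u"
    by (rule analytic_eigensystem_exists[OF Kc Ksym Kan])
  ultimately show ?thesis unfolding is_ASE_def b_def H_def by blast
qed

end
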